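(* Let $(X,d)$ be a separable ultra-metric space in which all closed balls are compact, let $\mu$ be a Radon measure on $X$ with full support, let $\sigma$ be a distance distribution function, and let $\{P^t\}_{t\ge0}$ be the isotropic semigroup associated with $(d,\mu,\sigma)$. For $1\le p<\infty$ let $\mathcal{L}_p$ be the generator of the extension of $\{P^t\}$ to a continuous contraction semigroup on $L^p(X,\mu)$. Then for all $1\le p<\infty$ $$\operatorname{spec}\mathcal{L}_p=\operatorname{spec}\mathcal{L}_2.$$
   Context: Closed balls: $B_r(x)=\{y:d(x,y)\le r\}$; $\mathrm{Q}_rf(x)=\frac1{\mu(B_r(x))}\int_{B_r(x)}f\,d\mu$. A distance distribution function is a strictly increasing left-continuous function $\sigma:[0,\infty]\to[0,1]$ with $\sigma(0+)=0$, $\sigma(\infty)=1$. The isotropic Markov operator associated with $(d,\mu,\sigma)$ is $P=\int_{[0,\infty)}\mathrm{Q}_r\,d\sigma(r)$, self-adjoint in $L^2(X,\mu)$ with spectrum in $[0,1]$; the isotropic semigroup is $\{P^t\}_{t\ge0}$ (powers by functional calculus), a symmetric Markov semigroup. Any continuous symmetric Markov semigroup on $L^2$ extends to all $L^p$, $1\le p<\infty$, as a continuous contraction semigroup. Sign convention: the generator of a strongly continuous semigroup $\{P^t\}$ on a Banach space is $\mathcal{L}f=\lim_{t\to0}\frac{f-P^tf}{t}$ (strong limit), with domain the set of $f$ for which the limit exists. *)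

theory Defs
  imports "HOL-Analysis.Analysis" "HOL-Computational_Algebra.Polynomial"
begin

text \<open>The space is the whole type, of class \<^class>\<open>metric_space\<close>.  Separability is expressed, as in the
  library's class \<^class>\<open>polish_space\<close>, by \<^class>\<open>second_countable_topology\<close>.\<close>

definition ultrametric :: "'a::metric_space itself \<Rightarrow> bool" where
  "ultrametric _ \<longleftrightarrow> (\<forall>x y z :: 'a. dist x z \<le> max (dist x y) (dist y z))"

definition radon_measure :: "'a::topological_space measure \<Rightarrow> bool" where
  "radon_measure M \<longleftrightarrow>
     sets M = sets borel \<and>
     (\<forall>K. compact K \<longrightarrow> emeasure M K < \<infinity>) \<and>
     (\<forall>A\<in>sets borel. emeasure M A = (INF U\<in>{U. open U \<and> A \<subseteq> U}. emeasure M U)) \<and>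
     (\<forall>U. open U \<longrightarrow> emeasure M U = (SUP K\<in>{K. compact K \<and> K \<subseteq> U}. emeasure M K))"

definition full_support :: "'a::topological_space measure \<Rightarrow> bool" where
  "full_support M \<longleftrightarrow> (\<forall>U. open U \<longrightarrow> U \<noteq> {} \<longrightarrow> emeasure M U > 0)"

text \<open>The type \<^typ>\<open>ennreal\<close> is the extended half-line \<open>[0, \<infinity>]\<close>; left continuity
  includes the point \<open>\<infinity>\<close>.\<close>

definition distance_distribution :: "(ennreal \<Rightarrow> real) \<Rightarrow> bool" where
  "distance_distribution \<sigma> \<longleftrightarrow>
     range \<sigma> \<subseteq> {0..1} \<and> strict_mono \<sigma> \<and>
     (\<forall>r. (\<sigma> \<longlongrightarrow> \<sigma> r) (at_left r)) \<and>
     (\<sigma> \<longlongrightarrow> 0) (at_right 0) \<and> \<sigma> \<infinity> = 1"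

text \<open>The Stieltjes measure \<open>d\<sigma>\<close>, which gives \<open>[a, b)\<close> the mass \<open>\<sigma> b - \<sigma> a\<close> for \<open>0 \<le> a \<le> b\<close>.
  Since \<^const>\<open>interval_measure\<close> expects a right-continuous function, it is applied to
  \<open>r \<mapsto> \<sigma>(r+)\<close>, extended by \<open>0\<close> to the negative half-line.\<close>

definition stieltjes_measure :: "(ennreal \<Rightarrow> real) \<Rightarrow> real measure" where
  "stieltjes_measure \<sigma> =
     interval_measure (\<lambda>r. if r < 0 then 0 else Lim (at_right (ennreal r)) \<sigma>)"


text \<open>Elements of \<open>L\<^sup>p\<close> (complex-valued, \<open>1 \<le> p < \<infinity>\<close>) are represented by functions, and equality
  in \<open>L\<^sup>p\<close> is equality almost everywhere.\<close>

definition Lp_space :: "'a measure \<Rightarrow> real \<Rightarrow> ('a \<Rightarrow> complex) set" where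
  "Lp_space M p = {f \<in> borel_measurable M. integrable M (\<lambda>x. norm (f x) powr p)}"

definition Lp_norm :: "'a measure \<Rightarrow> real \<Rightarrow> ('a \<Rightarrow> complex) \<Rightarrow> real" where
  "Lp_norm M p f = (LINT x|M. norm (f x) powr p) powr (1 / p)"

type_synonym 'a oper = "('a \<Rightarrow> complex) \<Rightarrow> ('a \<Rightarrow> complex)"

definition Lp_bounded_linear :: "'a measure \<Rightarrow> real \<Rightarrow> 'a oper \<Rightarrow> bool" where
  "Lp_bounded_linear M p T \<longleftrightarrow>
     (\<forall>f\<in>Lp_space M p. T f \<in> Lp_space M p) \<and>
     (\<forall>f\<in>Lp_space M p. \<forall>g\<in>Lp_space M p. AE x in M. T (\<lambda>y. f y + g y) x = T f x + T g x) \<and>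
     (\<forall>c. \<forall>f\<in>Lp_space M p. AE x in M. T (\<lambda>y. c * f y) x = c * T f x) \<and>
     (\<exists>C. \<forall>f\<in>Lp_space M p. Lp_norm M p (T f) \<le> C * Lp_norm M p f)"

definition Lp_contraction_semigroup :: "'a measure \<Rightarrow> real \<Rightarrow> (real \<Rightarrow> 'a oper) \<Rightarrow> bool" where
  "Lp_contraction_semigroup M p T \<longleftrightarrow>
     (\<forall>t\<ge>0. Lp_bounded_linear M p (T t)) \<and>
     (\<forall>t\<ge>0. \<forall>f\<in>Lp_space M p. Lp_norm M p (T t f) \<le> Lp_norm M p f) \<and>
     (\<forall>f\<in>Lp_space M p. AE x in M. T 0 f x = f x) \<and>
     (\<forall>s\<ge>0. \<forall>t\<ge>0. \<forall>f\<in>Lp_space M p. AE x in M. T (s + t) f x = T s (T t f) x) \<and>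
     (\<forall>f\<in>Lp_space M p. ((\<lambda>t. Lp_norm M p (\<lambda>x. T t f x - f x)) \<longlongrightarrow> 0) (at_right 0))"

text \<open>The graph of the generator \<open>f \<mapsto> lim (f - T t f) / t\<close> as \<open>t \<rightarrow> 0+\<close>; its domain is the set of
  \<open>f\<close> for which the limit exists in \<open>L\<^sup>p\<close>.\<close>

definition Lp_generator ::
    "'a measure \<Rightarrow> real \<Rightarrow> (real \<Rightarrow> 'a oper) \<Rightarrow> (('a \<Rightarrow> complex) \<times> ('a \<Rightarrow> complex)) set" where
  "Lp_generator M p T =
     {(f, g). f \<in> Lp_space M p \<and> g \<in> Lp_space M p \<and>
        ((\<lambda>t. Lp_norm M p (\<lambda>x. (f x - T t f x) / complex_of_real t - g x)) \<longlongrightarrow> 0) (at_right 0)}"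

text \<open>For an operator given by its graph \<open>G\<close>, the number \<open>z\<close> lies in the resolvent set iff
  \<open>z - G\<close> has a bounded everywhere defined two-sided inverse \<open>R\<close>.\<close>

definition Lp_resolvent_set ::
    "'a measure \<Rightarrow> real \<Rightarrow> (('a \<Rightarrow> complex) \<times> ('a \<Rightarrow> complex)) set \<Rightarrow> complex set" where
  "Lp_resolvent_set M p G =
     {z. \<exists>R. Lp_bounded_linear M p R \<and>
        (\<forall>(f, g)\<in>G. AE x in M. R (\<lambda>y. z * f y - g y) x = f x) \<and>
        (\<forall>h\<in>Lp_space M p. (R h, \<lambda>x. z * R h x - h x) \<in> G)}"

definition Lp_spectrum ::
    "'a measure \<Rightarrow> real \<Rightarrow> (('a \<Rightarrow> complex) \<times> ('a \<Rightarrow> complex)) set \<Rightarrow> complex set" where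
  "Lp_spectrum M p G = - Lp_resolvent_set M p G"


definition ball_average :: "'a::metric_space measure \<Rightarrow> real \<Rightarrow> 'a oper" where
  "ball_average M r f x = (1 / measure M (cball x r)) *\<^sub>R (LINT y:cball x r|M. f y)"

text \<open>For \<open>f\<close> in \<open>L\<^sup>2\<close> the integral over \<open>r\<close> converges for almost every \<open>x\<close>.\<close>

definition isotropic_markov_operator ::
    "'a::metric_space measure \<Rightarrow> (ennreal \<Rightarrow> real) \<Rightarrow> 'a oper" where
  "isotropic_markov_operator M \<sigma> f x = (LINT r:{0..}|stieltjes_measure \<sigma>. ball_average M r f x)"

definition poly_operator :: "real poly \<Rightarrow> 'a oper \<Rightarrow> 'a oper" where
  "poly_operator q A f x = (\<Sum>i\<le>degree q. complex_of_real (coeff q i) * (A ^^ i) f x)"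

text \<open>Continuous functional calculus on \<open>L\<^sup>2\<close> for an operator \<open>A\<close> that is self-adjoint with spectrum
  in \<open>[0, 1]\<close>: \<open>T\<close> is \<open>\<phi>(A)\<close>, the limit in operator norm of \<open>q\<^sub>n(A)\<close> whenever the polynomials
  \<open>q\<^sub>n\<close> converge to \<open>\<phi>\<close> uniformly on \<open>[0, 1]\<close>.\<close>

definition is_functional_calculus ::
    "'a measure \<Rightarrow> 'a oper \<Rightarrow> (real \<Rightarrow> real) \<Rightarrow> 'a oper \<Rightarrow> bool" where
  "is_functional_calculus M A \<phi> T \<longleftrightarrow>
     Lp_bounded_linear M 2 T \<and>
     (\<forall>q :: nat \<Rightarrow> real poly. uniform_limit {0..1} (\<lambda>n. poly (q n)) \<phi> sequentially \<longrightarrow>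
        (\<forall>\<epsilon>>0. \<forall>\<^sub>F n in sequentially. \<forall>f\<in>Lp_space M 2.
           Lp_norm M 2 (\<lambda>x. poly_operator (q n) A f x - T f x) \<le> \<epsilon> * Lp_norm M 2 f))"

text \<open>\<open>P\<^sup>t\<close>, determined up to equality almost everywhere.  The case \<open>t = 0\<close> is separate because
  \<^term>\<open>0 powr 0 = (0::real)\<close>, whereas \<open>P\<^sup>0\<close> is the identity.\<close>

definition isotropic_semigroup ::
    "'a::metric_space measure \<Rightarrow> (ennreal \<Rightarrow> real) \<Rightarrow> real \<Rightarrow> 'a oper" where
  "isotropic_semigroup M \<sigma> t =
     (SOME T. is_functional_calculus M (isotropic_markov_operator M \<sigma>)
        (\<lambda>s. if t = 0 then 1 else s powr t) T)"

text \<open>Since \<open>L\<^sup>2 \<inter> L\<^sup>p\<close> is dense in \<open>L\<^sup>p\<close>, the extension is determined up to equality almost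
  everywhere.\<close>

definition isotropic_semigroup_Lp ::
    "'a::metric_space measure \<Rightarrow> (ennreal \<Rightarrow> real) \<Rightarrow> real \<Rightarrow> real \<Rightarrow> 'a oper" where
  "isotropic_semigroup_Lp M \<sigma> p =
     (SOME T. Lp_contraction_semigroup M p T \<and>
        (\<forall>t\<ge>0. \<forall>f\<in>Lp_space M 2 \<inter> Lp_space M p.
           AE x in M. T t f x = isotropic_semigroup M \<sigma> t f x))"

definition isotropic_generator ::
    "'a::metric_space measure \<Rightarrow> (ennreal \<Rightarrow> real) \<Rightarrow> real
      \<Rightarrow> (('a \<Rightarrow> complex) \<times> ('a \<Rightarrow> complex)) set" where
  "isotropic_generator M \<sigma> p = Lp_generator M p (isotropic_semigroup_Lp M \<sigma> p)"

end

theory Submission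
  imports Defs "HOL-Probability.Probability"
begin

text \<open>
  For \<open>v > 0\<close> put \<open>rad v = inf {r. \<sigma> r > e\<^sup>-\<^sup>v}\<close> and let \<open>E v\<close> average over the balls of radius \<open>rad v\<close>.
  In an ultrametric space \<open>E v \<circ> E v' = E (min v v')\<close>, and \<open>E\<close> is the spectral family of the
  generator: substituting \<open>\<sigma> r = e\<^sup>-\<^sup>v\<close> turns \<open>P = \<integral> Q\<^sub>r d\<sigma>(r)\<close> into \<open>\<integral> e\<^sup>-\<^sup>v E v dv\<close>, and
  \<open>P\<^sup>t = \<integral> t e\<^sup>-\<^sup>t\<^sup>v E v dv\<close>.  An operator \<open>T w = \<integral> w v E v dv\<close> with integrable \<open>w\<close> is bounded on every
  \<open>L\<^sup>p\<close>, and \<open>w \<mapsto> T w\<close> turns products of the symbols \<open>u \<mapsto> \<integral>\<^sub>u\<^sup>\<infinity> w\<close> into compositions.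

  Every distance \<open>D > 0\<close> gives an eigenvalue \<open>- ln (\<sigma> D)\<close> with an eigenfunction in all \<open>L\<^sup>p\<close>, namely a
  difference of normalized indicators of the closed and the open ball of radius \<open>D\<close>.  If \<open>z\<close> keeps a
  positive distance from these values and from \<open>0\<close>, then \<open>E\<close> is constant near \<open>z\<close>, so the symbol
  \<open>1 / (z - u)\<close> may be modified near its pole without changing the operator; this yields a resolvent
  that is bounded on all \<open>L\<^sup>p\<close>.  Hence for every \<open>p\<close> the spectrum is the closure of
  \<open>{- ln (\<sigma> D)} \<union> {0}\<close>.
\<close>

section \<open>Weighted power means and \<open>L\<^sup>p\<close> norms\<close>

text \<open>Two bounds for \<open>T w\<close> shape the proof. On every \<open>L^p\<close> the norm
  is at most the \<open>L^1\<close> norm of \<open>w\<close>; hence symbols are written as tails of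
  integrable weights, and the resolvent, whose weight decays like \<open>1 / v^2\<close>, works for
  all \<open>p\<close> at once. This bound is too weak to identify \<open>P^t\<close>, which is
  defined on \<open>L^2\<close> through uniform limits of polynomials: there the norm must be
  controlled by the supremum of the symbol. That bound rests on the squared norm of
  \<open>E v f\<close> being increasing in \<open>v\<close>. A tail vanishes at infinity, so
  multiples of the identity have no weight and are carried as separate constants. The unbounded
  generator \<open>L\<close> has no weight either; it is reached through \<open>(1 + L)^-1\<close>,
  with symbol \<open>1 / (1 + u)\<close>, and everything about resolvents becomes an identity
  between bounded operators. Taking the spectral value \<open>v\<close> as the variable, instead of
  the radius, turns \<open>d\<sigma>\<close> into \<open>exp (- v) dv\<close> whatever jumps
  \<open>\<sigma>\<close> has: at a jump \<open>rad\<close> is merely constant on an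
  interval.\<close>

lemma powr_tangent:
  fixes a y p :: real
  assumes "1 \<le> p" "0 < a" "0 \<le> y"
  shows "a powr p + p * a powr (p - 1) * (y - a) \<le> y powr p"
proof (cases "y = 0")
  case True
  then show ?thesis
    using assms powr_add[of a "p - 1" 1] by (auto simp: algebra_simps)
next
  case False
  with assms have y: "y > 0" by simp
  \<comment> \<open>By homogeneity it suffices to treat \<open>a = 1\<close>, where the claim
    \<open>1 + p * (s - 1) \<le> s powr p\<close> is Young's inequality for \<open>s powr p\<close>
    and 1.\<close>
  define s where "s = y / a"
  have s: "s > 0" "y = s * a" using y assms by (auto simp: s_def)
  have "(s powr p) powr (1/p) * 1 powr (1 - 1/p) \<le> (1/p) * s powr p + (1 - 1/p) * 1"
    using assms s by (intro Youngs_inequality_0) auto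
  then have "p * s \<le> p * ((1/p) * s powr p + (1 - 1/p))"
    using assms s by (auto simp: powr_powr)
  then have "1 + p * (s - 1) \<le> s powr p"
    using assms by (simp add: algebra_simps)
  then have "a powr p * (1 + p * (s - 1)) \<le> a powr p * s powr p"
    by (intro mult_left_mono) auto
  moreover have "a powr p = a powr (p - 1) * a"
    using assms powr_add[of a "p - 1" 1] by simp
  ultimately show ?thesis
    using s assms by (simp add: powr_mult algebra_simps)
qed

lemma le_one_plus_powr:
  fixes y p :: real
  assumes "1 \<le> p" "0 \<le> y"
  shows "y \<le> 1 + y powr p"
  using powr_tangent[of p 1 y] assms
  by (smt (verit, ccfv_SIG) mult_le_cancel_right1 mult_less_0_iff powr_ge_zero powr_one_eq_one)

lemma powr_add_le:
  fixes a b p :: real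
  assumes "0 \<le> p" "0 \<le> a" "0 \<le> b"
  shows "(a + b) powr p \<le> 2 powr p * (a powr p + b powr p)"
proof -
  have "(a + b) powr p \<le> (2 * max a b) powr p"
    using assms by (intro powr_mono2) auto
  also have "\<dots> = 2 powr p * (max a b) powr p"
    using assms by (simp add: powr_mult)
  also have "\<dots> \<le> 2 powr p * (a powr p + b powr p)"
    by (intro mult_left_mono) (auto simp: max_def)
  finally show ?thesis .
qed

lemma powr_convex_comb:
  fixes a b l p :: real
  assumes "1 \<le> p" "0 \<le> a" "0 \<le> b" "0 \<le> l" "l \<le> 1"
  shows "(l * a + (1 - l) * b) powr p \<le> l * a powr p + (1 - l) * b powr p"
proof (cases "l * a + (1 - l) * b = 0")
  case True
  then show ?thesis using assms by simp
next
  case False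
  define c where "c = l * a + (1 - l) * b"
  have c: "c > 0" using False assms by (simp add: c_def add_nonneg_eq_0_iff order_less_le)
  \<comment> \<open>The tangent at the mean \<open>c\<close> is used at both points; averaging
    cancels its linear term.\<close>
  have "l * (c powr p + p * c powr (p - 1) * (a - c)) + (1 - l) * (c powr p + p * c powr (p - 1) * (b - c))
      \<le> l * a powr p + (1 - l) * b powr p"
    using assms c by (intro add_mono mult_left_mono powr_tangent) auto
  moreover have "l * (c powr p + p * c powr (p - 1) * (a - c)) + (1 - l) * (c powr p + p * c powr (p - 1) * (b - c))
      = c powr p + p * c powr (p - 1) * (l * a + (1 - l) * b - c)"
    by (simp add: algebra_simps)
  ultimately show ?thesis by (simp add: c_def)
qed

text \<open>Integrating the tangent at the mean value of \<open>g\<close> gives the bound. The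
  measure is not normalized, and the factor \<open>W powr (p - 1)\<close> for its mass
  \<open>W\<close> later combines with one more \<open>W\<close> to the operator norm
  \<open>W\<close>.\<close>

lemma jensen_powr:
  fixes g :: "'a \<Rightarrow> real"
  assumes "finite_measure N" "g \<in> borel_measurable N" "\<And>x. 0 \<le> g x"
    and p: "1 \<le> p" and int: "integrable N (\<lambda>x. g x powr p)"
  shows "integrable N g"
    and "(LINT x|N. g x) powr p \<le> measure N (space N) powr (p - 1) * (LINT x|N. g x powr p)"
proof -
  interpret finite_measure N by fact
  show I: "integrable N g"
    by (rule Bochner_Integration.integrable_bound[where f="\<lambda>x. 1 + g x powr p"])
      (use assms le_one_plus_powr[OF p] in auto)
  let ?W = "measure N (space N)"
  show "(LINT x|N. g x) powr p \<le> ?W powr (p - 1) * (LINT x|N. g x powr p)"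
  proof (cases "(LINT x|N. g x) = 0")
    case True
    then show ?thesis by (auto intro!: mult_nonneg_nonneg integral_nonneg_AE)
  next
    case False
    have pos: "(LINT x|N. g x) > 0"
      using False Bochner_Integration.integral_nonneg[of N g] assms(3) by (simp add: order_less_le)
    have W: "?W > 0"
    proof (rule ccontr)
      assume "\<not> ?W > 0"
      then have "?W = 0" using measure_nonneg[of N "space N"] by linarith
      then have "emeasure N (space N) = 0" by (simp add: emeasure_eq_measure)
      then have "AE x in N. g x = 0"
        by (intro AE_I[of _ _ "space N"]) auto
      then show False using False integral_cong_AE[of g N "\<lambda>_. 0"] assms by auto
    qed
    define a where "a = (LINT x|N. g x) / ?W"
    have a: "a > 0" using pos W by (simp add: a_def)
    have "(LINT x|N. a powr p + p * a powr (p - 1) * (g x - a)) \<le> (LINT x|N. g x powr p)"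
      using I int powr_tangent[OF p a] assms(3) by (intro integral_mono) auto
    also have "(LINT x|N. a powr p + p * a powr (p - 1) * (g x - a)) = ?W * a powr p"
      using I W by (simp add: a_def)
    finally have *: "?W * a powr p \<le> (LINT x|N. g x powr p)" .
    have "(LINT x|N. g x) = ?W * a" using W by (simp add: a_def)
    then have "(LINT x|N. g x) powr p = ?W powr (p - 1) * (?W * a powr p)"
      using W a powr_add[of ?W "p - 1" 1] by (simp add: powr_mult)
    also have "\<dots> \<le> ?W powr (p - 1) * (LINT x|N. g x powr p)"
      using * by (intro mult_left_mono) auto
    finally show ?thesis .
  qed
qed

section \<open>The seminormed function spaces \<open>L^p\<close>\<close>

lemma Lp_spaceD:
  assumes "f \<in> Lp_space M p"
  shows "f \<in> borel_measurable M" "integrable M (\<lambda>x. norm (f x) powr p)"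
  using assms by (auto simp: Lp_space_def)

lemma Lp_space_bound:
  assumes "g \<in> Lp_space M p" "f \<in> borel_measurable M" "0 \<le> p"
    and "AE x in M. norm (f x) \<le> C * norm (g x)"
  shows "f \<in> Lp_space M p"
proof -
  have C: "AE x in M. norm (f x) \<le> \<bar>C\<bar> * norm (g x)"
    using assms(4) by eventually_elim (meson abs_ge_self mult_right_mono norm_ge_zero order_trans)
  have "integrable M (\<lambda>x. norm (f x) powr p)"
  proof (rule Bochner_Integration.integrable_bound[where f="\<lambda>x. \<bar>C\<bar> powr p * norm (g x) powr p"])
    show "AE x in M. norm (norm (f x) powr p) \<le> norm (\<bar>C\<bar> powr p * norm (g x) powr p)"
      using C
    proof eventually_elim
      case (elim x)
      then have "norm (f x) powr p \<le> (\<bar>C\<bar> * norm (g x)) powr p"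
        using assms(3) by (intro powr_mono2) auto
      then show ?case by (simp add: powr_mult)
    qed
  qed (use assms Lp_spaceD[OF assms(1)] in auto)
  then show ?thesis using assms by (simp add: Lp_space_def)
qed

lemma Lp_space_add:
  assumes "f \<in> Lp_space M p" "g \<in> Lp_space M p" "0 \<le> p"
  shows "(\<lambda>x. f x + g x) \<in> Lp_space M p"
proof -
  note f = Lp_spaceD[OF assms(1)] and g = Lp_spaceD[OF assms(2)]
  have "integrable M (\<lambda>x. norm (f x + g x) powr p)"
  proof (rule Bochner_Integration.integrable_bound
        [where f="\<lambda>x. 2 powr p * (norm (f x) powr p + norm (g x) powr p)"])
    show "AE x in M. norm (norm (f x + g x) powr p)
        \<le> norm (2 powr p * (norm (f x) powr p + norm (g x) powr p))"
    proof (intro AE_I2)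
      fix x
      have "norm (f x + g x) powr p \<le> (norm (f x) + norm (g x)) powr p"
        using assms(3) by (intro powr_mono2 norm_triangle_ineq) auto
      also have "\<dots> \<le> 2 powr p * (norm (f x) powr p + norm (g x) powr p)"
        using assms(3) by (intro powr_add_le) auto
      finally show "norm (norm (f x + g x) powr p)
        \<le> norm (2 powr p * (norm (f x) powr p + norm (g x) powr p))" by simp
    qed
  qed (use f g in auto)
  then show ?thesis using f g by (simp add: Lp_space_def)
qed

lemma Lp_space_scale:
  assumes "f \<in> Lp_space M p"
  shows "(\<lambda>x. c * f x) \<in> Lp_space M p"
  using Lp_spaceD[OF assms] by (auto simp: Lp_space_def norm_mult powr_mult)

lemma Lp_space_diff:
  assumes "f \<in> Lp_space M p" "g \<in> Lp_space M p" "0 \<le> p"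
  shows "(\<lambda>x. f x - g x) \<in> Lp_space M p"
  using Lp_space_add[OF assms(1) Lp_space_scale[OF assms(2), of "-1"] assms(3)] by simp

lemma Lp_space_zero: "(\<lambda>x. 0) \<in> Lp_space M p"
  by (simp add: Lp_space_def)

lemma Lp_space_sum:
  assumes "\<And>i. i \<in> I \<Longrightarrow> f i \<in> Lp_space M p" "0 \<le> p"
  shows "(\<lambda>x. \<Sum>i\<in>I. f i x) \<in> Lp_space M p"
  using assms by (induction I rule: infinite_finite_induct) (auto intro: Lp_space_add Lp_space_zero)

lemma Lp_norm_nonneg: "0 \<le> Lp_norm M p f"
  by (simp add: Lp_norm_def)

lemma Lp_norm_powr:
  assumes "0 < p"
  shows "Lp_norm M p f powr p = (LINT x|M. norm (f x) powr p)"
  using assms by (simp add: Lp_norm_def powr_powr)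

lemma Lp_norm_le:
  assumes "0 < p" "(LINT x|M. norm (f x) powr p) \<le> C powr p" "0 \<le> C"
  shows "Lp_norm M p f \<le> C"
proof -
  have "Lp_norm M p f \<le> (C powr p) powr (1 / p)"
    unfolding Lp_norm_def using assms by (intro powr_mono2 integral_nonneg_AE) auto
  then show ?thesis using assms by (simp add: powr_powr)
qed

lemma Lp_norm_cong:
  assumes "AE x in M. f x = g x" "f \<in> borel_measurable M" "g \<in> borel_measurable M"
  shows "Lp_norm M p f = Lp_norm M p g"
proof -
  have "(LINT x|M. norm (f x) powr p) = (LINT x|M. norm (g x) powr p)"
    using assms by (intro integral_cong_AE) (auto elim!: eventually_mono)
  then show ?thesis by (simp add: Lp_norm_def)
qed

lemma Lp_norm_scale:
  assumes "0 < p"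
  shows "Lp_norm M p (\<lambda>x. c * f x) = norm c * Lp_norm M p f"
  using assms by (simp add: Lp_norm_def norm_mult powr_mult powr_powr integral_nonneg_AE)

lemma Lp_norm_zero_iff:
  assumes "f \<in> Lp_space M p" "0 < p"
  shows "Lp_norm M p f = 0 \<longleftrightarrow> (AE x in M. f x = 0)"
proof -
  have "Lp_norm M p f = 0 \<longleftrightarrow> (LINT x|M. norm (f x) powr p) = 0"
    by (simp add: Lp_norm_def)
  also have "\<dots> \<longleftrightarrow> (AE x in M. norm (f x) powr p = 0)"
    using Lp_spaceD[OF assms(1)] by (intro integral_nonneg_eq_0_iff_AE) auto
  finally show ?thesis by simp
qed

text \<open>Minkowski from convexity alone: \<open>f + g\<close> is \<open>F + G\<close> times the
  convex combination of \<open>f / F\<close> and \<open>g / G\<close> with weights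
  \<open>F / (F + G)\<close> and \<open>G / (F + G)\<close>. Functions of norm zero cannot be
  normalized and are split off.\<close>

lemma Lp_norm_triangle:
  assumes f: "f \<in> Lp_space M p" and g: "g \<in> Lp_space M p" and p: "1 \<le> p"
  shows "Lp_norm M p (\<lambda>x. f x + g x) \<le> Lp_norm M p f + Lp_norm M p g"
proof -
  define F G where "F = Lp_norm M p f" and "G = Lp_norm M p g"
  have FG: "F \<ge> 0" "G \<ge> 0" by (auto simp: F_def G_def Lp_norm_nonneg)
  note [measurable] = Lp_spaceD(1)[OF f] Lp_spaceD(1)[OF g]
  consider "F = 0" | "G = 0" | "F > 0" "G > 0" using FG by linarith
  then show ?thesis
  proof cases
    case 1
    then have "AE x in M. f x + g x = g x"
      using Lp_norm_zero_iff[OF f] p by (auto simp: F_def)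
    then show ?thesis using Lp_norm_cong[of "\<lambda>x. f x + g x" g M p] 1 by (auto simp: F_def)
  next
    case 2
    then have "AE x in M. f x + g x = f x"
      using Lp_norm_zero_iff[OF g] p by (auto simp: G_def)
    then show ?thesis using Lp_norm_cong[of "\<lambda>x. f x + g x" f M p] 2 by (auto simp: G_def)
  next
    case 3
    define l where "l = F / (F + G)"
    have l: "0 \<le> l" "l \<le> 1" "1 - l = G / (F + G)" using 3 by (auto simp: l_def field_simps)
    have *: "norm (f x + g x) powr p
        \<le> (F + G) powr p * (l / F powr p * norm (f x) powr p + (1 - l) / G powr p * norm (g x) powr p)" for x
    proof -
      have "norm (f x + g x) \<le> norm (f x) + norm (g x)" by (rule norm_triangle_ineq)
      also have "\<dots> = (F + G) * (l * (norm (f x) / F) + (1 - l) * (norm (g x) / G))"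
      proof -
        have "(F + G) * l = F" "(F + G) * (1 - l) = G" using 3 l(3) by (auto simp: l_def)
        then have "(F + G) * (l * (norm (f x) / F)) = norm (f x)"
          "(F + G) * ((1 - l) * (norm (g x) / G)) = norm (g x)"
          using 3 by (simp_all add: mult.assoc[symmetric])
        then show ?thesis by (simp add: distrib_left)
      qed
      finally have "norm (f x + g x) powr p
          \<le> ((F + G) * (l * (norm (f x) / F) + (1 - l) * (norm (g x) / G))) powr p"
        using p by (intro powr_mono2) auto
      also have "\<dots> = (F + G) powr p * (l * (norm (f x) / F) + (1 - l) * (norm (g x) / G)) powr p"
        using 3 l by (intro powr_mult)
      also have "\<dots> \<le> (F + G) powr p
          * (l * (norm (f x) / F) powr p + (1 - l) * (norm (g x) / G) powr p)"
        using p l 3 by (intro mult_left_mono powr_convex_comb) auto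
      finally show ?thesis using 3 by (simp add: powr_divide)
    qed
    have "(LINT x|M. norm (f x + g x) powr p) \<le> (LINT x|M. (F + G) powr p
         * (l / F powr p * norm (f x) powr p + (1 - l) / G powr p * norm (g x) powr p))"
      using Lp_spaceD[OF f] Lp_spaceD[OF g] Lp_spaceD[OF Lp_space_add[OF f g]] p *
      by (intro integral_mono) auto
    also have "\<dots> = (F + G) powr p * (l / F powr p * F powr p + (1 - l) / G powr p * G powr p)"
      using Lp_spaceD[OF f] Lp_spaceD[OF g] p Lp_norm_powr[of p M f] Lp_norm_powr[of p M g]
      by (simp add: F_def G_def)
    also have "\<dots> = (F + G) powr p" using 3 by simp
    finally show ?thesis
      using p FG unfolding F_def G_def by (intro Lp_norm_le) auto
  qed
qed

lemma Lp_norm_minus_commute: "Lp_norm M p (\<lambda>x. f x - g x) = Lp_norm M p (\<lambda>x. g x - f x)"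
  by (simp add: Lp_norm_def norm_minus_commute)

lemma Lp_norm_triangle_diff:
  assumes "f \<in> Lp_space M p" "g \<in> Lp_space M p" "h \<in> Lp_space M p" "1 \<le> p"
  shows "Lp_norm M p (\<lambda>x. f x - h x) \<le> Lp_norm M p (\<lambda>x. f x - g x) + Lp_norm M p (\<lambda>x. g x - h x)"
  using Lp_norm_triangle[OF Lp_space_diff[OF assms(1,2)] Lp_space_diff[OF assms(2,3)]] assms(4)
  by simp

lemma Lp_limit_unique:
  assumes "\<And>t. F t \<in> Lp_space M p" "a \<in> Lp_space M p" "b \<in> Lp_space M p" "1 \<le> p" "net \<noteq> bot"
    and "((\<lambda>t. Lp_norm M p (\<lambda>x. F t x - a x)) \<longlongrightarrow> 0) net"
    and "((\<lambda>t. Lp_norm M p (\<lambda>x. F t x - b x)) \<longlongrightarrow> 0) net"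
  shows "AE x in M. a x = b x"
proof -
  have "((\<lambda>t. Lp_norm M p (\<lambda>x. F t x - a x) + Lp_norm M p (\<lambda>x. F t x - b x)) \<longlongrightarrow> 0 + 0) net"
    using assms by (intro tendsto_add)
  moreover have "Lp_norm M p (\<lambda>x. a x - b x)
      \<le> Lp_norm M p (\<lambda>x. F t x - a x) + Lp_norm M p (\<lambda>x. F t x - b x)" for t
    using Lp_norm_triangle_diff[OF assms(2,1,3,4)] by (metis Lp_norm_minus_commute)
  ultimately have "Lp_norm M p (\<lambda>x. a x - b x) \<le> 0"
    using assms(5) by (intro tendsto_lowerbound[where F=net]) auto
  then have "Lp_norm M p (\<lambda>x. a x - b x) = 0" using Lp_norm_nonneg[of M p] by (simp add: antisym)
  then show ?thesis
    using Lp_norm_zero_iff[OF Lp_space_diff[OF assms(2,3)]] assms(4) by simp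
qed

section \<open>Ball averages as symmetric Markov kernels\<close>

text \<open>The calculus of ball averages sees the distance distribution only through a family of
  positive radii that decreases to 0 in the spectral variable, so these properties alone are assumed
  here; \<open>rad\<close> will be the instance.\<close>

locale ball_averages =
  fixes M :: "'a::{metric_space, second_countable_topology} measure" and \<rho> :: "real \<Rightarrow> real"
  assumes ultra: "ultrametric TYPE('a)"
    and compact_cball: "\<And>(x :: 'a) r. compact (cball x r)"
    and radon: "radon_measure M" and support: "full_support M"
    and \<rho>_pos: "\<And>v. 0 < \<rho> v"
    and \<rho>_measurable [measurable]: "\<rho> \<in> borel_measurable borel"
    and \<rho>_antimono: "\<And>v v'. 0 < v \<Longrightarrow> v \<le> v' \<Longrightarrow> \<rho> v' \<le> \<rho> v"
    and \<rho>_limit: "\<And>r. 0 < r \<Longrightarrow> \<exists>V. \<forall>v\<ge>V. \<rho> v \<le> r"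
begin

lemma sets_M [measurable_cong, simp]: "sets M = sets borel"
  using radon unfolding radon_measure_def by (rule conjunct1)

lemma space_M [simp]: "space M = UNIV"
  using sets_eq_imp_space_eq[OF sets_M] by simp

lemma dist_ultra: "dist (x::'a) z \<le> max (dist x y) (dist y z)"
  using ultra by (simp add: ultrametric_def)

text \<open>Every point of an ultrametric ball is a centre of it, so the balls of one radius
  partition the space. Openness of balls, symmetry of the kernel and constancy of averages on balls
  all come from this.\<close>

lemma cball_eq:
  assumes "(y::'a) \<in> cball x r"
  shows "cball y r = cball x r"
proof -
  have "dist x z \<le> r \<longleftrightarrow> dist y z \<le> r" for z
    using dist_ultra[of x z y] dist_ultra[of y z x] assms dist_commute[of x y]
    unfolding mem_cball by linarith
  then show ?thesis by auto
qed

lemma open_cball: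
  assumes "0 < r"
  shows "open (cball (x::'a) r)"
  unfolding open_contains_ball
proof
  fix y assume "y \<in> cball x r"
  then have "ball y r \<subseteq> cball x r" using cball_eq[of y x r] ball_subset_cball[of y r] by blast
  then show "\<exists>e>0. ball y e \<subseteq> cball x r" using assms by blast
qed

lemma emeasure_cball_finite: "emeasure M (cball x r) < \<infinity>"
proof -
  have "\<forall>K. compact K \<longrightarrow> emeasure M K < \<infinity>"
    using radon unfolding radon_measure_def by (elim conjE)
  then show ?thesis using compact_cball by simp
qed

lemma measure_cball_pos:
  assumes "0 < r"
  shows "0 < measure M (cball x r)"
proof -
  have "x \<in> cball x r" using assms by simp
  then have "emeasure M (cball x r) > 0"
    using support open_cball[OF assms] unfolding full_support_def by blast
  then show ?thesis
    using emeasure_cball_finite[of x r] by (simp add: measure_def enn2real_positive_iff less_top)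
qed

sublocale sigma_finite_measure M
proof
  let ?A = "range (\<lambda>n::nat. cball (undefined::'a) (real n))"
  have "\<Union>?A = space M"
    using real_arch_simple by (auto simp: mem_cball)
  moreover have "emeasure M a \<noteq> \<infinity>" if "a \<in> ?A" for a
    using that emeasure_cball_finite by (auto simp: less_top)
  ultimately show "\<exists>A. countable A \<and> A \<subseteq> sets M \<and> \<Union>A = space M \<and> (\<forall>a\<in>A. emeasure M a \<noteq> \<infinity>)"
    by (intro exI[of _ ?A]) auto
qed

text \<open>The kernel of \<open>E v\<close> with respect to \<open>M\<close>. It is a symmetric
  probability density in either variable, because the balls of radius \<open>\<rho> v\<close>
  partition the space.\<close>

definition k :: "real \<Rightarrow> 'a \<Rightarrow> 'a \<Rightarrow> real" where
  "k v x y = (if dist x y \<le> \<rho> v then 1 / measure M (cball x (\<rho> v)) else 0)"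

abbreviation E :: "real \<Rightarrow> 'a oper" where
  "E v \<equiv> ball_average M (\<rho> v)"

lemma k_nonneg [simp]: "0 \<le> k v x y"
  by (simp add: k_def)

lemma k_commute: "k v x y = k v y x"
  using cball_eq[of y x "\<rho> v"] by (auto simp: k_def dist_commute)

text \<open>Joint measurability in centre and radius, which every later use of Fubini over
  \<open>v\<close> and \<open>x\<close> needs: the mass of the ball is the integral over
  \<open>y\<close> of a jointly measurable function.\<close>

lemma measurable_measure_cball:
  assumes [measurable]: "V \<in> borel_measurable N" and X: "X \<in> measurable N M"
  shows "(\<lambda>i. measure M (cball (X i) (\<rho> (V i)))) \<in> borel_measurable N"
proof -
  have [measurable]: "X \<in> borel_measurable N" using X by (simp cong: measurable_cong_sets)
  have "emeasure M (cball (X i) (\<rho> (V i))) = (\<integral>\<^sup>+y. (if dist (X i) y \<le> \<rho> (V i) then 1 else 0) \<partial>M)" for i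
  proof -
    have "emeasure M (cball (X i) (\<rho> (V i))) = (\<integral>\<^sup>+y. indicator (cball (X i) (\<rho> (V i))) y \<partial>M)" by simp
    also have "\<dots> = (\<integral>\<^sup>+y. (if dist (X i) y \<le> \<rho> (V i) then 1 else 0) \<partial>M)"
      by (intro nn_integral_cong) (auto simp: indicator_def)
    finally show ?thesis .
  qed
  moreover have "(\<lambda>i. \<integral>\<^sup>+y. (if dist (X i) y \<le> \<rho> (V i) then 1 else 0) \<partial>M) \<in> borel_measurable N"
    by measurable
  ultimately show ?thesis unfolding measure_def by simp
qed

lemma measurable_k [measurable (raw)]:
  assumes [measurable]: "V \<in> borel_measurable N" and X: "X \<in> measurable N M" and Y: "Y \<in> measurable N M"
  shows "(\<lambda>i. k (V i) (X i) (Y i)) \<in> borel_measurable N"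
proof -
  have [measurable]: "X \<in> borel_measurable N" "Y \<in> borel_measurable N"
    using X Y by (simp_all cong: measurable_cong_sets)
  note [measurable] = measurable_measure_cball[OF assms(1) X]
  show ?thesis unfolding k_def by measurable
qed

lemma E_kernel: "E v f x = (LINT y|M. k v x y *\<^sub>R f y)"
proof -
  have "E v f x = (LINT y|M. (1 / measure M (cball x (\<rho> v))) *\<^sub>R indicator (cball x (\<rho> v)) y *\<^sub>R f y)"
    unfolding ball_average_def set_lebesgue_integral_def by (rule integral_scaleR_right[symmetric])
  also have "\<dots> = (LINT y|M. k v x y *\<^sub>R f y)"
    by (intro Bochner_Integration.integral_cong) (auto simp: k_def indicator_def)
  finally show ?thesis .
qed

lemma measurable_E [measurable (raw)]:
  assumes [measurable]: "f \<in> borel_measurable M" "V \<in> borel_measurable N" "X \<in> measurable N M"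
  shows "(\<lambda>i. E (V i) f (X i)) \<in> borel_measurable N"
  unfolding E_kernel by measurable

lemma nn_integral_k: "(\<integral>\<^sup>+y. k v x y \<partial>M) = 1"
proof -
  have "(\<integral>\<^sup>+y. k v x y \<partial>M) = (\<integral>\<^sup>+y. ennreal (1 / measure M (cball x (\<rho> v))) * indicator (cball x (\<rho> v)) y \<partial>M)"
    by (intro nn_integral_cong) (auto simp: k_def indicator_def)
  also have "\<dots> = ennreal (1 / measure M (cball x (\<rho> v))) * ennreal (measure M (cball x (\<rho> v)))"
    using emeasure_cball_finite[of x "\<rho> v"]
    by (subst nn_integral_cmult_indicator) (auto simp: emeasure_eq_ennreal_measure less_top)
  also have "\<dots> = 1"
    using measure_cball_pos[OF \<rho>_pos[of v], of x] by (simp flip: ennreal_mult)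
  finally show ?thesis .
qed

lemma nn_integral_k_symmetric:
  fixes g h :: "'a \<Rightarrow> ennreal"
  assumes [measurable]: "g \<in> borel_measurable M" "h \<in> borel_measurable M"
  shows "(\<integral>\<^sup>+x. h x * (\<integral>\<^sup>+y. k v x y * g y \<partial>M) \<partial>M) = (\<integral>\<^sup>+y. (\<integral>\<^sup>+x. k v y x * h x \<partial>M) * g y \<partial>M)"
proof -
  interpret pair_sigma_finite M M ..
  have "(\<integral>\<^sup>+x. h x * (\<integral>\<^sup>+y. k v x y * g y \<partial>M) \<partial>M) = (\<integral>\<^sup>+x. \<integral>\<^sup>+y. h x * (k v x y * g y) \<partial>M \<partial>M)"
    by (intro nn_integral_cong nn_integral_cmult[symmetric]) measurable
  also have "\<dots> = (\<integral>\<^sup>+y. \<integral>\<^sup>+x. h x * (k v x y * g y) \<partial>M \<partial>M)"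
    by (intro Fubini') measurable
  also have "\<dots> = (\<integral>\<^sup>+y. \<integral>\<^sup>+x. (k v y x * h x) * g y \<partial>M \<partial>M)"
    by (intro nn_integral_cong) (metis k_commute mult.assoc mult.commute)
  also have "\<dots> = (\<integral>\<^sup>+y. (\<integral>\<^sup>+x. k v y x * h x \<partial>M) * g y \<partial>M)"
    by (intro nn_integral_cong nn_integral_multc) measurable
  finally show ?thesis .
qed

lemma nn_integral_k_invariant:
  fixes g :: "'a \<Rightarrow> ennreal"
  assumes [measurable]: "g \<in> borel_measurable M"
  shows "(\<integral>\<^sup>+x. \<integral>\<^sup>+y. k v x y * g y \<partial>M \<partial>M) = (\<integral>\<^sup>+y. g y \<partial>M)"
  using nn_integral_k_symmetric[of g "\<lambda>_. 1" v] by (simp add: nn_integral_k)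

lemma integrable_k_powr:
  assumes "f \<in> Lp_space M p"
  shows "integrable M (\<lambda>y. k v x y * norm (f y) powr p)"
proof -
  note [measurable] = Lp_spaceD(1)[OF assms]
  let ?g = "\<lambda>y. (1 / measure M (cball x (\<rho> v))) * norm (f y) powr p"
  have "k v x y \<le> 1 / measure M (cball x (\<rho> v))" for y
    by (simp add: k_def)
  then have "k v x y * norm (f y) powr p \<le> ?g y" for y
    by (rule mult_right_mono) simp
  then have "norm (k v x y * norm (f y) powr p) \<le> norm (?g y)" for y
    using abs_ge_self[of "?g y"] by (simp add: abs_mult)
  moreover have "integrable M ?g"
    using Lp_spaceD(2)[OF assms] by (rule integrable_mult_right)
  ultimately show ?thesis
    by (rule_tac Bochner_Integration.integrable_bound[OF _ _ AE_I2]) (assumption, measurable)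
qed

lemma finite_measure_k: "finite_measure (density M (k v x))"
  by (rule finite_measureI) (simp add: emeasure_density nn_integral_k)

lemma integrable_k:
  assumes "f \<in> Lp_space M p" "1 \<le> p"
  shows "integrable M (\<lambda>y. k v x y *\<^sub>R f y)"
proof -
  note [measurable] = Lp_spaceD(1)[OF assms(1)]
  have "integrable (density M (k v x)) (\<lambda>y. norm (f y) powr p)"
    using integrable_k_powr[OF assms(1), of v x] by (subst integrable_density) simp_all
  then have "integrable (density M (k v x)) (\<lambda>y. norm (f y))"
    using assms(2) by (rule_tac jensen_powr(1)[where p=p, OF finite_measure_k]) simp_all
  then have "integrable M (\<lambda>y. norm (k v x y *\<^sub>R f y))"
    by (subst (asm) integrable_density) simp_all
  then show ?thesis by (rule integrable_norm_cancel) measurable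
qed

lemma norm_E_le: "norm (E v f x) \<le> (LINT y|M. k v x y * norm (f y))"
  unfolding E_kernel by (rule order_trans[OF integral_norm_bound]) simp

lemma norm_E_powr_le:
  assumes "f \<in> Lp_space M p" "1 \<le> p"
  shows "norm (E v f x) powr p \<le> (LINT y|M. k v x y * norm (f y) powr p)"
proof -
  note [measurable] = Lp_spaceD(1)[OF assms(1)]
  let ?N = "density M (k v x)"
  have N: "measure ?N (space ?N) = 1"
    by (simp add: measure_def emeasure_density nn_integral_k)
  have "norm (E v f x) powr p \<le> (LINT y|M. k v x y * norm (f y)) powr p"
    using assms(2) by (intro powr_mono2 norm_E_le) auto
  also have "\<dots> = (LINT y|?N. norm (f y)) powr p"
    by (subst integral_density) auto
  also have "\<dots> \<le> (LINT y|?N. norm (f y) powr p)"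
  proof -
    have "integrable ?N (\<lambda>y. norm (f y) powr p)"
      using integrable_k_powr[OF assms(1), of v x] by (subst integrable_density) simp_all
    then show ?thesis
      using jensen_powr(2)[where N="?N" and g="\<lambda>y. norm (f y)" and p=p, OF finite_measure_k] assms(2)
      unfolding N by simp
  qed
  also have "\<dots> = (LINT y|M. k v x y * norm (f y) powr p)"
    by (subst integral_density) auto
  finally show ?thesis .
qed

text \<open>Jensen for the probability density \<open>k v x\<close> bounds the integrand pointwise,
  and averaging by a symmetric Markov kernel preserves the integral of
  \<open>norm (f y) powr p\<close>.\<close>

lemma nn_integral_E_powr_le:
  assumes "f \<in> Lp_space M p" "1 \<le> p"
  shows "(\<integral>\<^sup>+x. norm (E v f x) powr p \<partial>M) \<le> (LINT x|M. norm (f x) powr p)"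
proof -
  note [measurable] = Lp_spaceD(1)[OF assms(1)]
  have "(\<integral>\<^sup>+x. norm (E v f x) powr p \<partial>M) \<le> (\<integral>\<^sup>+x. \<integral>\<^sup>+y. k v x y * ennreal (norm (f y) powr p) \<partial>M \<partial>M)"
  proof (intro nn_integral_mono)
    fix x
    have "ennreal (norm (E v f x) powr p) \<le> ennreal (LINT y|M. k v x y * norm (f y) powr p)"
      using norm_E_powr_le[OF assms] by (intro ennreal_leI)
    also have "\<dots> = (\<integral>\<^sup>+y. k v x y * norm (f y) powr p \<partial>M)"
      using integrable_k_powr[OF assms(1)] by (subst nn_integral_eq_integral) auto
    finally show "ennreal (norm (E v f x) powr p) \<le> (\<integral>\<^sup>+y. k v x y * ennreal (norm (f y) powr p) \<partial>M)"
      by (simp add: ennreal_mult)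
  qed
  also have "\<dots> = (\<integral>\<^sup>+y. norm (f y) powr p \<partial>M)"
    by (intro nn_integral_k_invariant) measurable
  also have "\<dots> = (LINT x|M. norm (f x) powr p)"
    using Lp_spaceD(2)[OF assms(1)] by (intro nn_integral_eq_integral) auto
  finally show ?thesis .
qed

lemma E_Lp:
  assumes "f \<in> Lp_space M p" "1 \<le> p"
  shows "E v f \<in> Lp_space M p" "Lp_norm M p (E v f) \<le> Lp_norm M p f"
proof -
  note [measurable] = Lp_spaceD(1)[OF assms(1)]
  have I: "integrable M (\<lambda>x. norm (E v f x) powr p)"
    using le_less_trans[OF nn_integral_E_powr_le[OF assms, of v] ennreal_less_top]
    by (intro integrableI_nonneg) auto
  then show "E v f \<in> Lp_space M p" by (auto simp: Lp_space_def)
  have "ennreal (LINT x|M. norm (E v f x) powr p) \<le> (LINT x|M. norm (f x) powr p)"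
    using nn_integral_E_powr_le[OF assms, of v] I by (subst nn_integral_eq_integral[symmetric]) auto
  then have "(LINT x|M. norm (E v f x) powr p) \<le> Lp_norm M p f powr p"
    using assms(2) by (simp add: Lp_norm_powr integral_nonneg_AE)
  then show "Lp_norm M p (E v f) \<le> Lp_norm M p f"
    using assms(2) by (intro Lp_norm_le) (auto simp: Lp_norm_nonneg)
qed

lemma E_add:
  assumes "f \<in> Lp_space M p" "g \<in> Lp_space M p" "1 \<le> p"
  shows "E v (\<lambda>y. f y + g y) x = E v f x + E v g x"
  unfolding E_kernel using integrable_k[OF assms(1,3)] integrable_k[OF assms(2,3)]
  by (simp add: scaleR_add_right)

lemma E_scale: "E v (\<lambda>y. c * f y) x = c * E v f x"
  unfolding E_kernel by (subst integral_mult_right_zero[symmetric]) simp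

lemma E_cong:
  assumes "AE y in M. f y = g y" "f \<in> borel_measurable M" "g \<in> borel_measurable M"
  shows "E v f = E v g"
  unfolding E_kernel using assms by (intro ext integral_cong_AE) (auto elim!: eventually_mono)

lemma E_cnj: "E v (\<lambda>y. cnj (f y)) x = cnj (E v f x)"
  unfolding E_kernel by (subst Bochner_Integration.integral_cnj[symmetric]) (simp only: complex_cnj_scaleR)

lemma E_const_on_ball:
  assumes "y \<in> cball x (\<rho> v)"
  shows "E v f y = E v f x"
  using cball_eq[OF assms] by (simp add: ball_average_def)

end

section \<open>Strong convergence of ball averages\<close>

text \<open>A form of Minkowski's integral inequality: Jensen in \<open>i\<close> for almost every
  \<open>x\<close>, then Tonelli. Since operators are defined by pointwise integrals, their
  convergence almost everywhere is part of the result; the version with norms inside serves later as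
  a dominating function for Fubini.\<close>

lemma Lp_integral_average:
  fixes F :: "'i \<Rightarrow> 'a \<Rightarrow> complex"
  assumes "finite_measure N" "sigma_finite_measure M"
    and F [measurable]: "(\<lambda>(i, x). F i x) \<in> borel_measurable (N \<Otimes>\<^sub>M M)"
    and p: "1 \<le> p" and K: "0 \<le> K" "(\<integral>\<^sup>+i. \<integral>\<^sup>+x. norm (F i x) powr p \<partial>M \<partial>N) \<le> ennreal K"
  shows "AE x in M. integrable N (\<lambda>i. F i x)"
    and "(\<lambda>x. complex_of_real (LINT i|N. norm (F i x))) \<in> Lp_space M p"
    and "(\<lambda>x. LINT i|N. F i x) \<in> Lp_space M p"
    and "(LINT x|M. norm (LINT i|N. F i x) powr p) \<le> measure N (space N) powr (p - 1) * K"
proof -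
  interpret N: finite_measure N by fact
  interpret M: sigma_finite_measure M by fact
  interpret pair_sigma_finite N M ..
  let ?W = "measure N (space N)"
  let ?G = "\<lambda>x. LINT i|N. norm (F i x)"
  have sec: "(\<lambda>i. F i x) \<in> borel_measurable N" if "x \<in> space M" for x
    using measurable_compose[OF measurable_Pair2'[OF that] F] by simp
  have swap: "(\<integral>\<^sup>+x. \<integral>\<^sup>+i. norm (F i x) powr p \<partial>N \<partial>M) \<le> ennreal K"
    using K(2) by (subst Fubini') auto
  have "AE x in M. (\<integral>\<^sup>+i. norm (F i x) powr p \<partial>N) \<noteq> \<infinity>"
    using le_less_trans[OF swap ennreal_less_top] by (intro nn_integral_PInf_AE) auto
  with AE_space have AE: "AE x in M. x \<in> space M \<and> integrable N (\<lambda>i. norm (F i x) powr p)"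
  proof (eventually_elim, goal_cases)
    case (1 x)
    note [measurable] = sec[OF 1(1)]
    show ?case using 1 by (auto intro!: integrableI_nonneg simp: less_top)
  qed
  have AE2: "AE x in M. integrable N (\<lambda>i. F i x) \<and>
      ennreal (?G x powr p) \<le> ennreal (?W powr (p - 1)) * (\<integral>\<^sup>+i. norm (F i x) powr p \<partial>N)"
    using AE
  proof (eventually_elim, goal_cases)
    case (1 x)
    note [measurable] = sec[OF conjunct1[OF 1]]
    note J = jensen_powr[OF assms(1) _ norm_ge_zero p conjunct2[OF 1]]
    have "ennreal (?G x powr p) \<le> ennreal (?W powr (p - 1) * (LINT i|N. norm (F i x) powr p))"
      by (intro ennreal_leI J(2)) measurable
    also have "\<dots> = ennreal (?W powr (p - 1)) * (\<integral>\<^sup>+i. norm (F i x) powr p \<partial>N)"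
      using 1 by (subst nn_integral_eq_integral) (auto simp: ennreal_mult)
    finally show ?case using J(1) by (auto intro: integrable_norm_cancel)
  qed
  show int: "AE x in M. integrable N (\<lambda>i. F i x)"
    using AE2 by eventually_elim simp
  have le: "(\<integral>\<^sup>+x. ?G x powr p \<partial>M) \<le> ennreal (?W powr (p - 1) * K)"
  proof -
    have "(\<integral>\<^sup>+x. ?G x powr p \<partial>M)
        \<le> (\<integral>\<^sup>+x. ennreal (?W powr (p - 1)) * (\<integral>\<^sup>+i. norm (F i x) powr p \<partial>N) \<partial>M)"
      using AE2 by (intro nn_integral_mono_AE) (auto elim: eventually_mono)
    also have "\<dots> \<le> ennreal (?W powr (p - 1)) * ennreal K"
      using swap by (subst nn_integral_cmult) (auto intro: mult_left_mono)
    finally show ?thesis using K(1) by (simp add: ennreal_mult)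
  qed
  have G_nonneg: "0 \<le> ?G x" for x by (intro integral_nonneg_AE) simp
  have IG: "integrable M (\<lambda>x. ?G x powr p)"
    using le_less_trans[OF le ennreal_less_top] by (intro integrableI_nonneg) auto
  then show G: "(\<lambda>x. complex_of_real (?G x)) \<in> Lp_space M p"
    using G_nonneg by (auto simp: Lp_space_def)
  show F': "(\<lambda>x. LINT i|N. F i x) \<in> Lp_space M p"
  proof (rule Lp_space_bound[where C=1, OF G])
    show "AE x in M. norm (LINT i|N. F i x) \<le> 1 * norm (complex_of_real (?G x))"
      using G_nonneg by (intro AE_I2) (simp add: integral_norm_bound)
  qed (use p in auto)
  have "(LINT x|M. norm (LINT i|N. F i x) powr p) \<le> (LINT x|M. ?G x powr p)"
    using Lp_spaceD(2)[OF F'] IG p by (intro integral_mono powr_mono2) (auto simp: integral_norm_bound)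
  also have "ennreal (LINT x|M. ?G x powr p) \<le> ennreal (?W powr (p - 1) * K)"
    using le IG by (subst nn_integral_eq_integral[symmetric]) auto
  then have "(LINT x|M. ?G x powr p) \<le> ?W powr (p - 1) * K"
    using K(1) by simp
  finally show "(LINT x|M. norm (LINT i|N. F i x) powr p) \<le> ?W powr (p - 1) * K" .
qed

text \<open>Cutting off large values and small values together puts the truncation of an
  \<open>L^p\<close> function into all \<open>L^q\<close> simultaneously. This reduces
  \<open>L^p\<close> convergence to \<open>L^1\<close> and supplies a dense part of
  \<open>L^2 \<inter> L^p\<close>.\<close>

definition truncate :: "nat \<Rightarrow> ('a \<Rightarrow> complex) \<Rightarrow> 'a \<Rightarrow> complex" where
  "truncate n f x = (if inverse (Suc n) \<le> norm (f x) \<and> norm (f x) \<le> Suc n then f x else 0)"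

lemma measurable_truncate [measurable (raw)]:
  assumes [measurable]: "f \<in> borel_measurable M"
  shows "truncate n f \<in> borel_measurable M"
  unfolding truncate_def[abs_def] by measurable

lemma truncate_Lp:
  assumes "f \<in> Lp_space M p" "0 \<le> p" "0 \<le> q"
  shows "truncate n f \<in> Lp_space M q"
proof -
  note [measurable] = Lp_spaceD(1)[OF assms(1)]
  let ?g = "\<lambda>x. (Suc n powr q * Suc n powr p) * norm (f x) powr p"
  have le: "norm (norm (truncate n f x) powr q) \<le> norm (?g x)" for x
  proof (cases "inverse (Suc n) \<le> norm (f x) \<and> norm (f x) \<le> Suc n")
    case True
    have "1 \<le> Suc n * norm (f x)"
      using True by (simp add: field_simps)
    then have "1 \<le> Suc n powr p * norm (f x) powr p"
      using assms(2) by (simp add: ge_one_powr_ge_zero flip: powr_mult)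
    moreover have "norm (f x) powr q \<le> Suc n powr q"
      using True assms(3) by (intro powr_mono2) auto
    ultimately have "norm (f x) powr q * 1 \<le> Suc n powr q * (Suc n powr p * norm (f x) powr p)"
      by (intro mult_mono) auto
    then show ?thesis using True by (simp add: truncate_def mult.assoc)
  qed (auto simp: truncate_def)
  have "integrable M (\<lambda>x. norm (truncate n f x) powr q)"
    by (rule Bochner_Integration.integrable_bound[where f="?g"])
      (use Lp_spaceD(2)[OF assms(1)] le in auto)
  then show ?thesis by (simp add: Lp_space_def)
qed

lemma truncate_tendsto:
  assumes "f \<in> Lp_space M p" "0 < p"
  shows "(\<lambda>n. Lp_norm M p (\<lambda>x. truncate n f x - f x)) \<longlonglongrightarrow> 0"
proof -
  note [measurable] = Lp_spaceD(1)[OF assms(1)]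
  have "(\<lambda>n. LINT x|M. norm (truncate n f x - f x) powr p) \<longlonglongrightarrow> (LINT x|M. 0)"
  proof (rule integral_dominated_convergence[where w="\<lambda>x. norm (f x) powr p"])
    show "AE x in M. (\<lambda>n. norm (truncate n f x - f x) powr p) \<longlonglongrightarrow> 0"
    proof (intro AE_I2)
      fix x
      have "\<forall>\<^sub>F n in sequentially. truncate n f x = f x"
      proof (cases "f x = 0")
        case False
        have "(\<lambda>n. inverse (real (Suc n))) \<longlonglongrightarrow> 0" by (rule LIMSEQ_inverse_real_of_nat)
        then have "\<forall>\<^sub>F n in sequentially. inverse (real (Suc n)) < norm (f x)"
          using False by (intro order_tendstoD) auto
        moreover obtain m :: nat where "norm (f x) \<le> m" using real_arch_simple by blast
        then have "\<forall>\<^sub>F n in sequentially. norm (f x) \<le> real (Suc n)"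
          by (intro eventually_sequentiallyI[of m]) auto
        ultimately show ?thesis by eventually_elim (auto simp: truncate_def)
      qed (auto simp: truncate_def)
      then show "(\<lambda>n. norm (truncate n f x - f x) powr p) \<longlonglongrightarrow> 0"
        by (intro tendsto_eventually) (auto elim: eventually_mono)
    qed
    show "AE x in M. norm (norm (truncate n f x - f x) powr p) \<le> norm (f x) powr p" for n
      using assms(2) by (intro AE_I2) (auto simp: truncate_def)
  qed (use Lp_spaceD(2)[OF assms(1)] in auto)
  then have "(\<lambda>n. (LINT x|M. norm (truncate n f x - f x) powr p) powr (1 / p)) \<longlonglongrightarrow> 0 powr (1 / p)"
    using assms(2) by (intro tendsto_powr') (auto intro!: always_eventually integral_nonneg_AE)
  then show ?thesis by (simp add: Lp_norm_def)
qed

lemma indicator_Lp: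
  assumes "A \<in> sets M" "emeasure M A < \<infinity>"
  shows "(indicator A :: 'a \<Rightarrow> complex) \<in> Lp_space M p"
proof -
  have "(\<lambda>x. norm (indicator A x :: complex) powr p) = indicator A"
    by (auto simp: indicator_def)
  then show ?thesis using assms by (simp add: Lp_space_def integrable_real_indicator)
qed

lemma Lp_1_iff: "f \<in> Lp_space M 1 \<longleftrightarrow> integrable M f"
  by (auto simp: Lp_space_def integrable_norm_iff)

lemma Lp_norm_1: "Lp_norm M 1 f = (LINT x|M. norm (f x))"
  by (simp add: Lp_norm_def integral_nonneg_AE)

section \<open>Symmetry and composition of ball averages\<close>

context ball_averages
begin

lemma E_const: "E v (\<lambda>_. c) x = c"
proof -
  have "E v (\<lambda>_. c) x = (1 / measure M (cball x (\<rho> v))) *\<^sub>R (measure M (cball x (\<rho> v)) *\<^sub>R c)"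
    using emeasure_cball_finite[of x "\<rho> v"]
    by (simp add: ball_average_def set_lebesgue_integral_def less_top)
  then show ?thesis using measure_cball_pos[OF \<rho>_pos, of x v] by simp
qed

lemma E_local:
  assumes "\<And>y. y \<in> cball x (\<rho> v) \<Longrightarrow> f y = g y"
  shows "E v f x = E v g x"
proof -
  have "indicator (cball x (\<rho> v)) y *\<^sub>R f y = indicator (cball x (\<rho> v)) y *\<^sub>R g y" for y
    using assms[of y] by (auto simp: indicator_def)
  then show ?thesis unfolding ball_average_def set_lebesgue_integral_def by metis
qed

lemma E_eq_const:
  assumes "\<And>y. y \<in> cball x (\<rho> v) \<Longrightarrow> f y = c"
  shows "E v f x = c"
  using E_local[of x v f "\<lambda>_. c"] assms by (simp add: E_const)

lemma E_norm: "E v (\<lambda>y. complex_of_real (norm (f y))) x = complex_of_real (LINT y|M. k v x y * norm (f y))"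
  unfolding E_kernel integral_complex_of_real[symmetric] by (simp add: scaleR_conv_of_real)

lemma Lp_space_norm:
  assumes "f \<in> Lp_space M p"
  shows "(\<lambda>y. complex_of_real (norm (f y))) \<in> Lp_space M p"
  using Lp_spaceD[OF assms] by (auto simp: Lp_space_def)

text \<open>Symmetry of \<open>k\<close> and Fubini. Absolute convergence is a hypothesis because
  \<open>g\<close> is a kernel in one application and an \<open>L^2\<close> function in another. The
  pairing is bilinear, without conjugation.\<close>

lemma E_pairing:
  assumes f: "f \<in> Lp_space M p" "1 \<le> p" and g [measurable]: "g \<in> borel_measurable M"
    and int: "integrable M (\<lambda>x. norm (g x) * (LINT y|M. k v x y * norm (f y)))"
  shows "(LINT x|M. g x * E v f x) = (LINT x|M. E v g x * f x)"
proof -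
  interpret pair_sigma_finite M M ..
  note [measurable] = Lp_spaceD(1)[OF f(1)]
  let ?h = "\<lambda>x y. g x * (k v x y *\<^sub>R f y)"
  have h: "integrable (M \<Otimes>\<^sub>M M) (\<lambda>(x, y). ?h x y)"
  proof (rule Fubini_integrable)
    show "integrable M (\<lambda>x. LINT y|M. norm (case (x, y) of (x, y) \<Rightarrow> ?h x y))"
    proof -
      have "norm (?h x y) = norm (g x) * (k v x y * norm (f y))" for x y by (simp add: norm_mult)
      then show ?thesis using int by (simp only: prod.case integral_mult_right_zero)
    qed
    show "AE x in M. integrable M (\<lambda>y. case (x, y) of (x, y) \<Rightarrow> ?h x y)"
      using integrable_k[OF f, of v] by (intro AE_I2) (simp del: mult_scaleR_right)
  qed measurable
  have "(LINT x|M. g x * E v f x) = (LINT x|M. LINT y|M. ?h x y)"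
    by (simp add: E_kernel del: mult_scaleR_right)
  also have "\<dots> = (LINT y|M. LINT x|M. ?h x y)"
    by (rule Fubini_integral[symmetric, OF h])
  also have "\<dots> = (LINT y|M. LINT x|M. (k v y x *\<^sub>R g x) * f y)"
    by (simp add: k_commute[of v _ "_ :: 'a"] scaleR_conv_of_real mult_ac)
  also have "\<dots> = (LINT y|M. E v g y * f y)"
    by (simp only: E_kernel integral_mult_left_zero)
  finally show ?thesis .
qed

lemma cball_mono_\<rho>: "0 < v \<Longrightarrow> v \<le> v' \<Longrightarrow> cball x (\<rho> v') \<subseteq> cball (x::'a) (\<rho> v)"
  using \<rho>_antimono by (intro subset_cball) auto

text \<open>If the outer ball is the smaller one, the inner average is already constant on it.
  Otherwise the inner average is moved onto the kernel of the outer ball, and that kernel is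
  constant on the smaller balls.\<close>

lemma E_E:
  assumes f: "f \<in> Lp_space M p" "1 \<le> p" and "0 < v" "0 < v'"
  shows "E v (E v' f) x = E (min v v') f x"
proof (cases "v' \<le> v")
  case True
  have "E v' f y = E v' f x" if "y \<in> cball x (\<rho> v)" for y
    using that cball_mono_\<rho>[OF assms(4) True, of x] by (intro E_const_on_ball) auto
  then have "E v (E v' f) x = E v' f x" by (rule E_eq_const)
  then show ?thesis using True by (simp add: min_absorb2)
next
  case False
  then have le: "v \<le> v'" by simp
  let ?g = "\<lambda>y. complex_of_real (k v x y)"
  have "E v (E v' f) x = (LINT y|M. ?g y * E v' f y)"
    unfolding E_kernel[of v] by (simp add: scaleR_conv_of_real)
  also have "\<dots> = (LINT y|M. E v' ?g y * f y)"
  proof (rule E_pairing[OF f])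
    have "integrable M (\<lambda>y. k v x y *\<^sub>R E v' (\<lambda>y. complex_of_real (norm (f y))) y)"
      by (intro integrable_k[OF _ f(2)] E_Lp Lp_space_norm f)
    then have "integrable M (\<lambda>y. norm (k v x y *\<^sub>R E v' (\<lambda>y. complex_of_real (norm (f y))) y))"
      by (rule integrable_norm)
    moreover have "(\<lambda>y. norm (k v x y *\<^sub>R E v' (\<lambda>y. complex_of_real (norm (f y))) y))
        = (\<lambda>y. norm (?g y) * (LINT z|M. k v' y z * norm (f z)))"
      by (rule ext) (simp add: E_norm integral_nonneg_AE)
    ultimately show "integrable M (\<lambda>y. norm (?g y) * (LINT z|M. k v' y z * norm (f z)))"
      by simp
  qed measurable
  also have "\<dots> = (LINT y|M. ?g y * f y)"
  proof -
    have "E v' ?g y = ?g y" for y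
    proof (rule E_eq_const)
      fix z assume "z \<in> cball y (\<rho> v')"
      then have "z \<in> cball y (\<rho> v)" using cball_mono_\<rho>[OF assms(3) le] by blast
      then have "x \<in> cball z (\<rho> v) \<longleftrightarrow> x \<in> cball y (\<rho> v)" using cball_eq by simp
      then show "?g z = ?g y" by (simp add: k_def dist_commute)
    qed
    then show ?thesis by simp
  qed
  also have "\<dots> = E v f x" unfolding E_kernel[of v] by (simp add: scaleR_conv_of_real)
  finally show ?thesis using le by (simp add: min_absorb1)
qed

lemma E_diff_Lp:
  assumes "f \<in> Lp_space M p" "1 \<le> p"
  shows "(\<lambda>x. E v f x - f x) \<in> Lp_space M p"
  using assms by (intro Lp_space_diff E_Lp) auto

section \<open>Convergence of \<open>E v\<close> to the identity by density\<close>

definition E_converges :: "real \<Rightarrow> ('a \<Rightarrow> complex) \<Rightarrow> bool" where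
  "E_converges p f \<longleftrightarrow> ((\<lambda>v. Lp_norm M p (\<lambda>x. E v f x - f x)) \<longlongrightarrow> 0) at_top"

lemma E_converges_approx:
  assumes f: "f \<in> Lp_space M p" and p: "1 \<le> p"
    and approx: "\<And>\<epsilon>. 0 < \<epsilon> \<Longrightarrow> \<exists>g\<in>Lp_space M p. E_converges p g \<and> Lp_norm M p (\<lambda>x. g x - f x) < \<epsilon>"
  shows "E_converges p f"
  unfolding E_converges_def
proof (rule tendstoI)
  fix e :: real assume e: "0 < e"
  then obtain g where g: "g \<in> Lp_space M p" "E_converges p g" "Lp_norm M p (\<lambda>x. g x - f x) < e / 3"
    using approx[of "e / 3"] by auto
  have "\<forall>\<^sub>F v in at_top. Lp_norm M p (\<lambda>x. E v g x - g x) < e / 3"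
    using g(2) e unfolding E_converges_def by (intro order_tendstoD(2)) auto
  then show "\<forall>\<^sub>F v in at_top. dist (Lp_norm M p (\<lambda>x. E v f x - f x)) 0 < e"
  proof eventually_elim
    case (elim v)
    note Lp = f g(1) E_Lp(1)[OF f p, of v] E_Lp(1)[OF g(1) p, of v]
    have "(\<lambda>x. E v f x - E v g x) = E v (\<lambda>x. f x - g x)"
      using E_add[OF f Lp_space_scale[OF g(1), of "-1"] p, of v] E_scale[of v "-1" g]
      by (auto simp: fun_eq_iff)
    then have "Lp_norm M p (\<lambda>x. E v f x - E v g x) \<le> Lp_norm M p (\<lambda>x. f x - g x)"
      using E_Lp(2)[OF Lp_space_diff[OF f g(1)] p] p by simp
    moreover have "Lp_norm M p (\<lambda>x. E v f x - f x) \<le> Lp_norm M p (\<lambda>x. E v f x - E v g x)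
        + (Lp_norm M p (\<lambda>x. E v g x - g x) + Lp_norm M p (\<lambda>x. g x - f x))"
      using Lp_norm_triangle_diff[OF Lp(3,4,1) p] Lp_norm_triangle_diff[OF Lp(4,2,1) p] by linarith
    ultimately have "Lp_norm M p (\<lambda>x. E v f x - f x) < e"
      using elim g(3) Lp_norm_minus_commute[of M p f g] by linarith
    then show ?case using Lp_norm_nonneg[of M p] by simp
  qed
qed

text \<open>Regularity gives a compact \<open>K\<close> inside an open \<open>U\<close>, with
  \<open>U\<close> close to both \<open>K\<close> and \<open>A\<close>. Thickening \<open>K\<close>
  by a radius \<open>r\<close> that still fits into \<open>U\<close> yields a union of balls of one
  radius, so \<open>indicator V\<close> is fixed by \<open>E v\<close> once
  \<open>\<rho> v \<le> r\<close>.\<close>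

lemma uniformly_open_approx:
  assumes A: "A \<in> sets M" "emeasure M A < \<infinity>" and "0 < \<epsilon>"
  obtains V r where "V \<in> sets M" "emeasure M V < \<infinity>" "0 < r" "\<And>x. x \<in> V \<Longrightarrow> cball x r \<subseteq> V"
    "measure M (A - V) + measure M (V - A) < \<epsilon>"
proof -
  have outer: "emeasure M A = (INF U\<in>{U. open U \<and> A \<subseteq> U}. emeasure M U)"
    using radon A(1) unfolding radon_measure_def by auto
  have inner: "emeasure M U = (SUP K\<in>{K. compact K \<and> K \<subseteq> U}. emeasure M K)" if "open U" for U
    using radon that unfolding radon_measure_def by blast
  have "emeasure M A < emeasure M A + ennreal (\<epsilon> / 2)"
    using A(2) assms(3) by (simp add: less_top ennreal_add_left_cancel_less[of _ 0, simplified])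
  then obtain U where U: "open U" "A \<subseteq> U" "emeasure M U < emeasure M A + ennreal (\<epsilon> / 2)"
    by (subst (asm) outer) (auto simp: INF_less_iff)
  have Uf: "emeasure M U < \<infinity>" using U(3) A(2) by (simp add: order_less_trans)
  show ?thesis
  proof (cases "U = {}")
    case True
    then show ?thesis using U(2) assms(3) by (intro that[of "{}" 1]) auto
  next
    case False
    then have Upos: "0 < emeasure M U" using support U(1) unfolding full_support_def by auto
    \<comment> \<open>The maximum with 0 allows strict comparisons to pass through
      \<open>ennreal\<close>; \<open>c\<close> stays strictly below the mass of \<open>U\<close>,
      which is positive because \<open>U\<close> is nonempty.\<close>
    define c where "c = max 0 (measure M U - \<epsilon> / 2)"
    have "0 < measure M U" using Upos Uf by (simp add: measure_def enn2real_positive_iff less_top)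
    then have "ennreal c < ennreal (measure M U)"
      using assms(3) by (intro ennreal_lessI) (auto simp: c_def)
    then have "ennreal c < emeasure M U"
      using Uf by (simp add: emeasure_eq_ennreal_measure less_top)
    then obtain K where K: "compact K" "K \<subseteq> U" "ennreal c < emeasure M K"
      unfolding inner[OF U(1)] by (auto simp: less_SUP_iff)
    obtain r where r: "0 < r" "(\<Union>x\<in>K. cball x r) \<subseteq> U"
      using compact_subset_open_imp_cball_epsilon_subset[OF K(1) U(1) K(2)] by auto
    define V where "V = (\<Union>x\<in>K. cball x r)"
    have V: "K \<subseteq> V" "V \<subseteq> U" using r by (auto simp: V_def)
    have oV: "open V" unfolding V_def using open_cball[OF r(1)] by blast
    have sets [measurable]: "V \<in> sets M" "U \<in> sets M" "K \<in> sets M"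
      using oV U(1) K(1) by (auto intro: borel_compact)
    have fin: "emeasure M V < \<infinity>" "emeasure M K < \<infinity>"
      using emeasure_mono[OF V(2) sets(2)] emeasure_mono[OF K(2) sets(2)] Uf by (auto elim: le_less_trans)
    note fm = fin Uf A(2)
    have "measure M U < measure M A + \<epsilon> / 2"
      using U(3) fm assms(3)
      by (simp add: emeasure_eq_ennreal_measure less_top ennreal_less_iff flip: ennreal_plus)
    moreover have "c < measure M K"
    proof -
      have "ennreal c < ennreal (measure M K)" using K(3) fm by (simp add: emeasure_eq_ennreal_measure less_top)
      moreover have "0 \<le> c" by (simp add: c_def)
      ultimately show ?thesis by (simp only: ennreal_less_iff)
    qed
    then have "measure M U - \<epsilon> / 2 < measure M K" by (simp add: c_def)
    moreover have "measure M (U - K) = measure M U - measure M K"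
      using fm K(2) sets by (intro measure_Diff) (auto simp: fmeasurable_def)
    moreover have "measure M (U - A) = measure M U - measure M A"
      using fm U(2) sets A by (intro measure_Diff) (auto simp: fmeasurable_def)
    moreover have "U - K \<in> fmeasurable M" "U - A \<in> fmeasurable M"
      using fmeasurableI[OF sets(2) Uf] sets A(1)
      by (auto simp only: intro!: fmeasurable_Diff)
    then have "measure M (A - V) \<le> measure M (U - K)" "measure M (V - A) \<le> measure M (U - A)"
      using V U(2) sets A by (auto intro!: measure_mono_fmeasurable)
    ultimately have "measure M (A - V) + measure M (V - A) < \<epsilon>" by linarith
    moreover have "cball x r \<subseteq> V" if x: "x \<in> V" for x
    proof -
      obtain y where "y \<in> K" "x \<in> cball y r" using x by (auto simp: V_def)
      then show ?thesis using cball_eq[of x y r] by (auto simp: V_def)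
    qed
    ultimately show ?thesis using that[of V r] sets fin r by blast
  qed
qed

lemma E_converges_scale:
  assumes "f \<in> Lp_space M p" "1 \<le> p" "E_converges p f"
  shows "E_converges p (\<lambda>x. c * f x)"
proof -
  have "Lp_norm M p (\<lambda>x. E v (\<lambda>x. c * f x) x - c * f x) = norm c * Lp_norm M p (\<lambda>x. E v f x - f x)" for v
    using assms(2) by (simp add: E_scale Lp_norm_scale flip: right_diff_distrib)
  then show ?thesis
    using tendsto_mult_right_zero[OF assms(3)[unfolded E_converges_def]] by (simp add: E_converges_def)
qed

lemma E_converges_add:
  assumes f: "f \<in> Lp_space M p" "E_converges p f" and g: "g \<in> Lp_space M p" "E_converges p g"
    and p: "1 \<le> p"
  shows "E_converges p (\<lambda>x. f x + g x)"
  unfolding E_converges_def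
proof (rule Lim_null_comparison)
  show "((\<lambda>v. Lp_norm M p (\<lambda>x. E v f x - f x) + Lp_norm M p (\<lambda>x. E v g x - g x)) \<longlongrightarrow> 0) at_top"
    using tendsto_add[OF f(2)[unfolded E_converges_def] g(2)[unfolded E_converges_def]] by simp
  have "Lp_norm M p (\<lambda>x. E v (\<lambda>x. f x + g x) x - (f x + g x))
      \<le> Lp_norm M p (\<lambda>x. E v f x - f x) + Lp_norm M p (\<lambda>x. E v g x - g x)" for v
    using Lp_norm_triangle[OF E_diff_Lp[OF f(1) p] E_diff_Lp[OF g(1) p] p, of v v] f(1) g(1) p
    by (simp add: E_add algebra_simps)
  then show "\<forall>\<^sub>F v in at_top. norm (Lp_norm M p (\<lambda>x. E v (\<lambda>x. f x + g x) x - (f x + g x)))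
      \<le> Lp_norm M p (\<lambda>x. E v f x - f x) + Lp_norm M p (\<lambda>x. E v g x - g x)"
    by (intro always_eventually) (simp add: Lp_norm_nonneg)
qed

lemma E_converges_indicator:
  assumes A: "A \<in> sets M" "emeasure M A < \<infinity>"
  shows "E_converges 1 (\<lambda>x. indicator A x)"
proof (rule E_converges_approx)
  show "indicator A \<in> Lp_space M 1" using A by (rule indicator_Lp)
  fix \<epsilon> :: real assume "0 < \<epsilon>"
  then obtain V r where V: "V \<in> sets M" "emeasure M V < \<infinity>" "0 < r" "\<And>x. x \<in> V \<Longrightarrow> cball x r \<subseteq> V"
    "measure M (A - V) + measure M (V - A) < \<epsilon>"
    using uniformly_open_approx[OF A] by metis
  let ?g = "indicator V :: 'a \<Rightarrow> complex"
  obtain v0 where v0: "\<forall>v\<ge>v0. \<rho> v \<le> r" using \<rho>_limit[OF V(3)] by auto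
  have "E v ?g = ?g" if "v \<ge> v0" for v
  proof (rule ext, rule E_eq_const)
    fix x y :: 'a assume "y \<in> cball x (\<rho> v)"
    then have "y \<in> cball x r" "x \<in> cball y r"
      using subset_cball[of "\<rho> v" r x] v0 that by (auto simp: dist_commute)
    then have "y \<in> V \<longleftrightarrow> x \<in> V" using V(4) by blast
    then show "?g y = ?g x" by (simp add: indicator_def)
  qed
  then have "\<forall>\<^sub>F v in at_top. Lp_norm M 1 (\<lambda>x. E v ?g x - ?g x) = 0"
    by (intro eventually_at_top_linorderI[of v0]) (simp add: Lp_norm_def)
  then have "E_converges 1 ?g" unfolding E_converges_def by (rule tendsto_eventually)
  moreover have "Lp_norm M 1 (\<lambda>x. ?g x - indicator A x) < \<epsilon>"
  proof -
    have "(LINT x|M. norm (?g x - indicator A x)) = (LINT x|M. indicator (A - V) x + indicator (V - A) x)"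
      by (intro Bochner_Integration.integral_cong) (auto simp: indicator_def)
    also have "\<dots> = measure M (A - V) + measure M (V - A)"
    proof (subst Bochner_Integration.integral_add)
      show "integrable M (indicator (A - V) :: 'a \<Rightarrow> real)" "integrable M (indicator (V - A) :: 'a \<Rightarrow> real)"
        using A V(1,2) by (auto intro!: integrable_real_indicator intro: le_less_trans[OF emeasure_mono])
    qed (use A V(1) in auto)
    finally show ?thesis using V(5) by (simp add: Lp_norm_1)
  qed
  moreover have "?g \<in> Lp_space M 1" using V(1,2) by (rule indicator_Lp)
  ultimately show "\<exists>g\<in>Lp_space M 1. E_converges 1 g \<and> Lp_norm M 1 (\<lambda>x. g x - indicator A x) < \<epsilon>"
    by blast
qed simp

lemma E_converges_L1:
  assumes "integrable M f"
  shows "E_converges 1 f"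
  using assms
proof (induction rule: integrable_induct)
  case (base A c)
  have "E_converges 1 (\<lambda>x. c * indicator A x)"
    using base by (intro E_converges_scale E_converges_indicator indicator_Lp) auto
  then show ?case by (simp add: scaleR_conv_of_real mult.commute of_real_indicator)
next
  case (add f g)
  then show ?case by (intro E_converges_add) (auto simp: Lp_1_iff)
next
  case (lim f s)
  show ?case
  proof (rule E_converges_approx)
    show "f \<in> Lp_space M 1" using lim by (simp add: Lp_1_iff)
    fix \<epsilon> :: real assume e: "0 < \<epsilon>"
    note [measurable] = borel_measurable_integrable[OF lim.hyps(4)] borel_measurable_integrable[OF lim.hyps(1)]
    have "(\<lambda>n. LINT x|M. norm (s n x - f x)) \<longlonglongrightarrow> (LINT x|M. 0)"
    proof (rule integral_dominated_convergence[where w="\<lambda>x. 3 * norm (f x)"])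
      show "AE x in M. (\<lambda>n. norm (s n x - f x)) \<longlonglongrightarrow> 0"
        using lim.hyps(2) by (intro AE_I2 tendsto_norm_zero LIM_zero) auto
      show "AE x in M. norm (norm (s n x - f x)) \<le> 3 * norm (f x)" for n
      proof (intro AE_I2)
        fix x assume "x \<in> space M"
        then show "norm (norm (s n x - f x)) \<le> 3 * norm (f x)"
          using lim.hyps(3)[of x n] norm_triangle_ineq4[of "s n x" "f x"] by simp
      qed
    qed (use lim.hyps(4) in simp_all)
    then have "\<forall>\<^sub>F n in sequentially. Lp_norm M 1 (\<lambda>x. s n x - f x) < \<epsilon>"
      using e by (intro order_tendstoD) (auto simp: Lp_norm_1)
    then obtain n where "Lp_norm M 1 (\<lambda>x. s n x - f x) < \<epsilon>"
      by (auto simp: eventually_sequentially)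
    then show "\<exists>g\<in>Lp_space M 1. E_converges 1 g \<and> Lp_norm M 1 (\<lambda>x. g x - f x) < \<epsilon>"
      using lim by (intro bexI[of _ "s n"]) (auto simp: Lp_1_iff)
  qed simp
qed

text \<open>For a truncation \<open>g\<close> the difference \<open>E v g - g\<close> is bounded by
  a constant \<open>C\<close>, so the \<open>p\<close>-th power of its norm is at most
  \<open>C powr (p - 1)\<close> times the norm itself, and \<open>L^1\<close> convergence is
  enough.\<close>

lemma E_converges_Lp:
  assumes f: "f \<in> Lp_space M p" and p: "1 \<le> p"
  shows "E_converges p f"
proof (rule E_converges_approx[OF f p])
  fix \<epsilon> :: real assume e: "0 < \<epsilon>"
  have "\<forall>\<^sub>F n in sequentially. Lp_norm M p (\<lambda>x. truncate n f x - f x) < \<epsilon>"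
    using truncate_tendsto[OF f] p e by (intro order_tendstoD) auto
  then obtain n where n: "Lp_norm M p (\<lambda>x. truncate n f x - f x) < \<epsilon>"
    by (auto simp: eventually_sequentially)
  let ?g = "truncate n f"
  let ?C = "2 * real (Suc n)"
  have g: "?g \<in> Lp_space M q" if "1 \<le> q" for q
    using truncate_Lp[OF f, of q] p that by simp
  have bound: "norm (?g x) \<le> Suc n" for x by (simp add: truncate_def)
  have diff: "norm (E v ?g x - ?g x) \<le> ?C" for v x
  proof -
    have "norm (E v ?g x) \<le> (LINT y|M. k v x y * norm (?g y))" by (rule norm_E_le)
    also have "\<dots> \<le> (LINT y|M. k v x y * Suc n)"
    proof (rule integral_mono)
      show "integrable M (\<lambda>y. k v x y * norm (?g y))"
        using integrable_k_powr[OF g[of 1], of v x] by simp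
      show "integrable M (\<lambda>y. k v x y * Suc n)"
        using nn_integral_k[of v x] by (intro integrable_mult_left integrableI_nonneg) auto
    qed (use bound in \<open>auto intro: mult_left_mono\<close>)
    also have "\<dots> = Suc n"
      using nn_integral_k[of v x] by (simp add: integral_eq_nn_integral)
    finally have "norm (E v ?g x - ?g x) \<le> real (Suc n) + real (Suc n)"
      by (intro order_trans[OF norm_triangle_ineq4 add_mono] bound) simp
    then show ?thesis by simp
  qed
  have le: "Lp_norm M p (\<lambda>x. E v ?g x - ?g x) \<le> (?C powr (p - 1) * Lp_norm M 1 (\<lambda>x. E v ?g x - ?g x)) powr (1 / p)" for v
  proof -
    let ?d = "\<lambda>x. E v ?g x - ?g x"
    have "(LINT x|M. norm (?d x) powr p) \<le> (LINT x|M. ?C powr (p - 1) * norm (?d x))"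
    proof (rule integral_mono)
      show "integrable M (\<lambda>x. norm (?d x) powr p)"
        using Lp_spaceD(2)[OF E_diff_Lp[OF g[OF p] p]] .
      show "integrable M (\<lambda>x. ?C powr (p - 1) * norm (?d x))"
        using E_diff_Lp[OF g[of 1], of v] by (simp add: Lp_1_iff)
      fix x
      have "norm (?d x) powr p = norm (?d x) powr (p - 1) * norm (?d x)"
        using powr_add[of "norm (?d x)" "p - 1" 1] by simp
      also have "\<dots> \<le> ?C powr (p - 1) * norm (?d x)"
        using diff p by (intro mult_right_mono powr_mono2) auto
      finally show "norm (?d x) powr p \<le> ?C powr (p - 1) * norm (?d x)" .
    qed
    then show ?thesis unfolding Lp_norm_1 unfolding Lp_norm_def using p
      by (intro powr_mono2) (auto intro!: integral_nonneg_AE)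
  qed
  have "((\<lambda>v. Lp_norm M 1 (\<lambda>x. E v ?g x - ?g x)) \<longlongrightarrow> 0) at_top"
    using E_converges_L1[of ?g] g[of 1] by (simp add: Lp_1_iff E_converges_def)
  then have "((\<lambda>v. (?C powr (p - 1) * Lp_norm M 1 (\<lambda>x. E v ?g x - ?g x)) powr (1 / p)) \<longlongrightarrow> 0 powr (1 / p)) at_top"
    using p by (intro tendsto_powr' tendsto_mult_right_zero tendsto_const)
      (auto intro!: always_eventually mult_nonneg_nonneg simp: Lp_norm_nonneg)
  then have "E_converges p ?g"
    unfolding E_converges_def
    by (rule Lim_null_comparison[rotated, OF tendsto_eq_rhs])
      (use le in \<open>auto simp: Lp_norm_nonneg\<close>)
  then show "\<exists>g\<in>Lp_space M p. E_converges p g \<and> Lp_norm M p (\<lambda>x. g x - f x) < \<epsilon>"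
    using n g[OF p] by blast
qed

end

section \<open>Weighted integrals of the spectral projections\<close>

text \<open>The spectrum lies in the nonnegative half-line, and radii at \<open>v \<le> 0\<close>
  have no meaning. Vanishing there lets all integrals run over the whole of
  \<open>lborel\<close>.\<close>

definition weight :: "(real \<Rightarrow> complex) \<Rightarrow> bool" where
  "weight w \<longleftrightarrow> integrable lborel w \<and> (\<forall>v\<le>0. w v = 0)"

text \<open>The symbol of the operator with weight \<open>w\<close>: the factor by which it acts at
  the spectral value \<open>u\<close>, where the averages jump from 0 to the identity.\<close>

definition tail :: "(real \<Rightarrow> complex) \<Rightarrow> real \<Rightarrow> complex" where
  "tail w u = (LINT v:{u<..}|lborel. w v)"

text \<open>By the product rule, \<open>tail (wprod w w') = tail w * tail w'\<close>, as \<open>w\<close> is minus the derivative of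
  \<^term>\<open>tail w\<close>.\<close>

definition wprod :: "(real \<Rightarrow> complex) \<Rightarrow> (real \<Rightarrow> complex) \<Rightarrow> real \<Rightarrow> complex" where
  "wprod w w' v = w v * tail w' v + w' v * tail w v"

lemma weightD:
  assumes "weight w"
  shows "integrable lborel w" "v \<le> 0 \<Longrightarrow> w v = 0" "w \<in> borel_measurable borel"
  using assms borel_measurable_integrable[of lborel w] by (auto simp: weight_def)

lemma measurable_tail [measurable (raw)]:
  assumes [measurable]: "w \<in> borel_measurable borel" "u \<in> borel_measurable N"
  shows "(\<lambda>i. tail w (u i)) \<in> borel_measurable N"
proof -
  have "(\<lambda>u. LINT v|lborel. (if u < v then w v else 0)) \<in> borel_measurable borel"
    by measurable
  moreover have "tail w = (\<lambda>u. LINT v|lborel. (if u < v then w v else 0))"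
    unfolding tail_def set_lebesgue_integral_def
    by (intro ext Bochner_Integration.integral_cong) (auto simp: indicator_def)
  ultimately have [measurable]: "tail w \<in> borel_measurable borel" by simp
  show ?thesis by measurable
qed

lemma tail_bound:
  assumes "integrable lborel w"
  shows "norm (tail w u) \<le> (LINT v|lborel. norm (w v))"
proof -
  have "norm (tail w u) \<le> (LINT v|lborel. norm (indicator {u<..} v *\<^sub>R w v))"
    unfolding tail_def set_lebesgue_integral_def by (rule integral_norm_bound)
  also have "\<dots> \<le> (LINT v|lborel. norm (w v))"
    using assms
    by (intro integral_mono integrable_norm integrable_mult_indicator) (auto simp: indicator_def)
  finally show ?thesis .
qed

lemma tail_add:
  assumes "integrable lborel w" "integrable lborel w'"
  shows "tail (\<lambda>v. w v + w' v) u = tail w u + tail w' u"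
  unfolding tail_def using assms
  by (intro set_integral_add) (auto simp: set_integrable_def intro!: integrable_mult_indicator)

lemma tail_scale: "tail (\<lambda>v. c * w v) u = c * tail w u"
  unfolding tail_def by simp

lemma tail_of_real: "tail (\<lambda>v. complex_of_real (a v)) u = complex_of_real (LINT v:{u<..}|lborel. a v)"
  unfolding tail_def set_lebesgue_integral_def
  by (simp add: scaleR_conv_of_real flip: of_real_mult integral_complex_of_real)

lemma weight_add: "weight w \<Longrightarrow> weight w' \<Longrightarrow> weight (\<lambda>v. w v + w' v)"
  and weight_scale: "weight w \<Longrightarrow> weight (\<lambda>v. c * w v)"
  by (auto simp: weight_def)

lemma weight_wprod:
  assumes "weight w" "weight w'"
  shows "weight (wprod w w')"
proof -
  note [measurable] = weightD(3)[OF assms(1)] weightD(3)[OF assms(2)]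
  have *: "integrable lborel (\<lambda>v. w v * tail w' v)" if "weight w" "weight w'" for w w'
  proof (rule Bochner_Integration.integrable_bound
      [where f="\<lambda>v. (LINT v|lborel. norm (w' v)) *\<^sub>R w v"])
    note [measurable] = weightD(3)[OF that(1)] weightD(3)[OF that(2)]
    show "(\<lambda>v. w v * tail w' v) \<in> borel_measurable lborel" by measurable
    show "AE v in lborel. norm (w v * tail w' v) \<le> norm ((LINT v|lborel. norm (w' v)) *\<^sub>R w v)"
    proof (intro AE_I2)
      fix v
      have "norm (w v) * norm (tail w' v) \<le> norm (w v) * (LINT v|lborel. norm (w' v))"
        using tail_bound[OF weightD(1)[OF that(2)]] by (intro mult_left_mono) auto
      then show "norm (w v * tail w' v) \<le> norm ((LINT v|lborel. norm (w' v)) *\<^sub>R w v)"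
        by (simp add: norm_mult mult.commute abs_of_nonneg integral_nonneg_AE)
    qed
  qed (use weightD(1)[OF that(1)] in simp)
  show ?thesis
    using *[OF assms] *[OF assms(2,1)] assms unfolding weight_def wprod_def by auto
qed

lemma wprod_commute: "wprod w w' = wprod w' w"
  by (auto simp: wprod_def)

text \<open>Cut the plane along the diagonal: on each side \<open>min v v'\<close> is one of the
  variables, and integrating out the other one leaves a tail. With an indicator for \<open>h\<close>
  this is the product rule for symbols, with \<open>h v = E v f x\<close> the composition rule for
  operators.\<close>

lemma integral_min_wprod:
  fixes h :: "real \<Rightarrow> complex"
  assumes w: "weight w" "weight w'" and h: "h \<in> borel_measurable borel"
    and int: "integrable (lborel \<Otimes>\<^sub>M lborel) (\<lambda>(v, v'). w v * w' v' * h (min v v'))"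
  shows "(LINT v|lborel. LINT v'|lborel. w v * w' v' * h (min v v')) = (LINT v|lborel. wprod w w' v * h v)"
    and "integrable lborel (\<lambda>v. wprod w w' v * h v)"
proof -
  note [measurable] = weightD(3)[OF w(1)] weightD(3)[OF w(2)] h
  let ?g = "\<lambda>v v'. w v * w' v' * h (min v v')"
  let ?g1 = "\<lambda>v v'. if v < v' then ?g v v' else 0" and ?g2 = "\<lambda>v v'. if v' \<le> v then ?g v v' else 0"
  have i1: "integrable (lborel \<Otimes>\<^sub>M lborel) (\<lambda>(v, v'). ?g1 v v')"
    by (rule Bochner_Integration.integrable_bound[OF int]) (measurable, auto)
  have i2: "integrable (lborel \<Otimes>\<^sub>M lborel) (\<lambda>(v, v'). ?g2 v v')"
    by (rule Bochner_Integration.integrable_bound[OF int]) (measurable, auto)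
  have e1: "(LINT v'|lborel. ?g1 v v') = w v * tail w' v * h v" for v
  proof -
    have "(LINT v'|lborel. ?g1 v v') = (LINT v'|lborel. (w v * h v) * (indicator {v<..} v' *\<^sub>R w' v'))"
      by (intro Bochner_Integration.integral_cong) (auto simp: indicator_def)
    then show ?thesis
      by (simp only: tail_def set_lebesgue_integral_def integral_mult_right_zero mult_ac)
  qed
  have e2: "(LINT v|lborel. ?g2 v v') = w' v' * tail w v' * h v'" for v'
  proof -
    have "(LINT v|lborel. ?g2 v v') = (LINT v|lborel. (w' v' * h v') * (indicator {v'<..} v *\<^sub>R w v))"
    proof (rule integral_cong_AE)
      \<comment> \<open>\<open>?g2\<close> contains the diagonal while \<open>tail\<close>
        integrates over an open half-line; they differ at a single point.\<close>
      show "AE v in lborel. ?g2 v v' = (w' v' * h v') * (indicator {v'<..} v *\<^sub>R w v)"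
        using AE_lborel_singleton[of v'] by eventually_elim (auto simp: indicator_def)
    qed measurable
    then show ?thesis
      by (simp only: tail_def set_lebesgue_integral_def integral_mult_right_zero mult_ac)
  qed
  have I1: "integrable lborel (\<lambda>v. w v * tail w' v * h v)"
    using lborel_pair.integrable_fst'[OF i1] by (simp add: e1)
  have I2: "integrable lborel (\<lambda>v. w' v * tail w v * h v)"
    using lborel_pair.integrable_snd[OF i2] by (simp add: e2)
  have eq: "wprod w w' v * h v = w v * tail w' v * h v + w' v * tail w v * h v" for v
    by (simp add: wprod_def algebra_simps)
  show "integrable lborel (\<lambda>v. wprod w w' v * h v)"
    unfolding eq using I1 I2 by simp
  have "(LINT v|lborel. LINT v'|lborel. ?g v v') = (LINT z|(lborel \<Otimes>\<^sub>M lborel). (case z of (v, v') \<Rightarrow> ?g v v'))"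
    by (rule lborel_pair.integral_fst[OF int])
  also have "\<dots> = (LINT z|(lborel \<Otimes>\<^sub>M lborel). (case z of (v, v') \<Rightarrow> ?g1 v v') + (case z of (v, v') \<Rightarrow> ?g2 v v'))"
    by (intro Bochner_Integration.integral_cong) auto
  also have "\<dots> = (LINT v|lborel. LINT v'|lborel. ?g1 v v') + (LINT v'|lborel. LINT v|lborel. ?g2 v v')"
    using i1 i2 by (subst Bochner_Integration.integral_add)
      (auto simp: lborel_pair.integral_fst lborel_pair.integral_snd)
  also have "\<dots> = (LINT v|lborel. wprod w w' v * h v)"
    unfolding e1 e2 eq using I1 I2 by simp
  finally show "(LINT v|lborel. LINT v'|lborel. ?g v v') = (LINT v|lborel. wprod w w' v * h v)" .
qed

lemma integrable_weight_product:
  assumes "weight w" "weight w'" and [measurable]: "h \<in> borel_measurable borel" and "\<And>v. norm (h v) \<le> C"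
  shows "integrable (lborel \<Otimes>\<^sub>M lborel) (\<lambda>(v, v'). w v * w' v' * (h (min v v') :: complex))"
proof -
  note [measurable] = weightD(3)[OF assms(1)] weightD(3)[OF assms(2)]
  have C: "0 \<le> C" using order_trans[OF norm_ge_zero assms(4)] .
  have "integrable (lborel \<Otimes>\<^sub>M lborel) (\<lambda>(v, v'). w v * w' v')"
  proof (rule lborel_pair.Fubini_integrable)
    show "integrable lborel (\<lambda>v. LINT v'|lborel. norm (case (v, v') of (v, v') \<Rightarrow> w v * w' v'))"
      using weightD(1)[OF assms(1)] by (simp add: norm_mult)
  qed (use weightD(1)[OF assms(2)] in auto)
  then have "integrable (lborel \<Otimes>\<^sub>M lborel) (\<lambda>z. C * (case z of (v, v') \<Rightarrow> w v * w' v'))"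
    by simp
  then show ?thesis
  proof (rule Bochner_Integration.integrable_bound)
    show "AE z in lborel \<Otimes>\<^sub>M lborel. norm (case z of (v, v') \<Rightarrow> w v * w' v' * h (min v v'))
        \<le> norm (complex_of_real C * (case z of (v, v') \<Rightarrow> w v * w' v'))"
      using assms(4) C by (intro AE_I2) (auto simp: norm_mult mult.commute intro!: mult_mono)
  qed measurable
qed

text \<open>The indicator of \<open>{u<..}\<close> at \<open>min v v'\<close> is the product of its
  values at \<open>v\<close> and \<open>v'\<close>, so the double integral in
  \<open>integral_min_wprod\<close> factorizes.\<close>

lemma tail_wprod:
  assumes w: "weight w" "weight w'"
  shows "tail (wprod w w') u = tail w u * tail w' u"
proof -
  let ?h = "\<lambda>v. indicator {u<..} v :: complex"
  have "tail (wprod w w') u = (LINT v|lborel. wprod w w' v * ?h v)"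
    unfolding tail_def set_lebesgue_integral_def
    by (intro Bochner_Integration.integral_cong) (auto simp: indicator_def)
  also have "\<dots> = (LINT v|lborel. LINT v'|lborel. w v * w' v' * ?h (min v v'))"
    using w by (intro integral_min_wprod(1)[symmetric] integrable_weight_product[where C=1])
      (auto simp: indicator_def)
  also have "\<dots> = (LINT v|lborel. LINT v'|lborel. (indicator {u<..} v *\<^sub>R w v) * (indicator {u<..} v' *\<^sub>R w' v'))"
    by (intro Bochner_Integration.integral_cong) (auto simp: indicator_def)
  also have "\<dots> = tail w u * tail w' u"
    by (simp only: tail_def set_lebesgue_integral_def integral_mult_right_zero integral_mult_left_zero)
  finally show ?thesis .
qed

lemma finite_measure_density_norm:
  fixes w :: "'i \<Rightarrow> complex"
  assumes "integrable N w"
  shows "finite_measure (density N (\<lambda>v. norm (w v)))"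
    and "measure (density N (\<lambda>v. norm (w v))) (space N) = (LINT v|N. norm (w v))"
proof -
  have [measurable]: "w \<in> borel_measurable N" using assms by (rule borel_measurable_integrable)
  have *: "emeasure (density N (\<lambda>v. norm (w v))) (space N) = ennreal (LINT v|N. norm (w v))"
  proof -
    have "emeasure (density N (\<lambda>v. norm (w v))) (space N) = (\<integral>\<^sup>+v. ennreal (norm (w v)) * indicator (space N) v \<partial>N)"
      by (rule emeasure_density) auto
    also have "\<dots> = (\<integral>\<^sup>+v. ennreal (norm (w v)) \<partial>N)"
      by (rule nn_integral_cong) simp
    finally show ?thesis using nn_integral_eq_integral[OF integrable_norm[OF assms]] by simp
  qed
  show "finite_measure (density N (\<lambda>v. norm (w v)))"
    by (rule finite_measureI) (simp add: *)
  show "measure (density N (\<lambda>v. norm (w v))) (space N) = (LINT v|N. norm (w v))"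
    using * by (simp add: measure_def integral_nonneg_AE)
qed

section \<open>Operators with integrable weight\<close>

context ball_averages
begin

definition T :: "(real \<Rightarrow> complex) \<Rightarrow> 'a oper" where
  "T w f x = (LINT v|lborel. w v * E v f x)"

text \<open>The index space is left general: it is the line for a single operator, and the plane
  with \<open>\<kappa>\<close> the minimum of the coordinates for a composition.\<close>

lemma average_E:
  fixes w :: "'i \<Rightarrow> complex"
  assumes "sigma_finite_measure N" and w: "integrable N w" and [measurable]: "\<kappa> \<in> borel_measurable N"
    and f: "f \<in> Lp_space M p" and p: "1 \<le> p"
  shows "AE x in M. integrable N (\<lambda>i. w i * E (\<kappa> i) f x)"
    and "(\<lambda>x. complex_of_real (LINT i|N. norm (w i * E (\<kappa> i) f x))) \<in> Lp_space M p"
    and "(\<lambda>x. LINT i|N. w i * E (\<kappa> i) f x) \<in> Lp_space M p"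
    and "Lp_norm M p (\<lambda>x. LINT i|N. w i * E (\<kappa> i) f x) \<le> (LINT i|N. norm (w i)) * Lp_norm M p f"
proof -
  have [measurable]: "w \<in> borel_measurable N" using w by (rule borel_measurable_integrable)
  note [measurable] = Lp_spaceD(1)[OF f]
  let ?N = "density N (\<lambda>i. norm (w i))"
  \<comment> \<open>The complex weight is split into the density \<open>norm (w i)\<close>, which
    gives a finite measure, and the phase \<open>sgn (w i)\<close>, which goes into the
    integrand.\<close>
  let ?F = "\<lambda>i x. sgn (w i) * E (\<kappa> i) f x"
  let ?W = "LINT i|N. norm (w i)"
  have W: "0 \<le> ?W" by (intro integral_nonneg_AE) simp
  have eq: "norm (w i) *\<^sub>R ?F i x = w i * E (\<kappa> i) f x" for i x
    by (cases "w i = 0") (simp_all add: sgn_div_norm scaleR_conv_of_real)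
  have eqn: "norm (w i) * norm (?F i x) = norm (w i * E (\<kappa> i) f x)" for i x
    by (simp add: norm_mult norm_sgn)
  have "(\<integral>\<^sup>+i. \<integral>\<^sup>+x. norm (?F i x) powr p \<partial>M \<partial>?N) \<le> (\<integral>\<^sup>+i. ennreal (LINT x|M. norm (f x) powr p) \<partial>?N)"
  proof (rule nn_integral_mono)
    fix i
    have "(\<integral>\<^sup>+x. norm (?F i x) powr p \<partial>M) \<le> (\<integral>\<^sup>+x. norm (E (\<kappa> i) f x) powr p \<partial>M)"
      using p by (intro nn_integral_mono ennreal_leI powr_mono2) (auto simp: norm_mult norm_sgn)
    also have "\<dots> \<le> ennreal (LINT x|M. norm (f x) powr p)" by (rule nn_integral_E_powr_le[OF f p])
    finally show "(\<integral>\<^sup>+x. norm (?F i x) powr p \<partial>M) \<le> ennreal (LINT x|M. norm (f x) powr p)" .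
  qed
  also have "\<dots> = ennreal (LINT x|M. norm (f x) powr p) * ennreal ?W"
  proof -
    have "emeasure ?N (space ?N) = ennreal ?W"
      using finite_measure.emeasure_eq_measure[OF finite_measure_density_norm(1)[OF w]]
        finite_measure_density_norm(2)[OF w] by simp
    then show ?thesis by simp
  qed
  also have "\<dots> = ennreal (?W * (LINT x|M. norm (f x) powr p))"
    by (simp add: ennreal_mult W integral_nonneg_AE mult.commute)
  finally have K: "(\<integral>\<^sup>+i. \<integral>\<^sup>+x. norm (?F i x) powr p \<partial>M \<partial>?N) \<le> ennreal (?W * (LINT x|M. norm (f x) powr p))" .
  have K0: "0 \<le> ?W * (LINT x|M. norm (f x) powr p)" using W by (simp add: integral_nonneg_AE)
  have meas: "(\<lambda>(i, x). ?F i x) \<in> borel_measurable (?N \<Otimes>\<^sub>M M)" by measurable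
  note avg = Lp_integral_average[OF finite_measure_density_norm(1)[OF w] sigma_finite_measure_axioms meas p K0 K]
  have F: "(LINT i|?N. ?F i x) = (LINT i|N. w i * E (\<kappa> i) f x)" if "x \<in> space M" for x
    using that by (subst integral_density) (auto simp: eq)
  have Fn: "(LINT i|?N. norm (?F i x)) = (LINT i|N. norm (w i * E (\<kappa> i) f x))" if "x \<in> space M" for x
    using that by (subst integral_density) (auto simp: eqn)
  show "AE x in M. integrable N (\<lambda>i. w i * E (\<kappa> i) f x)"
    using avg(1) AE_space by eventually_elim (subst (asm) integrable_density, auto simp: eq)
  show "(\<lambda>x. complex_of_real (LINT i|N. norm (w i * E (\<kappa> i) f x))) \<in> Lp_space M p"
    using avg(2) by (simp add: Fn)
  show "(\<lambda>x. LINT i|N. w i * E (\<kappa> i) f x) \<in> Lp_space M p"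
    using avg(3) by (simp add: F)
  have "(LINT x|M. norm (LINT i|N. w i * E (\<kappa> i) f x) powr p)
      \<le> ?W powr (p - 1) * (?W * (LINT x|M. norm (f x) powr p))"
    using avg(4) by (simp add: F finite_measure_density_norm(2)[OF w])
  also have "\<dots> = (?W * Lp_norm M p f) powr p"
    using p W powr_add[of ?W "p - 1" 1] by (simp add: powr_mult Lp_norm_nonneg Lp_norm_powr)
  finally show "Lp_norm M p (\<lambda>x. LINT i|N. w i * E (\<kappa> i) f x) \<le> ?W * Lp_norm M p f"
    using p W by (intro Lp_norm_le) (auto intro!: mult_nonneg_nonneg simp: Lp_norm_nonneg)
qed

end

context ball_averages
begin

lemma T_integrable:
  assumes w: "weight w" and f: "f \<in> Lp_space M p" "1 \<le> p"
  shows "AE x in M. integrable lborel (\<lambda>v. w v * E v f x)"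
  using average_E(1)[OF lborel.sigma_finite_measure_axioms weightD(1)[OF w] _ f] by simp

lemma T_Lp:
  assumes w: "weight w" and f: "f \<in> Lp_space M p" "1 \<le> p"
  shows "T w f \<in> Lp_space M p" "Lp_norm M p (T w f) \<le> (LINT v|lborel. norm (w v)) * Lp_norm M p f"
  using average_E(3,4)[OF lborel.sigma_finite_measure_axioms weightD(1)[OF w] _ f, of "\<lambda>v. v"]
  by (simp_all add: T_def[abs_def])

lemma T_cong:
  assumes "AE y in M. f y = g y" "f \<in> borel_measurable M" "g \<in> borel_measurable M"
  shows "T w f = T w g"
  unfolding T_def[abs_def] E_cong[OF assms] ..

lemma T_scale: "T w (\<lambda>y. c * f y) x = c * T w f x"
  unfolding T_def by (simp add: E_scale mult.left_commute)

lemma T_weight_scale: "T (\<lambda>v. c * w v) f x = c * T w f x"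
  unfolding T_def by (simp add: mult.assoc)

lemma T_add:
  assumes w: "weight w" and f: "f \<in> Lp_space M p" and g: "g \<in> Lp_space M p" and p: "1 \<le> p"
  shows "AE x in M. T w (\<lambda>y. f y + g y) x = T w f x + T w g x"
  using T_integrable[OF w f p] T_integrable[OF w g p]
  by eventually_elim (simp add: T_def E_add[OF f g p] distrib_left)

lemma T_weight_add:
  assumes w: "weight w" "weight w'" and f: "f \<in> Lp_space M p" "1 \<le> p"
  shows "AE x in M. T (\<lambda>v. w v + w' v) f x = T w f x + T w' f x"
  using T_integrable[OF w(1) f] T_integrable[OF w(2) f]
  by eventually_elim (simp add: T_def distrib_right)

lemma T_bounded_linear:
  assumes "weight w" "1 \<le> p"
  shows "Lp_bounded_linear M p (T w)"
  unfolding Lp_bounded_linear_def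
  using T_Lp[OF assms(1) _ assms(2)] T_add[OF assms(1) _ _ assms(2)] by (auto simp: T_scale)

text \<open>This holds at every point: \<open>E v\<close> integrates over a ball, so the null set
  where the integral in \<open>T w f\<close> may diverge does not matter. An everywhere identity is
  what can be inserted under the next integral over \<open>v\<close>.\<close>

lemma E_T:
  assumes w: "weight w" and f: "f \<in> Lp_space M p" "1 \<le> p" and v: "0 < v"
  shows "E v (T w f) x = (LINT v'|lborel. w v' * E (min v v') f x)"
proof -
  interpret P: pair_sigma_finite M lborel ..
  note [measurable] = weightD(3)[OF w] Lp_spaceD(1)[OF f(1)]
  let ?h = "\<lambda>y v'. k v x y *\<^sub>R (w v' * E v' f y)"
  have int: "integrable (M \<Otimes>\<^sub>M lborel) (\<lambda>(y, v'). ?h y v')"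
  proof (rule P.Fubini_integrable)
    have "integrable M (\<lambda>y. k v x y *\<^sub>R complex_of_real (LINT v'|lborel. norm (w v' * E v' f y)))"
      using average_E(2)[OF lborel.sigma_finite_measure_axioms weightD(1)[OF w] _ f, of "\<lambda>v. v"]
      by (intro integrable_k[OF _ f(2)]) simp
    then have "integrable M (\<lambda>y. norm (k v x y *\<^sub>R complex_of_real (LINT v'|lborel. norm (w v' * E v' f y))))"
      by (rule integrable_norm)
    moreover have "norm (k v x y *\<^sub>R complex_of_real (LINT v'|lborel. norm (w v' * E v' f y)))
        = (LINT v'|lborel. norm (case (y, v') of (y, v') \<Rightarrow> ?h y v'))" for y
    proof -
      have "(LINT v'|lborel. norm (case (y, v') of (y, v') \<Rightarrow> ?h y v'))
          = (LINT v'|lborel. k v x y * norm (w v' * E v' f y))"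
        by simp
      also have "\<dots> = k v x y * (LINT v'|lborel. norm (w v' * E v' f y))"
        by (rule integral_mult_right_zero)
      finally show ?thesis by (simp add: integral_nonneg_AE)
    qed
    ultimately show "integrable M (\<lambda>y. LINT v'|lborel. norm (case (y, v') of (y, v') \<Rightarrow> ?h y v'))"
      by simp
    show "AE y in M. integrable lborel (\<lambda>v'. case (y, v') of (y, v') \<Rightarrow> ?h y v')"
      using T_integrable[OF w f] by eventually_elim (simp del: mult_scaleR_right)
  qed measurable
  have "E v (T w f) x = (LINT y|M. LINT v'|lborel. ?h y v')"
    unfolding E_kernel[of v "T w f"] T_def by simp
  also have "\<dots> = (LINT v'|lborel. LINT y|M. ?h y v')"
    by (rule P.Fubini_integral[symmetric, OF int])
  also have "\<dots> = (LINT v'|lborel. w v' * E v (E v' f) x)"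
    unfolding E_kernel[of v "E _ f"] 
    by (subst integral_mult_right_zero[symmetric]) (simp add: scaleR_conv_of_real mult_ac)
  also have "\<dots> = (LINT v'|lborel. w v' * E (min v v') f x)"
  proof (rule Bochner_Integration.integral_cong[OF refl])
    fix v'
    show "w v' * E v (E v' f) x = w v' * E (min v v') f x"
      using weightD(2)[OF w, of v'] E_E[OF f v, of v'] by (cases "0 < v'") auto
  qed
  finally show ?thesis .
qed

text \<open>By \<open>E_T\<close> the composition is a double integral of
  \<open>E (min v v') f x\<close>. It converges absolutely for almost every \<open>x\<close> by
  \<open>average_E\<close> over the plane, and \<open>integral_min_wprod\<close> collapses
  it.\<close>

lemma T_T:
  assumes w: "weight w" "weight w'" and f: "f \<in> Lp_space M p" "1 \<le> p"
  shows "AE x in M. T w (T w' f) x = T (wprod w w') f x"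
proof -
  note [measurable] = weightD(3)[OF w(1)] weightD(3)[OF w(2)] Lp_spaceD(1)[OF f(1)]
  have ww: "integrable (lborel \<Otimes>\<^sub>M lborel) (\<lambda>z. w (fst z) * w' (snd z))"
  proof -
    have "(\<lambda>z. w (fst z) * w' (snd z)) = (\<lambda>(v, v'). w v * w' v' * 1)" by (auto simp: case_prod_beta)
    then show ?thesis using integrable_weight_product[OF w, of "\<lambda>_. 1" 1] by (simp only:) simp
  qed
  have "AE x in M. integrable (lborel \<Otimes>\<^sub>M lborel) (\<lambda>z. w (fst z) * w' (snd z) * E (min (fst z) (snd z)) f x)"
    by (rule average_E(1)[OF lborel_pair.sigma_finite_measure_axioms ww _ f]) measurable
  then show ?thesis
  proof eventually_elim
    case (elim x)
    have "T w (T w' f) x = (LINT v|lborel. w v * (LINT v'|lborel. w' v' * E (min v v') f x))"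
      unfolding T_def[of w]
    proof (rule Bochner_Integration.integral_cong[OF refl])
      fix v
      show "w v * E v (T w' f) x = w v * (LINT v'|lborel. w' v' * E (min v v') f x)"
        using weightD(2)[OF w(1), of v] E_T[OF w(2) f, of v x] by (cases "0 < v") auto
    qed
    also have "\<dots> = (LINT v|lborel. LINT v'|lborel. w v * w' v' * E (min v v') f x)"
      by (simp add: mult.assoc)
    also have "\<dots> = T (wprod w w') f x"
      unfolding T_def using elim
      by (intro integral_min_wprod(1)[OF w]) (measurable, simp only: case_prod_beta')
    finally show ?case .
  qed
qed

lemma T_commute:
  assumes "weight w" "weight w'" and f: "f \<in> Lp_space M p" "1 \<le> p"
  shows "AE x in M. T w (T w' f) x = T w' (T w f) x"
  using T_T[OF assms] T_T[OF assms(2,1) f] by eventually_elim (simp add: wprod_commute)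

text \<open>Where \<open>E\<close> is constant it factors out of the integral, so only the total
  weight of the interval counts. This freedom is what removes the pole of the resolvent
  symbol.\<close>

lemma T_eq_on_gap:
  assumes w: "weight w" "weight w'" and f: "f \<in> Lp_space M p" "1 \<le> p"
    and off: "\<And>v. v \<notin> {a..b} \<Longrightarrow> w v = w' v"
    and gap: "(LINT v:{a..b}|lborel. w v) = (LINT v:{a..b}|lborel. w' v)"
    and const: "\<And>v. v \<in> {a..b} \<Longrightarrow> E v f = E a f"
  shows "AE x in M. T w f x = T w' f x"
  using T_integrable[OF w(1) f] T_integrable[OF w(2) f]
proof eventually_elim
  case (elim x)
  note wi = weightD(1)[OF w(1)] weightD(1)[OF w(2)]
  have si: "set_integrable lborel {a..b} w" "set_integrable lborel {a..b} w'"
    unfolding set_integrable_def using wi by (auto intro!: integrable_mult_indicator)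
  have "T w f x - T w' f x = (LINT v|lborel. w v * E v f x - w' v * E v f x)"
    unfolding T_def using elim by simp
  also have "\<dots> = (LINT v|lborel. (indicator {a..b} v *\<^sub>R (w v - w' v)) * E a f x)"
  proof (rule Bochner_Integration.integral_cong[OF refl])
    fix v
    show "w v * E v f x - w' v * E v f x = (indicator {a..b} v *\<^sub>R (w v - w' v)) * E a f x"
    proof (cases "v \<in> {a..b}")
      case True
      then show ?thesis unfolding const[OF True] by (simp add: algebra_simps)
    next
      case False
      then show ?thesis using off[OF False] by simp
    qed
  qed
  also have "\<dots> = (LINT v:{a..b}|lborel. w v - w' v) * E a f x"
    unfolding set_lebesgue_integral_def by (rule integral_mult_left_zero)
  also have "(LINT v:{a..b}|lborel. w v - w' v) = 0"
    using gap si by (simp add: set_integral_diff)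
  finally show ?case by simp
qed

text \<open>For a probability density, \<open>T f - f\<close> is the average of
  \<open>E v f - f\<close>, and Jensen bounds the \<open>p\<close>-th power of its norm by the
  average of \<open>D v\<close>. Beyond a large \<open>V\<close> the values \<open>D v\<close> are
  small; the mass below \<open>V\<close> disappears as \<open>t\<close> tends to 0.\<close>

lemma T_approximate_identity:
  fixes a :: "real \<Rightarrow> real \<Rightarrow> real"
  assumes a: "\<And>t. 0 < t \<Longrightarrow> weight (\<lambda>v. complex_of_real (a t v))" "\<And>t v. 0 < t \<Longrightarrow> 0 \<le> a t v"
      "\<And>t. 0 < t \<Longrightarrow> tail (\<lambda>v. complex_of_real (a t v)) 0 = 1"
    and conc: "\<And>V. 0 < V \<Longrightarrow> ((\<lambda>t. tail (\<lambda>v. complex_of_real (a t v)) V) \<longlongrightarrow> 1) (at_right 0)"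
    and f: "f \<in> Lp_space M p" and p: "1 \<le> p"
  shows "((\<lambda>t. Lp_norm M p (\<lambda>x. T (\<lambda>v. complex_of_real (a t v)) f x - f x)) \<longlongrightarrow> 0) (at_right 0)"
proof -
  note [measurable] = Lp_spaceD(1)[OF f]
  define D where "D v = Lp_norm M p (\<lambda>x. E v f x - f x) powr p" for v
  define C where "C = (2 * Lp_norm M p f) powr p"
  have D_nonneg: "0 \<le> D v" for v by (simp add: D_def)
  have D_le: "D v \<le> C" for v
  proof -
    have "Lp_norm M p (\<lambda>x. E v f x - f x) \<le> Lp_norm M p (E v f) + Lp_norm M p f"
      using Lp_norm_triangle[OF E_Lp(1)[OF f p, of v] Lp_space_scale[OF f, of "-1"] p]
        Lp_norm_scale[of p M "-1" f] p by simp
    then show ?thesis unfolding D_def C_def using E_Lp(2)[OF f p, of v] p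
      by (intro powr_mono2) (auto simp: Lp_norm_nonneg)
  qed
  have D_lim: "(D \<longlongrightarrow> 0) at_top"
  proof -
    have "((\<lambda>v. Lp_norm M p (\<lambda>x. E v f x - f x) powr p) \<longlongrightarrow> 0 powr p) at_top"
      using E_converges_Lp[OF f p] p unfolding E_converges_def
      by (intro tendsto_powr') (auto intro!: always_eventually simp: Lp_norm_nonneg)
    then show ?thesis unfolding D_def by simp
  qed
  have nnD: "(\<integral>\<^sup>+x. norm (E v f x - f x) powr p \<partial>M) = ennreal (D v)" for v
    using Lp_spaceD(2)[OF E_diff_Lp[OF f p, of v]] p
    by (simp add: nn_integral_eq_integral D_def Lp_norm_powr)
  have main: "Lp_norm M p (\<lambda>x. T (\<lambda>v. complex_of_real (a t v)) f x - f x) powr p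
      \<le> e + C * (1 - Re (tail (\<lambda>v. complex_of_real (a t v)) V))"
    if t: "0 < t" and V: "0 < V" and e: "0 \<le> e" and De: "\<And>v. V < v \<Longrightarrow> D v \<le> e" for t V e
  proof -
    let ?w = "\<lambda>v. complex_of_real (a t v)"
    note w = a(1)[OF t]
    note [measurable] = weightD(3)[OF w]
    have ai: "integrable lborel (a t)"
      using integrable_Re[OF weightD(1)[OF w]] by simp
    have [measurable]: "a t \<in> borel_measurable borel"
      using borel_measurable_integrable[OF ai] by simp
    have eq0: "indicator {0<..} v * a t v = a t v" for v
      using weightD(2)[OF w, of v] by (auto simp: indicator_def)
    have total: "(LINT v|lborel. a t v) = 1"
    proof -
      have "complex_of_real (LINT v:{0<..}|lborel. a t v) = 1" using a(3)[OF t] by (simp only: tail_of_real)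
      then show ?thesis by (simp add: set_lebesgue_integral_def eq0)
    qed
    let ?N = "density lborel (\<lambda>v. norm (?w v))"
    have na: "norm (?w v) = a t v" for v using a(2)[OF t] by simp
    have fin: "finite_measure ?N" and mN: "measure ?N (space ?N) = 1"
      using finite_measure_density_norm[OF weightD(1)[OF w]] total by (simp_all only: na space_density)
    \<comment> \<open>Mass beyond \<open>V\<close> contributes at most \<open>e\<close>; the
      remaining mass is weighted with the uniform bound \<open>C\<close> of
      \<open>D\<close>.\<close>
    let ?K = "e + C * (1 - (LINT v:{V<..}|lborel. a t v))"
    have iV: "integrable lborel (\<lambda>v. indicator {V<..} v * a t v)"
      using integrable_mult_indicator[OF _ ai, of "{V<..}"] by simp
    have tV: "(LINT v:{V<..}|lborel. a t v) \<le> 1"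
      unfolding total[symmetric] set_lebesgue_integral_def using ai iV a(2)[OF t]
      by (intro integral_mono) (auto simp: indicator_def)
    have K0: "0 \<le> ?K" using e tV by (simp add: C_def)
    have int: "integrable lborel (\<lambda>v. e * a t v + C * (a t v - indicator {V<..} v * a t v))"
      using ai iV by auto
    have meas: "(\<lambda>(v, x). E v f x - f x) \<in> borel_measurable (?N \<Otimes>\<^sub>M M)" by measurable
    have "(\<integral>\<^sup>+v. \<integral>\<^sup>+x. norm (E v f x - f x) powr p \<partial>M \<partial>?N) = (\<integral>\<^sup>+v. a t v * ennreal (D v) \<partial>lborel)"
    proof (subst nn_integral_density)
      show "(\<lambda>v. \<integral>\<^sup>+x. norm (E v f x - f x) powr p \<partial>M) \<in> borel_measurable lborel" by measurable
    qed (simp_all add: nnD abs_of_nonneg[OF a(2)[OF t]])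
    also have "\<dots> \<le> (\<integral>\<^sup>+v. ennreal (e * a t v + C * (a t v - indicator {V<..} v * a t v)) \<partial>lborel)"
    proof (rule nn_integral_mono)
      fix v
      have "a t v * D v \<le> e * a t v + C * (a t v - indicator {V<..} v * a t v)"
      proof (cases "V < v")
        case True
        then show ?thesis using De[OF True] a(2)[OF t, of v] by (simp add: mult.commute mult_right_mono)
      next
        case False
        have "a t v * D v \<le> a t v * C" using D_le a(2)[OF t] by (intro mult_left_mono)
        moreover have "0 \<le> e * a t v" using e a(2)[OF t] by simp
        ultimately show ?thesis using False by (simp add: mult.commute)
      qed
      then show "ennreal (a t v) * ennreal (D v) \<le> ennreal (e * a t v + C * (a t v - indicator {V<..} v * a t v))"
        using a(2)[OF t] D_nonneg by (simp add: ennreal_leI flip: ennreal_mult)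
    qed
    also have "\<dots> = ennreal (LINT v|lborel. e * a t v + C * (a t v - indicator {V<..} v * a t v))"
    proof (rule nn_integral_eq_integral[OF int], intro AE_I2)
      fix v show "0 \<le> e * a t v + C * (a t v - indicator {V<..} v * a t v)"
        using e a(2)[OF t, of v] by (auto simp: C_def indicator_def)
    qed
    also have "(LINT v|lborel. e * a t v + C * (a t v - indicator {V<..} v * a t v)) = ?K"
      using ai iV total by (simp add: set_lebesgue_integral_def)
    finally have K: "(\<integral>\<^sup>+v. \<integral>\<^sup>+x. norm (E v f x - f x) powr p \<partial>M \<partial>?N) \<le> ennreal ?K" .
    note avg = Lp_integral_average[OF fin sigma_finite_measure_axioms meas p K0 K]
    have "AE x in M. (LINT v|?N. E v f x - f x) = T ?w f x - f x"
      using T_integrable[OF w f p]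
    proof eventually_elim
      case (elim x)
      have "(LINT v|?N. E v f x - f x) = (LINT v|lborel. ?w v * E v f x - ?w v * f x)"
        by (subst integral_density) (auto simp: na scaleR_conv_of_real algebra_simps a(2)[OF t])
      also have "\<dots> = T ?w f x - (LINT v|lborel. ?w v) * f x"
        using elim weightD(1)[OF w] by (simp add: T_def)
      finally show ?case by (simp add: total)
    qed
    then have "Lp_norm M p (\<lambda>x. LINT v|?N. E v f x - f x) = Lp_norm M p (\<lambda>x. T ?w f x - f x)"
      using Lp_spaceD(1)[OF avg(3)] Lp_spaceD(1)[OF T_Lp(1)[OF w f p]]
      by (intro Lp_norm_cong) auto
    moreover have "Lp_norm M p (\<lambda>x. LINT v|?N. E v f x - f x) powr p \<le> ?K"
      using avg(4) p unfolding mN by (subst Lp_norm_powr) auto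
    ultimately show ?thesis by (simp only: tail_of_real Re_complex_of_real)
  qed
  show ?thesis
  proof (rule tendstoI)
    fix e :: real assume e: "0 < e"
    define d where "d = e powr p / 2"
    have d: "0 < d" using e by (simp add: d_def)
    have "\<forall>\<^sub>F v in at_top. D v < d" using D_lim d by (intro order_tendstoD(2)) auto
    then obtain V0 where V0: "\<And>v. V0 \<le> v \<Longrightarrow> D v < d" by (auto simp: eventually_at_top_linorder)
    define V where "V = max V0 1"
    have "((\<lambda>t. C * (1 - Re (tail (\<lambda>v. complex_of_real (a t v)) V))) \<longlongrightarrow> C * (1 - Re 1)) (at_right 0)"
      by (intro tendsto_intros conc) (auto simp: V_def)
    then have "\<forall>\<^sub>F t in at_right 0. C * (1 - Re (tail (\<lambda>v. complex_of_real (a t v)) V)) < d"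
      using d by (intro order_tendstoD(2)) auto
    moreover have "\<forall>\<^sub>F t::real in at_right 0. 0 < t" by (rule eventually_at_right_less)
    ultimately show "\<forall>\<^sub>F t in at_right 0. dist (Lp_norm M p (\<lambda>x. T (\<lambda>v. complex_of_real (a t v)) f x - f x)) 0 < e"
    proof eventually_elim
      case (elim t)
      have "Lp_norm M p (\<lambda>x. T (\<lambda>v. complex_of_real (a t v)) f x - f x) powr p
          \<le> d + C * (1 - Re (tail (\<lambda>v. complex_of_real (a t v)) V))"
        using elim(2) d V0 by (intro main) (auto simp: V_def intro: less_imp_le)
      also have "\<dots> < e powr p" using elim(1) by (simp add: d_def)
      finally have "Lp_norm M p (\<lambda>x. T (\<lambda>v. complex_of_real (a t v)) f x - f x) < e"
        using p e powr_mono2[of p e "Lp_norm M p (\<lambda>x. T (\<lambda>v. complex_of_real (a t v)) f x - f x)"]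
        by linarith
      then show ?case by (simp add: Lp_norm_nonneg)
    qed
  qed
qed

end

section \<open>The semigroup and its generator\<close>

text \<open>For a nonnegative density the fundamental theorem on a half-line yields integrability
  and the value of the integral together; the symbol is the antiderivative that vanishes at
  infinity.\<close>

lemma weight_of_antiderivative:
  fixes a A :: "real \<Rightarrow> real"
  assumes [measurable]: "a \<in> borel_measurable borel"
    and deriv: "\<And>v. 0 \<le> v \<Longrightarrow> (A has_field_derivative - a v) (at v)"
    and nonneg: "\<And>v. 0 \<le> v \<Longrightarrow> 0 \<le> a v" and lim: "(A \<longlongrightarrow> 0) at_top"
  shows "weight (\<lambda>v. complex_of_real (if 0 < v then a v else 0))"
    and "0 \<le> u \<Longrightarrow> tail (\<lambda>v. complex_of_real (if 0 < v then a v else 0)) u = complex_of_real (A u)"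
proof -
  let ?a = "\<lambda>v. if 0 < v then a v else 0"
  have nn: "(\<integral>\<^sup>+v. ennreal (a v) * indicator {u..} v \<partial>lborel) = ennreal (A u)" if "0 \<le> u" for u
  proof -
    have "(\<integral>\<^sup>+v. ennreal (a v) * indicator {u..} v \<partial>lborel) = ennreal (0 - (- A u))"
    proof (rule nn_integral_FTC_atLeast)
      show "((\<lambda>v. - A v) \<longlongrightarrow> 0) at_top" using tendsto_minus[OF lim] by simp
      show "((\<lambda>v. - A v) has_real_derivative a v) (at v)" if "u \<le> v" for v
        using DERIV_minus[OF deriv[of v]] that \<open>0 \<le> u\<close> by simp
    qed (use nonneg that in auto)
    then show ?thesis by simp
  qed
  have AE: "AE v in lborel. ennreal (indicator {u<..} v *\<^sub>R ?a v) = ennreal (a v) * indicator {u..} v" if "0 \<le> u" for u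
    using AE_lborel_singleton[of u] by eventually_elim (use that in \<open>auto simp: indicator_def\<close>)
  have nn': "(\<integral>\<^sup>+v. ennreal (indicator {u<..} v *\<^sub>R ?a v) \<partial>lborel) = ennreal (A u)" if "0 \<le> u" for u
    unfolding nn[OF that, symmetric] by (rule nn_integral_cong_AE[OF AE[OF that]])
  have A_nonneg: "0 \<le> A u" if "0 \<le> u" for u
  proof (rule tendsto_le[OF _ tendsto_const lim])
    show "\<forall>\<^sub>F v in at_top. A v \<le> A u"
    proof (intro eventually_at_top_linorderI[of u])
      fix v assume "u \<le> v"
      then show "A v \<le> A u"
      proof (rule DERIV_nonpos_imp_nonincreasing)
        fix x assume "u \<le> x"
        then show "\<exists>y. (A has_field_derivative y) (at x) \<and> y \<le> 0"
          using deriv[of x] nonneg[of x] that by (intro exI[of _ "- a x"]) simp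
      qed
    qed
  qed simp
  have meas: "(\<lambda>v. indicator {u<..} v *\<^sub>R ?a v) \<in> borel_measurable lborel" for u by measurable
  have pos: "0 \<le> indicator {u<..} v *\<^sub>R ?a v" for u v using nonneg by (auto simp: indicator_def)
  have int: "integrable lborel (\<lambda>v. indicator {u<..} v *\<^sub>R ?a v)" if "0 \<le> u" for u
    using meas pos nn'[OF that] by (intro integrableI_nonneg) auto
  have "(\<lambda>v. indicator {0<..} v *\<^sub>R ?a v) = ?a" by (auto simp: indicator_def)
  then have "integrable lborel ?a" using int[of 0] by simp
  then show "weight (\<lambda>v. complex_of_real (?a v))" unfolding weight_def by (auto intro!: integrable_of_real)
  assume u: "0 \<le> u"
  have "ennreal (LINT v:{u<..}|lborel. ?a v) = ennreal (A u)"
    unfolding set_lebesgue_integral_def nn'[OF u, symmetric]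
    using int[OF u] pos by (intro nn_integral_eq_integral[symmetric]) auto
  moreover have "0 \<le> (LINT v:{u<..}|lborel. ?a v)"
    unfolding set_lebesgue_integral_def using pos by (intro integral_nonneg_AE AE_I2)
  ultimately show "tail (\<lambda>v. complex_of_real (?a v)) u = complex_of_real (A u)"
    using A_nonneg[OF u] by (simp only: tail_of_real) (simp add: ennreal_inj)
qed

definition semigroup_weight :: "real \<Rightarrow> real \<Rightarrow> complex" where
  "semigroup_weight t v = complex_of_real (if 0 < v then t * exp (- t * v) else 0)"

text \<open>The symbol \<open>1 / (1 + u)\<close> of \<open>(1 + L)\<^sup>-\<^sup>1\<close>, where \<open>L\<close> is the generator.\<close>

definition resolvent_weight :: "real \<Rightarrow> complex" where
  "resolvent_weight v = complex_of_real (if 0 < v then 1 / (1 + v)\<^sup>2 else 0)"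

lemma semigroup_weight:
  assumes "0 < t"
  shows "weight (semigroup_weight t)"
    and "0 \<le> u \<Longrightarrow> tail (semigroup_weight t) u = complex_of_real (exp (- t * u))"
proof -
  have "((\<lambda>v. exp (- t * v)) \<longlongrightarrow> 0) at_top"
    using assms by real_asymp
  moreover have deriv: "((\<lambda>v. exp (- t * v)) has_field_derivative - (t * exp (- t * v))) (at v)" for v
    by (auto intro!: derivative_eq_intros)
  ultimately show "weight (semigroup_weight t)"
    and "0 \<le> u \<Longrightarrow> tail (semigroup_weight t) u = complex_of_real (exp (- t * u))"
    using assms weight_of_antiderivative[of "\<lambda>v. t * exp (- t * v)" "\<lambda>v. exp (- t * v)", OF _ deriv]
    unfolding semigroup_weight_def[abs_def] by simp_all
qed

lemma resolvent_weight:
  shows "weight resolvent_weight"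
    and "0 \<le> u \<Longrightarrow> tail resolvent_weight u = complex_of_real (1 / (1 + u))"
proof -
  have "((\<lambda>v::real. 1 / (1 + v)) \<longlongrightarrow> 0) at_top" by real_asymp
  moreover have deriv: "((\<lambda>v::real. 1 / (1 + v)) has_field_derivative - (1 / (1 + v)\<^sup>2)) (at v)" if "0 \<le> v" for v
    using that by (auto intro!: derivative_eq_intros simp: power2_eq_square)
  ultimately show "weight resolvent_weight"
    and "0 \<le> u \<Longrightarrow> tail resolvent_weight u = complex_of_real (1 / (1 + u))"
    using weight_of_antiderivative[of "\<lambda>v. 1 / (1 + v)\<^sup>2" "\<lambda>v. 1 / (1 + v)", OF _ deriv]
    unfolding resolvent_weight_def[abs_def] by simp_all
qed

lemma norm_semigroup_weight:
  assumes "0 < t"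
  shows "(LINT v|lborel. norm (semigroup_weight t v)) = 1"
proof -
  have "complex_of_real (LINT v|lborel. norm (semigroup_weight t v)) = (LINT v|lborel. indicator {0<..} v *\<^sub>R semigroup_weight t v)"
    unfolding integral_complex_of_real[symmetric]
    by (intro Bochner_Integration.integral_cong) (use assms in \<open>auto simp: semigroup_weight_def norm_mult\<close>)
  also have "\<dots> = 1"
    using semigroup_weight(2)[OF assms, of 0] by (simp add: tail_def set_lebesgue_integral_def)
  finally show ?thesis by simp
qed

lemma wprod_semigroup_weight:
  assumes "0 < s" "0 < t"
  shows "wprod (semigroup_weight s) (semigroup_weight t) = semigroup_weight (s + t)"
proof
  fix v
  show "wprod (semigroup_weight s) (semigroup_weight t) v = semigroup_weight (s + t) v"
  proof (cases "0 < v")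
    case True
    have "exp (- (s + t) * v) = exp (- s * v) * exp (- t * v)" by (simp add: exp_add[symmetric] algebra_simps)
    then show ?thesis
      using True semigroup_weight(2)[OF assms(1), of v] semigroup_weight(2)[OF assms(2), of v]
      by (simp add: wprod_def) (simp add: semigroup_weight_def algebra_simps)
  qed (simp add: wprod_def semigroup_weight_def)
qed

context ball_averages
begin

text \<open>At \<open>t = 0\<close> the weight vanishes and would give the zero operator: the
  constant symbol 1 does not tend to 0 at infinity, so it is no tail.\<close>

definition P :: "real \<Rightarrow> 'a oper" where
  "P t f = (if t = 0 then f else T (semigroup_weight t) f)"

lemma P_pos: "0 < t \<Longrightarrow> P t f = T (semigroup_weight t) f"
  by (simp add: P_def)

lemma P_Lp:
  assumes "0 \<le> t" "f \<in> Lp_space M p" "1 \<le> p"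
  shows "P t f \<in> Lp_space M p" "Lp_norm M p (P t f) \<le> Lp_norm M p f"
  using assms T_Lp[OF semigroup_weight(1)[of t] assms(2,3)] norm_semigroup_weight[of t]
  by (cases "t = 0"; simp add: P_def)+

lemma Lp_contraction_semigroup_P:
  assumes p: "1 \<le> p"
  shows "Lp_contraction_semigroup M p P"
  unfolding Lp_contraction_semigroup_def
proof (intro conjI ballI allI impI)
  fix t :: real assume t: "0 \<le> t"
  show "Lp_bounded_linear M p (P t)"
  proof (cases "t = 0")
    case True
    then have "P t = (\<lambda>f. f)" by (simp add: P_def fun_eq_iff)
    then show ?thesis by (auto simp: Lp_bounded_linear_def intro!: exI[of _ 1])
  next
    case False
    then have "P t = T (semigroup_weight t)" by (simp add: P_def fun_eq_iff)
    then show ?thesis using T_bounded_linear[OF semigroup_weight(1) p] t False by simp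
  qed
next
  fix t :: real and f assume "0 \<le> t" "f \<in> Lp_space M p"
  then show "Lp_norm M p (P t f) \<le> Lp_norm M p f" using P_Lp(2)[OF _ _ p] by blast
next
  fix f show "AE x in M. P 0 f x = f x" by (simp add: P_def)
next
  fix s t :: real and f assume s: "0 \<le> s" and t: "0 \<le> t" and f: "f \<in> Lp_space M p"
  show "AE x in M. P (s + t) f x = P s (P t f) x"
  proof (cases "s = 0 \<or> t = 0")
    case True
    then show ?thesis by (auto simp: P_def)
  next
    case False
    then show ?thesis
      using T_T[OF semigroup_weight(1) semigroup_weight(1) f p, of s t] s t
      by (auto simp: P_def wprod_semigroup_weight elim!: eventually_mono)
  qed
next
  fix f assume f: "f \<in> Lp_space M p"
  let ?a = "\<lambda>t v. if 0 < v then t * exp (- t * v) else 0"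
  have eq: "(\<lambda>v. complex_of_real (?a t v)) = semigroup_weight t" for t
    by (simp add: semigroup_weight_def fun_eq_iff)
  have "((\<lambda>t. Lp_norm M p (\<lambda>x. T (\<lambda>v. complex_of_real (?a t v)) f x - f x)) \<longlongrightarrow> 0) (at_right 0)"
  proof (rule T_approximate_identity[OF _ _ _ _ f p])
    fix V :: real assume V: "0 < V"
    have "((\<lambda>t. complex_of_real (exp (- t * V))) \<longlongrightarrow> complex_of_real (exp (- 0 * V))) (at_right 0)"
      by (intro tendsto_intros)
    then have "((\<lambda>t. complex_of_real (exp (- t * V))) \<longlongrightarrow> 1) (at_right 0)" by simp
    then show "((\<lambda>t. tail (\<lambda>v. complex_of_real (?a t v)) V) \<longlongrightarrow> 1) (at_right 0)"
      unfolding eq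
      by (rule Lim_transform_eventually, intro eventually_mono[OF eventually_at_right_less])
        (use V in \<open>simp add: semigroup_weight(2)\<close>)
  qed (auto simp: eq semigroup_weight)
  then show "((\<lambda>t. Lp_norm M p (\<lambda>x. P t f x - f x)) \<longlongrightarrow> 0) (at_right 0)"
    unfolding eq
    by (rule Lim_transform_eventually, intro eventually_mono[OF eventually_at_right_less]) (simp add: P_def)
qed

lemma Lp_generator_cong:
  assumes T': "\<And>t f. 0 < t \<Longrightarrow> f \<in> Lp_space M p \<Longrightarrow> S t f \<in> Lp_space M p \<and> (AE x in M. S t f x = P t f x)"
    and p: "1 \<le> p"
  shows "Lp_generator M p S = Lp_generator M p P"
proof -
  have "((\<lambda>t. Lp_norm M p (\<lambda>x. (f x - S t f x) / complex_of_real t - g x)) \<longlongrightarrow> 0) (at_right 0) \<longleftrightarrow>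
      ((\<lambda>t. Lp_norm M p (\<lambda>x. (f x - P t f x) / complex_of_real t - g x)) \<longlongrightarrow> 0) (at_right 0)"
    if f: "f \<in> Lp_space M p" and g: "g \<in> Lp_space M p" for f g
  proof (rule tendsto_cong, rule eventually_mono[OF eventually_at_right_less])
    fix t :: real assume t: "0 < t"
    note [measurable] = Lp_spaceD(1)[OF f] Lp_spaceD(1)[OF g] Lp_spaceD(1)[OF conjunct1[OF T'[OF t f]]]
      Lp_spaceD(1)[OF P_Lp(1)[OF less_imp_le[OF t] f p]]
    show "Lp_norm M p (\<lambda>x. (f x - S t f x) / complex_of_real t - g x)
        = Lp_norm M p (\<lambda>x. (f x - P t f x) / complex_of_real t - g x)"
      by (rule Lp_norm_cong) (use T'[OF t f] in \<open>auto elim: eventually_mono\<close>)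
  qed
  then show ?thesis unfolding Lp_generator_def by auto
qed

text \<open>The graph consists of functions, not of classes, while identities between the operators
  \<open>T w\<close> hold only almost everywhere; this lemma mediates.\<close>

lemma generator_AE:
  assumes fg: "(f, g) \<in> Lp_generator M p P" and f': "f' \<in> Lp_space M p" "AE x in M. f x = f' x"
    and g': "g' \<in> Lp_space M p" "AE x in M. g x = g' x" and p: "1 \<le> p"
  shows "(f', g') \<in> Lp_generator M p P"
proof -
  from fg have f: "f \<in> Lp_space M p" and g: "g \<in> Lp_space M p" by (auto simp: Lp_generator_def)
  note [measurable] = Lp_spaceD(1)[OF f] Lp_spaceD(1)[OF g] Lp_spaceD(1)[OF f'(1)] Lp_spaceD(1)[OF g'(1)]
  have "Lp_norm M p (\<lambda>x. (f x - P t f x) / complex_of_real t - g x)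
      = Lp_norm M p (\<lambda>x. (f' x - P t f' x) / complex_of_real t - g' x)" if t: "0 < t" for t
  proof -
    note [measurable] = Lp_spaceD(1)[OF P_Lp(1)[OF less_imp_le[OF t] f p]]
    have "P t f = P t f'" using t T_cong[OF f'(2)] by (simp add: P_def)
    moreover have "Lp_norm M p (\<lambda>x. (f x - P t f x) / complex_of_real t - g x)
        = Lp_norm M p (\<lambda>x. (f' x - P t f x) / complex_of_real t - g' x)"
    proof (rule Lp_norm_cong)
      show "AE x in M. (f x - P t f x) / complex_of_real t - g x = (f' x - P t f x) / complex_of_real t - g' x"
        using f'(2) g'(2) by eventually_elim simp
    qed measurable
    ultimately show ?thesis by simp
  qed
  then have "\<forall>\<^sub>F t in at_right 0. Lp_norm M p (\<lambda>x. (f x - P t f x) / complex_of_real t - g x)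
      = Lp_norm M p (\<lambda>x. (f' x - P t f' x) / complex_of_real t - g' x)"
    by (intro eventually_mono[OF eventually_at_right_less])
  then show ?thesis using fg f' g' unfolding Lp_generator_def
    by (auto elim!: Lim_transform_eventually)
qed

text \<open>A bounded operator that commutes with the semigroup maps difference quotients to
  difference quotients, hence commutes with the generator.\<close>

lemma generator_T:
  assumes fg: "(f, g) \<in> Lp_generator M p P" and w: "weight w" and p: "1 \<le> p"
  shows "(T w f, T w g) \<in> Lp_generator M p P"
proof -
  from fg have f: "f \<in> Lp_space M p" and g: "g \<in> Lp_space M p"
    and lim: "((\<lambda>t. Lp_norm M p (\<lambda>x. (f x - P t f x) / complex_of_real t - g x)) \<longlongrightarrow> 0) (at_right 0)"
    by (auto simp: Lp_generator_def)
  let ?W = "LINT v|lborel. norm (w v)"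
  have le: "Lp_norm M p (\<lambda>x. (T w f x - P t (T w f) x) / complex_of_real t - T w g x)
      \<le> ?W * Lp_norm M p (\<lambda>x. (f x - P t f x) / complex_of_real t - g x)" if t: "0 < t" for t
  proof -
    let ?d = "\<lambda>x. (1 / complex_of_real t) * (f x + (- 1) * P t f x) + (- 1) * g x"
    note Pf = P_Lp(1)[OF less_imp_le[OF t] f p]
    have dq: "(\<lambda>x. (f x - P t f x) / complex_of_real t - g x) = ?d" by (simp add: divide_simps)
    have Ld: "?d \<in> Lp_space M p"
      using f g Pf p by (intro Lp_space_add Lp_space_scale) auto
    have L1: "(\<lambda>x. f x + (- 1) * P t f x) \<in> Lp_space M p"
      using f Pf p by (intro Lp_space_add Lp_space_scale) auto
    have "AE x in M. T w ?d x = (T w f x - P t (T w f) x) / complex_of_real t - T w g x"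
      using T_add[OF w Lp_space_scale[OF L1, of "1 / complex_of_real t"] Lp_space_scale[OF g, of "-1"] p]
        T_add[OF w f Lp_space_scale[OF Pf, of "-1"] p] T_commute[OF w semigroup_weight(1)[OF t] f p]
      by eventually_elim (simp only: T_scale P_pos[OF t], simp add: diff_divide_distrib)
    then have "Lp_norm M p (\<lambda>x. (T w f x - P t (T w f) x) / complex_of_real t - T w g x) = Lp_norm M p (T w ?d)"
      using Lp_spaceD(1)[OF T_Lp(1)[OF w Ld p]] Lp_spaceD(1)[OF T_Lp(1)[OF w f p]]
        Lp_spaceD(1)[OF T_Lp(1)[OF w g p]]
        Lp_spaceD(1)[OF P_Lp(1)[OF less_imp_le[OF t] T_Lp(1)[OF w f p] p]]
      by (intro Lp_norm_cong) (auto elim: eventually_mono)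
    also have "\<dots> \<le> ?W * Lp_norm M p ?d" by (rule T_Lp(2)[OF w Ld p])
    finally show ?thesis unfolding dq .
  qed
  have "((\<lambda>t. ?W * Lp_norm M p (\<lambda>x. (f x - P t f x) / complex_of_real t - g x)) \<longlongrightarrow> 0) (at_right 0)"
    using tendsto_mult_right_zero[OF lim] .
  then have "((\<lambda>t. Lp_norm M p (\<lambda>x. (T w f x - P t (T w f) x) / complex_of_real t - T w g x)) \<longlongrightarrow> 0) (at_right 0)"
    by (rule Lim_null_comparison[rotated], intro eventually_mono[OF eventually_at_right_less])
      (use le in \<open>simp add: Lp_norm_nonneg\<close>)
  then show ?thesis using T_Lp(1)[OF w f p] T_Lp(1)[OF w g p] by (simp add: Lp_generator_def)
qed

lemma generator_unique:
  assumes "(f, g) \<in> Lp_generator M p P" "(f, g') \<in> Lp_generator M p P" "1 \<le> p"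
  shows "AE x in M. g x = g' x"
proof -
  \<comment> \<open>\<open>Lp_limit_unique\<close> requires membership in \<open>L^p\<close> for
    every real \<open>t\<close>; the absolute value ensures it and changes nothing for
    \<open>t > 0\<close>.\<close>
  let ?F = "\<lambda>t x. (f x - P \<bar>t\<bar> f x) / complex_of_real t"
  from assms have f: "f \<in> Lp_space M p" by (auto simp: Lp_generator_def)
  have "(\<lambda>x. (1 / complex_of_real t) * (f x + (- 1) * P \<bar>t\<bar> f x)) \<in> Lp_space M p" for t
    using f P_Lp(1)[OF _ f assms(3), of "\<bar>t\<bar>"] assms(3) by (intro Lp_space_add Lp_space_scale) auto
  then have F: "?F t \<in> Lp_space M p" for t by (simp add: divide_simps)
  have "((\<lambda>t. Lp_norm M p (\<lambda>x. ?F t x - h x)) \<longlongrightarrow> 0) (at_right 0)"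
    if "(f, h) \<in> Lp_generator M p P" for h
  proof (rule Lim_transform_eventually)
    show "((\<lambda>t. Lp_norm M p (\<lambda>x. (f x - P t f x) / complex_of_real t - h x)) \<longlongrightarrow> 0) (at_right 0)"
      using that by (simp add: Lp_generator_def)
  qed (intro eventually_mono[OF eventually_at_right_less], simp)
  then show ?thesis
    using assms F by (intro Lp_limit_unique[of ?F M p g g' "at_right 0"]) (auto simp: Lp_generator_def)
qed

text \<open>The weight of \<open>(J - P\<^sup>t J) / t + J\<close> for \<open>J = (1 + L)\<^sup>-\<^sup>1\<close>.  It is a probability density whose mass
  escapes to infinity as \<open>t \<rightarrow> 0\<close>, which gives \<open>L J = 1 - J\<close>.\<close>

definition resolvent_difference :: "real \<Rightarrow> real \<Rightarrow> real" where
  "resolvent_difference t v =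
     (if 0 < v then (1 / (1 + v)\<^sup>2) * ((1 - exp (- t * v)) / t + 1 - (1 + v) * exp (- t * v)) else 0)"

lemma resolvent_difference:
  assumes t: "0 < t"
  shows "complex_of_real (resolvent_difference t v) = (1 / complex_of_real t) *
      (resolvent_weight v + (- 1) * wprod (semigroup_weight t) resolvent_weight v) + resolvent_weight v"
    and "0 \<le> resolvent_difference t v"
proof -
  show "complex_of_real (resolvent_difference t v) = (1 / complex_of_real t) *
      (resolvent_weight v + (- 1) * wprod (semigroup_weight t) resolvent_weight v) + resolvent_weight v"
  proof (cases "0 < v")
    case True
    define e where "e = exp (- t * v)"
    have "wprod (semigroup_weight t) resolvent_weight v
        = complex_of_real (t * e * (1 / (1 + v)) + 1 / (1 + v)\<^sup>2 * e)"
      using True semigroup_weight(2)[OF t, of v] resolvent_weight(2)[of v]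
      by (simp add: wprod_def e_def) (simp add: semigroup_weight_def resolvent_weight_def)
    moreover have "resolvent_weight v = complex_of_real (1 / (1 + v)\<^sup>2)"
      using True by (simp add: resolvent_weight_def)
    moreover have "resolvent_difference t v
        = (1 / t) * (1 / (1 + v)\<^sup>2 + (- 1) * (t * e * (1 / (1 + v)) + 1 / (1 + v)\<^sup>2 * e)) + 1 / (1 + v)\<^sup>2"
    proof -
      define q where "q = 1 / (1 + v)\<^sup>2"
      have q: "1 / (1 + v) = q * (1 + v)" using True by (simp add: q_def power2_eq_square)
      have "resolvent_difference t v = q * ((1 - e) / t + 1 - (1 + v) * e)"
        using True by (simp add: resolvent_difference_def q_def e_def)
      also have "\<dots> = (1 / t) * (q + (- 1) * (t * e * (q * (1 + v)) + q * e)) + q"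
        using t by (simp add: field_simps)
      finally show ?thesis unfolding q q_def[symmetric] .
    qed
    ultimately show ?thesis by simp
  qed (simp add: resolvent_difference_def resolvent_weight_def wprod_def semigroup_weight_def)
  show "0 \<le> resolvent_difference t v"
  proof (cases "0 < v")
    case True
    define s where "s = t * v"
    have s: "0 < s" using True t by (simp add: s_def)
    \<comment> \<open>Positivity reduces to \<open>(1 + s) * exp (- s) \<le> 1\<close> with
      \<open>s = t * v\<close>: this gives \<open>v * exp (- s) \<le> (1 - exp (- s)) / t\<close>,
      and the remaining terms compare by \<open>exp (- s) \<le> 1\<close>.\<close>
    have "exp (- s) * (1 + s) \<le> exp (- s) * exp s"
      by (intro mult_left_mono exp_ge_add_one_self) simp
    then have "exp (- s) * (1 + s) \<le> 1" by (simp flip: exp_add)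
    then have "s * exp (- s) \<le> 1 - exp (- s)" by (simp add: algebra_simps)
    then have "v * exp (- s) \<le> (1 - exp (- s)) / t" using t by (simp add: s_def field_simps)
    moreover have "exp (- s) \<le> 1" using s by simp
    ultimately have "0 \<le> (1 - exp (- s)) / t + 1 - (1 + v) * exp (- s)" unfolding distrib_right by linarith
    then show ?thesis using True by (simp add: resolvent_difference_def s_def)
  qed (simp add: resolvent_difference_def)
qed

lemma generator_resolvent:
  assumes f: "f \<in> Lp_space M p" and p: "1 \<le> p"
  shows "(T resolvent_weight f, \<lambda>x. f x - T resolvent_weight f x) \<in> Lp_generator M p P"
proof -
  let ?a = "\<lambda>t v. complex_of_real (resolvent_difference t v)"
  let ?J = "T resolvent_weight f"
  let ?d = "\<lambda>t v. resolvent_weight v + (- 1) * wprod (semigroup_weight t) resolvent_weight v"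
  note J = T_Lp(1)[OF resolvent_weight(1) f p]
  have wd: "weight (?d t)" if "0 < t" for t
    using that by (intro weight_add weight_scale weight_wprod resolvent_weight semigroup_weight)
  have w: "weight (?a t)" if t: "0 < t" for t
    unfolding resolvent_difference(1)[OF t] by (intro weight_add weight_scale[OF wd[OF t]] resolvent_weight)
  \<comment> \<open>At \<open>u = 0\<close> the symbol is 1, the total mass; for fixed
    \<open>u\<close> it tends to \<open>(u + 1) / (1 + u) = 1\<close> as \<open>t\<close> tends to
    0. These are the hypotheses of \<open>T_approximate_identity\<close>.\<close>
  have tail_a: "tail (?a t) u = complex_of_real (((1 - exp (- t * u)) / t + 1) / (1 + u))"
    if t: "0 < t" and u: "0 \<le> u" for t u
  proof -
    note weights = weightD(1)[OF resolvent_weight(1)] weightD(1)[OF weight_scale[OF wd[OF t]]]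
      weightD(1)[OF weight_scale[OF weight_wprod[OF semigroup_weight(1)[OF t] resolvent_weight(1)]]]
    have "tail (?a t) u = (1 / complex_of_real t) * (tail resolvent_weight u
        + (- 1) * (tail (semigroup_weight t) u * tail resolvent_weight u)) + tail resolvent_weight u"
      unfolding resolvent_difference(1)[OF t]
      by (simp only: tail_add[OF weights(2,1)] tail_scale tail_add[OF weights(1,3)]
          tail_wprod[OF semigroup_weight(1)[OF t] resolvent_weight(1)])
    also have "\<dots> = complex_of_real ((1 / t) * (1 / (1 + u) + (- 1) * (exp (- t * u) * (1 / (1 + u)))) + 1 / (1 + u))"
      by (simp add: semigroup_weight(2)[OF t u] resolvent_weight(2)[OF u])
    also have "(1 / t) * (1 / (1 + u) + (- 1) * (exp (- t * u) * (1 / (1 + u)))) + 1 / (1 + u)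
        = ((1 - exp (- t * u)) / t + 1) / (1 + u)"
      by (simp add: add_divide_distrib diff_divide_distrib mult.commute)
    finally show ?thesis .
  qed
  have approx: "((\<lambda>t. Lp_norm M p (\<lambda>x. T (?a t) f x - f x)) \<longlongrightarrow> 0) (at_right 0)"
  proof (rule T_approximate_identity[OF w resolvent_difference(2) _ _ f p])
    show "tail (?a t) 0 = 1" if "0 < t" for t using tail_a[OF that, of 0] by simp
    fix V :: real assume V: "0 < V"
    have "((\<lambda>t. (1 - exp (- t * V)) / t) \<longlongrightarrow> V) (at_right 0)" using V by real_asymp
    then have "((\<lambda>t. ((1 - exp (- t * V)) / t + 1) / (1 + V)) \<longlongrightarrow> (V + 1) / (1 + V)) (at_right 0)"
      using V by (intro tendsto_intros) auto
    then have "((\<lambda>t. complex_of_real (((1 - exp (- t * V)) / t + 1) / (1 + V)))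
        \<longlongrightarrow> complex_of_real ((V + 1) / (1 + V))) (at_right 0)"
      by (rule tendsto_of_real)
    moreover have "(V + 1) / (1 + V) = 1" using V by simp
    ultimately have "((\<lambda>t. complex_of_real (((1 - exp (- t * V)) / t + 1) / (1 + V))) \<longlongrightarrow> 1) (at_right 0)"
      by (simp only: of_real_1)
    then show "((\<lambda>t. tail (?a t) V) \<longlongrightarrow> 1) (at_right 0)"
      by (rule Lim_transform_eventually, intro eventually_mono[OF eventually_at_right_less])
        (use V in \<open>simp add: tail_a\<close>)
  qed
  have "Lp_norm M p (\<lambda>x. T (?a t) f x - f x)
      = Lp_norm M p (\<lambda>x. (?J x - P t ?J x) / complex_of_real t - (f x - ?J x))" if t: "0 < t" for t
  proof (rule Lp_norm_cong)
    note sw = semigroup_weight(1)[OF t] and jw = resolvent_weight(1)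
    note meas = Lp_spaceD(1)[OF f] Lp_spaceD(1)[OF J] Lp_spaceD(1)[OF T_Lp(1)[OF w[OF t] f p]]
      Lp_spaceD(1)[OF P_Lp(1)[OF less_imp_le[OF t] J p]]
    show "(\<lambda>x. T (?a t) f x - f x) \<in> borel_measurable M"
      "(\<lambda>x. (?J x - P t ?J x) / complex_of_real t - (f x - ?J x)) \<in> borel_measurable M"
      by (intro borel_measurable_diff borel_measurable_divide borel_measurable_const meas)+
    show "AE x in M. T (?a t) f x - f x = (?J x - P t ?J x) / complex_of_real t - (f x - ?J x)"
      unfolding resolvent_difference(1)[OF t] P_pos[OF t]
      using T_weight_add[OF weight_scale[OF wd[OF t]] jw f p, of "1 / complex_of_real t"]
        T_weight_add[OF jw weight_scale[OF weight_wprod[OF sw jw]] f p, of "-1"] T_T[OF sw jw f p]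
      by eventually_elim (simp only: T_weight_scale, simp add: diff_divide_distrib)
  qed
  then have "((\<lambda>t. Lp_norm M p (\<lambda>x. (?J x - P t ?J x) / complex_of_real t - (f x - ?J x))) \<longlongrightarrow> 0) (at_right 0)"
    by (intro Lim_transform_eventually[OF approx] eventually_mono[OF eventually_at_right_less]) simp
  then show ?thesis
    using J Lp_space_diff[OF f J] p by (simp add: Lp_generator_def)
qed

text \<open>The hypothesis \<open>eq\<close> says \<open>R = J ((1 + z) R - 1)\<close> for \<open>R = T w\<close> and \<open>J = (1 + L)\<^sup>-\<^sup>1\<close>, so \<open>R\<close> maps into the
  domain of \<open>L\<close>.\<close>

lemma resolvent_setI:
  assumes w: "weight w" and p: "1 \<le> p"
    and eq: "\<And>f. f \<in> Lp_space M p \<Longrightarrow>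
      AE x in M. T w f x + T resolvent_weight f x = (1 + z) * T resolvent_weight (T w f) x"
  shows "z \<in> Lp_resolvent_set M p (Lp_generator M p P)"
proof -
  have right: "(T w h, \<lambda>x. z * T w h x - h x) \<in> Lp_generator M p P" if h: "h \<in> Lp_space M p" for h
  proof -
    note u = T_Lp(1)[OF w h p]
    note jw = resolvent_weight(1)
    \<comment> \<open>The preimage of \<open>R h\<close> under \<open>J\<close>: by hypothesis
      \<open>R h = J k\<close>, and \<open>L J k = k - J k\<close> is then
      \<open>z R h - h\<close>.\<close>
    define k where "k x = (1 + z) * T w h x + (- 1) * h x" for x
    have k: "k \<in> Lp_space M p"
      unfolding k_def[abs_def] using u h p by (intro Lp_space_add Lp_space_scale) auto
    have Jk: "AE x in M. T resolvent_weight k x = T w h x"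
      using T_add[OF jw Lp_space_scale[OF u, of "1 + z"] Lp_space_scale[OF h, of "-1"] p] eq[OF h]
      unfolding k_def[abs_def] by eventually_elim (simp only: T_scale, simp add: algebra_simps)
    show ?thesis
    proof (rule generator_AE[OF generator_resolvent[OF k p] u Jk _ _ p])
      show "AE x in M. k x - T resolvent_weight k x = z * T w h x - h x"
        using Jk by eventually_elim (simp add: k_def algebra_simps)
    qed (use Lp_space_diff[OF Lp_space_scale[OF u] h] p in auto)
  qed
  \<comment> \<open>As \<open>R\<close> commutes with \<open>L\<close>, the graph contains both
    \<open>(R f, R g)\<close> and \<open>(R f, z R f - f)\<close>; uniqueness of the second
    component gives \<open>R (z f - g) = f\<close>.\<close>
  have left: "AE x in M. T w (\<lambda>y. z * f y - g y) x = f x" if fg: "(f, g) \<in> Lp_generator M p P" for f g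
  proof -
    from fg have f: "f \<in> Lp_space M p" and g: "g \<in> Lp_space M p" by (auto simp: Lp_generator_def)
    have "AE x in M. T w (\<lambda>y. z * f y + (- 1) * g y) x = f x"
      using generator_unique[OF generator_T[OF fg w p] right[OF f] p]
        T_add[OF w Lp_space_scale[OF f, of z] Lp_space_scale[OF g, of "-1"] p]
      by eventually_elim (simp only: T_scale, simp)
    then show ?thesis by simp
  qed
  show ?thesis
    unfolding Lp_resolvent_set_def using T_bounded_linear[OF w p] left right by blast
qed

lemma T_eigenfunction:
  assumes w: "weight w" and E: "\<And>v. 0 < v \<Longrightarrow> E v f x = (if l < v then f x else 0)"
  shows "T w f x = tail w l * f x"
proof -
  have "T w f x = (LINT v|lborel. (indicator {l<..} v *\<^sub>R w v) * f x)"
    unfolding T_def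
  proof (rule Bochner_Integration.integral_cong[OF refl])
    fix v
    show "w v * E v f x = (indicator {l<..} v *\<^sub>R w v) * f x"
      using E[of v] weightD(2)[OF w, of v] by (cases "0 < v") auto
  qed
  also have "\<dots> = tail w l * f x"
    unfolding tail_def set_lebesgue_integral_def by (rule integral_mult_left_zero)
  finally show ?thesis .
qed

text \<open>The hypothesis puts \<open>f\<close> into the jump of the spectral family at
  \<open>l\<close>, so \<open>P t f\<close> is \<open>exp (- t * l)\<close> times \<open>f\<close>.
  For \<open>l = 0\<close> it says that every average fixes \<open>f\<close>.\<close>

lemma generator_eigenfunction:
  assumes f: "f \<in> Lp_space M p" and p: "1 \<le> p" and l: "0 \<le> l"
    and E: "\<And>v x. 0 < v \<Longrightarrow> E v f x = (if l < v then f x else 0)"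
  shows "(f, \<lambda>x. complex_of_real l * f x) \<in> Lp_generator M p P"
proof -
  let ?c = "\<lambda>t. (1 - exp (- t * l)) / t - l"
  have eq: "(f x - P t f x) / complex_of_real t - complex_of_real l * f x = complex_of_real (?c t) * f x"
    if t: "0 < t" for t x
    using T_eigenfunction[OF semigroup_weight(1)[OF t] E, of x] t
    by (simp add: P_pos semigroup_weight(2)[OF t l] field_simps)
  have norm: "Lp_norm M p (\<lambda>x. (f x - P t f x) / complex_of_real t - complex_of_real l * f x)
      = \<bar>?c t\<bar> * Lp_norm M p f" if "0 < t" for t
  proof -
    have "0 < p" using p by simp
    from Lp_norm_scale[OF this, of M "complex_of_real (?c t)" f] show ?thesis
      unfolding norm_of_real eq[OF that] .
  qed
  have "((\<lambda>t. (1 - exp (- t * l)) / t - l) \<longlongrightarrow> 0) (at_right 0)"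
    by real_asymp
  then have "((\<lambda>t. \<bar>?c t\<bar> * Lp_norm M p f) \<longlongrightarrow> 0) (at_right 0)"
    using tendsto_rabs_zero tendsto_mult_left_zero by blast
  then have "((\<lambda>t. Lp_norm M p (\<lambda>x. (f x - P t f x) / complex_of_real t - complex_of_real l * f x)) \<longlongrightarrow> 0) (at_right 0)"
    by (rule Lim_transform_eventually, intro eventually_mono[OF eventually_at_right_less]) (simp add: norm)
  then show ?thesis using f Lp_space_scale[OF f] by (simp add: Lp_generator_def)
qed

text \<open>Eigenvalues arbitrarily close to \<open>z\<close> rule out a bounded inverse. Letting
  the eigenvalue depend on \<epsilon> covers limit points directly, with no separate argument that
  the spectrum is closed.\<close>

lemma approximate_eigenvalue_in_spectrum:
  assumes p: "1 \<le> p"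
    and approx: "\<And>\<epsilon>. 0 < \<epsilon> \<Longrightarrow> \<exists>f l. (f, \<lambda>x. l * f x) \<in> Lp_generator M p P \<and> Lp_norm M p f \<noteq> 0 \<and> norm (z - l) < \<epsilon>"
  shows "z \<in> Lp_spectrum M p (Lp_generator M p P)"
  unfolding Lp_spectrum_def
proof
  assume "z \<in> Lp_resolvent_set M p (Lp_generator M p P)"
  then obtain R where R: "Lp_bounded_linear M p R"
    and left: "\<And>f g. (f, g) \<in> Lp_generator M p P \<Longrightarrow> AE x in M. R (\<lambda>y. z * f y - g y) x = f x"
    unfolding Lp_resolvent_set_def by blast
  from R obtain C where C: "\<And>f. f \<in> Lp_space M p \<Longrightarrow> Lp_norm M p (R f) \<le> C * Lp_norm M p f"
    unfolding Lp_bounded_linear_def by blast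
  \<comment> \<open>An inverse with bound \<open>C\<close> forces the norm of \<open>f\<close> to be
    at most \<open>C * norm (z - l)\<close> times itself; below this threshold that factor is less
    than 1.\<close>
  obtain f l where fg: "(f, \<lambda>x. l * f x) \<in> Lp_generator M p P" and nz: "Lp_norm M p f \<noteq> 0"
    and close: "norm (z - l) < 1 / (1 + \<bar>C\<bar>)"
    using approx[of "1 / (1 + \<bar>C\<bar>)"] by (auto simp: add_pos_nonneg)
  from fg have f: "f \<in> Lp_space M p" by (simp add: Lp_generator_def)
  have "AE x in M. R (\<lambda>y. (z - l) * f y) x = f x"
    using left[OF fg] by (simp add: left_diff_distrib)
  moreover have Rf: "R (\<lambda>y. (z - l) * f y) \<in> Lp_space M p"
    using R Lp_space_scale[OF f] unfolding Lp_bounded_linear_def by blast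
  ultimately have "Lp_norm M p f = Lp_norm M p (R (\<lambda>y. (z - l) * f y))"
    using Lp_spaceD(1)[OF f] Lp_spaceD(1)[OF Rf] by (intro Lp_norm_cong[symmetric]) auto
  also have "\<dots> \<le> C * (norm (z - l) * Lp_norm M p f)"
    using C[OF Lp_space_scale[OF f, of "z - l"]] p by (simp add: Lp_norm_scale)
  also have "\<dots> \<le> \<bar>C\<bar> * (norm (z - l) * Lp_norm M p f)"
    by (intro mult_right_mono) (auto simp: Lp_norm_nonneg)
  finally have "1 * Lp_norm M p f \<le> (\<bar>C\<bar> * norm (z - l)) * Lp_norm M p f" by simp
  moreover have "0 < Lp_norm M p f" using nz Lp_norm_nonneg[of M p f] by simp
  ultimately have "1 \<le> \<bar>C\<bar> * norm (z - l)" by (simp only: mult_le_cancel_right_pos)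
  moreover have "\<bar>C\<bar> * norm (z - l) \<le> \<bar>C\<bar> * (1 / (1 + \<bar>C\<bar>))"
    using close by (intro mult_left_mono) auto
  moreover have "\<bar>C\<bar> * (1 / (1 + \<bar>C\<bar>)) < 1" by (simp add: divide_simps)
  ultimately show False by linarith
qed

end

section \<open>Functional calculus on \<open>L\<^sup>2\<close>\<close>

lemma tail_at_top:
  assumes "weight w"
  shows "(\<lambda>n::nat. tail w (real n)) \<longlonglongrightarrow> 0"
proof -
  note [measurable] = weightD(3)[OF assms]
  have "(\<lambda>n::nat. LINT v|lborel. indicator {real n<..} v *\<^sub>R w v) \<longlonglongrightarrow> (LINT v::real|lborel. 0)"
  proof (rule integral_dominated_convergence[where w="\<lambda>v. norm (w v)"])
    show "AE v in lborel. (\<lambda>n. indicator {real n<..} v *\<^sub>R w v) \<longlonglongrightarrow> 0"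
    proof (intro AE_I2 tendsto_eventually)
      fix v :: real
      obtain n :: nat where "v \<le> real n" using real_arch_simple by blast
      then show "\<forall>\<^sub>F n in sequentially. indicator {real n<..} v *\<^sub>R w v = 0"
        by (intro eventually_sequentiallyI[of n]) (auto simp: indicator_def)
    qed
    show "AE v in lborel. norm (indicator {real n<..} v *\<^sub>R w v) \<le> norm (w v)" for n :: nat
      by (intro AE_I2) (auto simp: indicator_def)
  qed (use weightD(1)[OF assms] in auto)
  then show ?thesis by (simp add: tail_def set_lebesgue_integral_def)
qed

text \<open>Up to its endpoint an up-closed set is the half-line above its infimum, so the integral
  is a tail. The empty set is the limit of half-lines moving to infinity, where the tail
  vanishes.\<close>

lemma upset_integral_bound:
  assumes w: "weight w" and bound: "\<And>u. 0 \<le> u \<Longrightarrow> norm (c + tail w u) \<le> m"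
    and U: "U \<subseteq> {0<..}" "\<And>v v'. v \<in> U \<Longrightarrow> v \<le> v' \<Longrightarrow> v' \<in> U" and meas: "U \<in> sets borel"
  shows "norm (c + (LINT v:U|lborel. w v)) \<le> m"
proof (cases "U = {}")
  case True
  have "(\<lambda>n::nat. norm (c + tail w (real n))) \<longlonglongrightarrow> norm (c + 0)"
    by (intro tendsto_intros tail_at_top w)
  then have "norm (c + 0) \<le> m"
    by (rule tendsto_upperbound) (auto intro!: always_eventually bound)
  then show ?thesis using True by (simp add: set_lebesgue_integral_def)
next
  case False
  define \<alpha> where "\<alpha> = Inf U"
  have bdd: "bdd_below U" using U(1) by (intro bdd_belowI[of _ 0]) auto
  have \<alpha>: "0 \<le> \<alpha>" unfolding \<alpha>_def using False U(1) by (intro cInf_greatest) auto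
  have above: "v \<in> U" if "\<alpha> < v" for v
    using that cInf_less_iff[OF False bdd, of v] U(2) unfolding \<alpha>_def by (meson less_imp_le)
  have below: "\<alpha> \<le> v" if "v \<in> U" for v
    unfolding \<alpha>_def using that bdd by (rule cInf_lower)
  note [measurable] = weightD(3)[OF w] meas
  have "(LINT v:U|lborel. w v) = tail w \<alpha>"
    unfolding tail_def set_lebesgue_integral_def
  proof (rule integral_cong_AE)
    show "AE v in lborel. indicator U v *\<^sub>R w v = indicator {\<alpha><..} v *\<^sub>R w v"
      using AE_lborel_singleton[of \<alpha>]
    proof eventually_elim
      case (elim v)
      then have "v \<in> U \<longleftrightarrow> \<alpha> < v" using above[of v] below[of v] by auto
      then show ?case by (simp add: indicator_def)
    qed
  qed measurable
  then show ?thesis using bound[OF \<alpha>] by simp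
qed

text \<open>An integration by parts against the increasing function \<open>e\<close>, in layer cake form:
  \<open>e v\<close> is the length of \<open>{s. 0 < s < e v}\<close>, and for fixed \<open>s\<close> the set \<open>{v. s < e v}\<close> is a half-line.\<close>

lemma layer_cake_bound:
  fixes e :: "real \<Rightarrow> real"
  assumes w: "weight w" and bound: "\<And>u. 0 \<le> u \<Longrightarrow> norm (c + tail w u) \<le> m"
    and e [measurable]: "e \<in> borel_measurable borel" and e_range: "\<And>v. 0 \<le> e v" "\<And>v. e v \<le> A"
    and mono: "\<And>v v'. 0 < v \<Longrightarrow> v \<le> v' \<Longrightarrow> e v \<le> e v'"
  shows "norm (c * complex_of_real A + (LINT v|lborel. w v * complex_of_real (e v))) \<le> m * A"
proof -
  note [measurable] = weightD(3)[OF w]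
  have A: "0 \<le> A" using e_range[of 0] by linarith
  let ?h = "\<lambda>v s. indicator {0<..<A} s *\<^sub>R (if s < e v then w v else 0)"
  let ?U = "\<lambda>s. {v. 0 < v \<and> s < e v}"
  have int: "integrable (lborel \<Otimes>\<^sub>M lborel) (\<lambda>(v, s). ?h v s)"
  proof (rule Bochner_Integration.integrable_bound)
    show "integrable (lborel \<Otimes>\<^sub>M lborel) (\<lambda>(v, s). w v * complex_of_real (indicator {0<..<A} s))"
    proof (rule lborel_pair.Fubini_integrable)
      have "integrable lborel (\<lambda>s. complex_of_real (indicator {0<..<A} s))"
        using A by (intro integrable_of_real integrable_real_indicator) auto
      then show "AE v in lborel. integrable lborel (\<lambda>s. case (v, s) of (v, s) \<Rightarrow> w v * complex_of_real (indicator {0<..<A} s))"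
        by (intro AE_I2) (simp del: of_real_indicator)
      show "integrable lborel (\<lambda>v. LINT s|lborel. norm (case (v, s) of (v, s) \<Rightarrow> w v * complex_of_real (indicator {0<..<A} s)))"
        using weightD(1)[OF w] by (simp add: norm_mult)
    qed measurable
    show "AE z in lborel \<Otimes>\<^sub>M lborel. norm (case z of (v, s) \<Rightarrow> ?h v s)
        \<le> norm (case z of (v, s) \<Rightarrow> w v * complex_of_real (indicator {0<..<A} s))"
      by (intro AE_I2) (auto simp: indicator_def norm_mult)
  qed measurable
  have e_int: "(LINT s|lborel. ?h v s) = w v * complex_of_real (e v)" for v
  proof -
    have "(LINT s|lborel. ?h v s) = (LINT s|lborel. indicator {0<..<e v} s *\<^sub>R w v)"
      using e_range[of v] by (intro Bochner_Integration.integral_cong) (auto simp: indicator_def)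
    also have "\<dots> = e v *\<^sub>R w v"
      using e_range(1)[of v] by (subst integral_scaleR_left) (auto simp: emeasure_lborel_Ioo)
    finally show ?thesis by (simp add: scaleR_conv_of_real mult.commute)
  qed
  have U_int: "(LINT v|lborel. ?h v s) = indicator {0<..<A} s *\<^sub>R (LINT v:?U s|lborel. w v)" for s
    unfolding set_lebesgue_integral_def integral_scaleR_right[symmetric]
  proof (rule Bochner_Integration.integral_cong[OF refl])
    fix v show "?h v s = indicator {0<..<A} s *\<^sub>R (indicator (?U s) v *\<^sub>R w v)"
      using weightD(2)[OF w, of v] by (cases "0 < v") (auto simp: indicator_def)
  qed
  have I: "integrable lborel (\<lambda>s. indicator {0<..<A} s *\<^sub>R (LINT v:?U s|lborel. w v))"
    using lborel_pair.integrable_snd[OF int] by (simp only: U_int)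
  have Ic: "integrable lborel (\<lambda>s. indicator {0<..<A} s *\<^sub>R c)"
    using A by (intro integrable_scaleR_left) (auto intro!: integrable_real_indicator)
  have "(LINT v|lborel. w v * complex_of_real (e v)) = (LINT v|lborel. LINT s|lborel. ?h v s)"
    by (simp only: e_int)
  also have "\<dots> = (LINT s|lborel. LINT v|lborel. ?h v s)"
    by (rule lborel_pair.Fubini_integral[symmetric, OF int])
  also have "\<dots> = (LINT s|lborel. indicator {0<..<A} s *\<^sub>R (LINT v:?U s|lborel. w v))"
    by (simp only: U_int)
  finally have "c * complex_of_real A + (LINT v|lborel. w v * complex_of_real (e v))
      = (LINT s|lborel. indicator {0<..<A} s *\<^sub>R c) + (LINT s|lborel. indicator {0<..<A} s *\<^sub>R (LINT v:?U s|lborel. w v))"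
    using A by (subst integral_scaleR_left) (auto simp: scaleR_conv_of_real mult.commute)
  also have "\<dots> = (LINT s|lborel. indicator {0<..<A} s *\<^sub>R (c + (LINT v:?U s|lborel. w v)))"
    using I Ic by (simp add: scaleR_add_right)
  finally have "norm (c * complex_of_real A + (LINT v|lborel. w v * complex_of_real (e v)))
      \<le> (LINT s|lborel. norm (indicator {0<..<A} s *\<^sub>R (c + (LINT v:?U s|lborel. w v))))"
    by (simp only:) (rule integral_norm_bound)
  also have "\<dots> \<le> (LINT s|lborel. m * indicator {0<..<A} s)"
  proof (rule integral_mono)
    show "integrable lborel (\<lambda>s. norm (indicator {0<..<A} s *\<^sub>R (c + (LINT v:?U s|lborel. w v))))"
      using Bochner_Integration.integrable_add[OF Ic I] by (intro integrable_norm) (simp add: scaleR_add_right)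
    show "integrable lborel (\<lambda>s. m * indicator {0<..<A} s)"
      using A by (intro integrable_mult_right integrable_real_indicator) auto
    fix s
    have "norm (c + (LINT v:?U s|lborel. w v)) \<le> m"
    proof (rule upset_integral_bound[OF w bound])
      fix v v' assume "v \<in> ?U s" "v \<le> v'"
      then show "v' \<in> ?U s" using mono[of v v'] by auto
    qed auto
    then show "norm (indicator {0<..<A} s *\<^sub>R (c + (LINT v:?U s|lborel. w v))) \<le> m * indicator {0<..<A} s"
      by (auto simp: indicator_def)
  qed
  also have "\<dots> = m * A" using A by simp
  finally show ?thesis .
qed

lemma L2_integrable_mult:
  assumes "f \<in> Lp_space M 2" "g \<in> Lp_space M 2"
  shows "integrable M (\<lambda>x. f x * g x)"
proof (rule Bochner_Integration.integrable_bound)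
  show "integrable M (\<lambda>x. norm (f x) powr 2 + norm (g x) powr 2)"
    using Lp_spaceD(2)[OF assms(1)] Lp_spaceD(2)[OF assms(2)] by simp
  have "a * b \<le> a powr 2 + b powr 2" if "0 \<le> a" "0 \<le> b" for a b :: real
  proof -
    have "0 \<le> (a - b)\<^sup>2 + a * b" using that by simp
    then show ?thesis using sum_squares_ge_zero[of a b] that by (simp add: power2_eq_square algebra_simps)
  qed
  then show "AE x in M. norm (f x * g x) \<le> norm (norm (f x) powr 2 + norm (g x) powr 2)"
    by (intro AE_I2) (simp add: norm_mult)
qed (use Lp_spaceD(1)[OF assms(1)] Lp_spaceD(1)[OF assms(2)] in auto)

lemma Lp_space_cnj:
  assumes "f \<in> Lp_space M p"
  shows "(\<lambda>x. cnj (f x)) \<in> Lp_space M p"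
proof -
  have "(\<lambda>x. cnj (f x)) \<in> borel_measurable M"
    using Lp_spaceD(1)[OF assms]
    by (rule measurable_compose) (intro borel_measurable_continuous_onI continuous_on_cnj continuous_on_id)
  then show ?thesis using Lp_spaceD(2)[OF assms] by (simp add: Lp_space_def)
qed

lemma L2_norm_sq:
  assumes "f \<in> Lp_space M 2"
  shows "complex_of_real ((Lp_norm M 2 f)\<^sup>2) = (LINT x|M. f x * cnj (f x))"
proof -
  have "(Lp_norm M 2 f)\<^sup>2 = (LINT x|M. norm (f x) powr 2)"
    using Lp_norm_powr[of 2 M f] Lp_norm_nonneg[of M 2 f] by simp
  also have "\<dots> = (LINT x|M. (norm (f x))\<^sup>2)" by simp
  finally show ?thesis
    by (simp only: integral_complex_of_real[symmetric] complex_norm_square)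
qed

context ball_averages
begin

lemma E_symmetric_L2:
  assumes f: "f \<in> Lp_space M 2" and g: "g \<in> Lp_space M 2"
  shows "(LINT x|M. g x * E v f x) = (LINT x|M. E v g x * f x)"
proof (rule E_pairing[OF f])
  have "integrable M (\<lambda>x. norm (g x * E v (\<lambda>y. complex_of_real (norm (f y))) x))"
    using g f by (intro integrable_norm L2_integrable_mult E_Lp Lp_space_norm) auto
  then show "integrable M (\<lambda>x. norm (g x) * (LINT y|M. k v x y * norm (f y)))"
    by (simp add: E_norm norm_mult abs_of_nonneg integral_nonneg_AE)
qed (use Lp_spaceD(1)[OF g] in auto)

lemma T_pairing:
  assumes w: "weight w" and f: "f \<in> Lp_space M 2" and g: "g \<in> Lp_space M 2"
  shows "(LINT x|M. g x * T w f x) = (LINT v|lborel. w v * (LINT x|M. g x * E v f x))"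
proof -
  interpret Q: pair_sigma_finite M lborel ..
  note [measurable] = weightD(3)[OF w] Lp_spaceD(1)[OF f] Lp_spaceD(1)[OF g]
  let ?h = "\<lambda>x v. g x * (w v * E v f x)"
  have int: "integrable (M \<Otimes>\<^sub>M lborel) (\<lambda>(x, v). ?h x v)"
  proof (rule Q.Fubini_integrable)
    have "integrable M (\<lambda>x. norm (g x * complex_of_real (LINT v|lborel. norm (w v * E v f x))))"
      using average_E(2)[OF lborel.sigma_finite_measure_axioms weightD(1)[OF w] _ f, of "\<lambda>v. v"] g
      by (intro integrable_norm L2_integrable_mult) auto
    moreover have "norm (g x * complex_of_real (LINT v|lborel. norm (w v * E v f x)))
        = (LINT v|lborel. norm (case (x, v) of (x, v) \<Rightarrow> ?h x v))" for x
    proof -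
      have "(LINT v|lborel. norm (case (x, v) of (x, v) \<Rightarrow> ?h x v))
          = (LINT v|lborel. norm (g x) * norm (w v * E v f x))"
        by (simp add: norm_mult)
      also have "\<dots> = norm (g x) * (LINT v|lborel. norm (w v * E v f x))"
        by (rule integral_mult_right_zero)
      finally show ?thesis by (simp add: norm_mult integral_nonneg_AE)
    qed
    ultimately show "integrable M (\<lambda>x. LINT v|lborel. norm (case (x, v) of (x, v) \<Rightarrow> ?h x v))"
      by simp
    show "AE x in M. integrable lborel (\<lambda>v. case (x, v) of (x, v) \<Rightarrow> ?h x v)"
      using T_integrable[OF w f] by (auto elim!: eventually_mono)
  qed measurable
  have "(LINT x|M. g x * T w f x) = (LINT x|M. LINT v|lborel. ?h x v)"
    unfolding T_def by simp
  also have "\<dots> = (LINT v|lborel. LINT x|M. ?h x v)"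
    by (rule Q.Fubini_integral[symmetric, OF int])
  also have "\<dots> = (LINT v|lborel. w v * (LINT x|M. g x * E v f x))"
    by (simp add: mult.left_commute[of "g _"])
  finally show ?thesis .
qed

lemma T_symmetric_L2:
  assumes w: "weight w" and f: "f \<in> Lp_space M 2" and g: "g \<in> Lp_space M 2"
  shows "(LINT x|M. g x * T w f x) = (LINT x|M. T w g x * f x)"
proof -
  have "(LINT x|M. T w g x * f x) = (LINT v|lborel. w v * (LINT x|M. f x * E v g x))"
    using T_pairing[OF w g f] by (simp add: mult.commute)
  also have "\<dots> = (LINT x|M. g x * T w f x)"
    unfolding T_pairing[OF w f g] E_symmetric_L2[OF g f] by (simp add: mult.commute)
  finally show ?thesis ..
qed

text \<open>Formally the squared norm is the integral of the squared symbol against the measure with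
  distribution function \<open>e v\<close>. To avoid this measure, the square of the symmetric
  operator is expanded into \<open>c\<^sup>2\<close> plus a weighted operator with symbol
  \<open>(c + tail w)\<^sup>2 - c\<^sup>2\<close>, and \<open>layer_cake_bound\<close> is applied to
  the increasing function \<open>e\<close>.\<close>

lemma L2_operator_bound:
  assumes w: "weight w" and real_w: "\<And>v. cnj (w v) = w v" and m: "0 \<le> m"
    and bound: "\<And>u. 0 \<le> u \<Longrightarrow> norm (complex_of_real c + tail w u) \<le> m"
    and f: "f \<in> Lp_space M 2"
  shows "Lp_norm M 2 (\<lambda>x. complex_of_real c * f x + T w f x) \<le> m * Lp_norm M 2 f"
proof -
  let ?c = "complex_of_real c"
  define S where "S g x = ?c * g x + T w g x" for g x
  have S_Lp: "S g \<in> Lp_space M 2" if "g \<in> Lp_space M 2" for g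
    unfolding S_def[abs_def] using that by (intro Lp_space_add Lp_space_scale T_Lp w) auto
  have S_sym: "(LINT x|M. S g x * h x) = (LINT x|M. g x * S h x)"
    if g: "g \<in> Lp_space M 2" and h: "h \<in> Lp_space M 2" for g h
  proof -
    note i = L2_integrable_mult[OF Lp_space_scale[OF g, of ?c] h] L2_integrable_mult[OF T_Lp(1)[OF w g] h]
      L2_integrable_mult[OF g Lp_space_scale[OF h, of ?c]] L2_integrable_mult[OF g T_Lp(1)[OF w h]]
    have "(LINT x|M. S g x * h x) = (LINT x|M. ?c * g x * h x) + (LINT x|M. T w g x * h x)"
      unfolding S_def distrib_right using i by (intro Bochner_Integration.integral_add) auto
    also have "\<dots> = (LINT x|M. g x * (?c * h x)) + (LINT x|M. g x * T w h x)"
      using T_symmetric_L2[OF w h g] by (simp add: mult_ac)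
    also have "\<dots> = (LINT x|M. g x * S h x)"
      unfolding S_def distrib_left using i by (intro Bochner_Integration.integral_add[symmetric]) auto
    finally show ?thesis .
  qed
  \<comment> \<open>The pairing is bilinear, so the norm pairs \<open>f\<close> with its conjugate;
    \<open>S\<close> commutes with conjugation because \<open>c\<close> and \<open>w\<close> are
    real.\<close>
  define f' where "f' x = cnj (f x)" for x
  have f': "f' \<in> Lp_space M 2" unfolding f'_def[abs_def] by (rule Lp_space_cnj[OF f])
  have S_cnj: "cnj (S f x) = S f' x" for x
    unfolding S_def T_def f'_def
    by (simp add: E_cnj real_w flip: Bochner_Integration.integral_cnj)
  define w2 where "w2 v = (2 * ?c) * w v + wprod w w v" for v
  have w2: "weight w2" unfolding w2_def[abs_def] by (intro weight_add weight_scale weight_wprod w)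
  define e where "e v = (Lp_norm M 2 (E v f))\<^sup>2" for v
  define A where "A = (Lp_norm M 2 f)\<^sup>2"
  \<comment> \<open>\<open>E v\<close> is a symmetric idempotent, so its quadratic form is a squared
    norm.\<close>
  have e_E: "(LINT x|M. f x * E v f' x) = complex_of_real (e v)" if v: "0 < v" for v
  proof -
    have "complex_of_real (e v) = (LINT x|M. E v f x * E v f' x)"
      unfolding e_def L2_norm_sq[OF E_Lp(1)[OF f, simplified]] f'_def by (simp add: E_cnj)
    also have "\<dots> = (LINT x|M. f x * E v (E v f') x)"
      using E_symmetric_L2[OF E_Lp(1)[OF f'] f, of v] by simp
    also have "\<dots> = (LINT x|M. f x * E v f' x)" using E_E[OF f' _ v v] by simp
    finally show ?thesis ..
  qed
  have "complex_of_real ((Lp_norm M 2 (S f))\<^sup>2) = (LINT x|M. S f x * S f' x)"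
    unfolding L2_norm_sq[OF S_Lp[OF f]] S_cnj ..
  also have "\<dots> = (LINT x|M. f x * S (S f') x)" by (rule S_sym[OF f S_Lp[OF f']])
  also have "\<dots> = (LINT x|M. ?c\<^sup>2 * (f x * f' x) + f x * T w2 f' x)"
  proof (rule integral_cong_AE)
    note [measurable] = Lp_spaceD(1)[OF f] Lp_spaceD(1)[OF f'] Lp_spaceD(1)[OF S_Lp[OF S_Lp[OF f']]]
      Lp_spaceD(1)[OF T_Lp(1)[OF w2 f']]
    show "(\<lambda>x. f x * S (S f') x) \<in> borel_measurable M"
      "(\<lambda>x. ?c\<^sup>2 * (f x * f' x) + f x * T w2 f' x) \<in> borel_measurable M"
      by simp_all
    have "AE x in M. S (S f') x = ?c\<^sup>2 * f' x + T w2 f' x"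
      using T_add[OF w Lp_space_scale[OF f', of ?c] T_Lp(1)[OF w f'], simplified]
        T_weight_add[OF weight_scale[OF w] weight_wprod[OF w w] f', of "2 * ?c", simplified] T_T[OF w w f', simplified]
      unfolding S_def w2_def[abs_def]
    proof eventually_elim
      case (elim x)
      show ?case
        unfolding elim(1) elim(2) elim(3)[symmetric] T_weight_scale T_scale
        by (simp add: power2_eq_square algebra_simps)
    qed
    then show "AE x in M. f x * S (S f') x = ?c\<^sup>2 * (f x * f' x) + f x * T w2 f' x"
      by eventually_elim (simp add: algebra_simps)
  qed
  also have "\<dots> = ?c\<^sup>2 * (LINT x|M. f x * f' x) + (LINT x|M. f x * T w2 f' x)"
    using L2_integrable_mult[OF f f'] L2_integrable_mult[OF f T_Lp(1)[OF w2 f']] by simp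
  also have "(LINT x|M. f x * f' x) = complex_of_real A"
    unfolding A_def L2_norm_sq[OF f] f'_def ..
  also have "(LINT x|M. f x * T w2 f' x) = (LINT v|lborel. w2 v * complex_of_real (e v))"
    unfolding T_pairing[OF w2 f' f]
  proof (rule Bochner_Integration.integral_cong[OF refl])
    fix v show "w2 v * (LINT x|M. f x * E v f' x) = w2 v * complex_of_real (e v)"
      using e_E[of v] weightD(2)[OF w2, of v] by (cases "0 < v") auto
  qed
  finally have eq: "complex_of_real ((Lp_norm M 2 (S f))\<^sup>2)
      = ?c\<^sup>2 * complex_of_real A + (LINT v|lborel. w2 v * complex_of_real (e v))" .
  have "norm (?c\<^sup>2 * complex_of_real A + (LINT v|lborel. w2 v * complex_of_real (e v))) \<le> m\<^sup>2 * A"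
  proof (rule layer_cake_bound[OF w2])
    fix u :: real assume u: "0 \<le> u"
    have "tail w2 u = (2 * ?c) * tail w u + tail w u * tail w u"
      unfolding w2_def[abs_def]
      by (simp only: tail_add[OF weightD(1)[OF weight_scale[OF w]] weightD(1)[OF weight_wprod[OF w w]]]
          tail_scale tail_wprod[OF w w])
    then have "?c\<^sup>2 + tail w2 u = (?c + tail w u)\<^sup>2" by (simp add: power2_eq_square algebra_simps)
    then show "norm (?c\<^sup>2 + tail w2 u) \<le> m\<^sup>2"
      using bound[OF u] by (simp add: norm_power power_mono)
  next
    note [measurable] = Lp_spaceD(1)[OF f]
    show "e \<in> borel_measurable borel" unfolding e_def[abs_def] Lp_norm_def by measurable
    show "0 \<le> e v" for v by (simp add: e_def)
    show "e v \<le> A" for v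
      unfolding e_def A_def using E_Lp(2)[OF f] by (intro power_mono) (auto simp: Lp_norm_nonneg)
    fix v v' :: real assume v: "0 < v" "v \<le> v'"
    \<comment> \<open>The coarser average factors through the finer one, and averages are
      contractions; hence \<open>e\<close> is increasing.\<close>
    have "E v f = E v (E v' f)" using E_E[OF f _ v(1), of v'] v by (simp add: fun_eq_iff min_absorb1)
    then show "e v \<le> e v'"
      unfolding e_def using E_Lp(2)[OF E_Lp(1)[OF f, of v'], of v]
      by (intro power_mono) (auto simp: Lp_norm_nonneg)
  qed
  then have "(Lp_norm M 2 (S f))\<^sup>2 \<le> (m * Lp_norm M 2 f)\<^sup>2"
    unfolding eq[symmetric] by (simp add: A_def power_mult_distrib flip: of_real_power)
  then have "Lp_norm M 2 (S f) \<le> m * Lp_norm M 2 f"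
    by (rule power2_le_imp_le) (simp add: m Lp_norm_nonneg)
  then show ?thesis by (simp add: S_def[abs_def])
qed

lemma T_weight_sum:
  assumes "finite I" "\<And>i. i \<in> I \<Longrightarrow> weight (w i)" and f: "f \<in> Lp_space M p" "1 \<le> p"
  shows "weight (\<lambda>v. \<Sum>i\<in>I. w i v)"
    and "AE x in M. T (\<lambda>v. \<Sum>i\<in>I. w i v) f x = (\<Sum>i\<in>I. T (w i) f x)"
    and "tail (\<lambda>v. \<Sum>i\<in>I. w i v) u = (\<Sum>i\<in>I. tail (w i) u)"
proof -
  have "weight (\<lambda>v. \<Sum>i\<in>I. w i v) \<and> (AE x in M. T (\<lambda>v. \<Sum>i\<in>I. w i v) f x = (\<Sum>i\<in>I. T (w i) f x)) \<and>
      tail (\<lambda>v. \<Sum>i\<in>I. w i v) u = (\<Sum>i\<in>I. tail (w i) u)"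
    using assms(1,2)
  proof (induction I rule: finite_induct)
    case empty
    then show ?case by (simp add: weight_def T_def tail_def)
  next
    case (insert j I)
    then have IH: "weight (\<lambda>v. \<Sum>i\<in>I. w i v)" "AE x in M. T (\<lambda>v. \<Sum>i\<in>I. w i v) f x = (\<Sum>i\<in>I. T (w i) f x)"
      "tail (\<lambda>v. \<Sum>i\<in>I. w i v) u = (\<Sum>i\<in>I. tail (w i) u)" and wj: "weight (w j)"
      by auto
    have "AE x in M. T (\<lambda>v. w j v + (\<Sum>i\<in>I. w i v)) f x = T (w j) f x + (\<Sum>i\<in>I. T (w i) f x)"
      using T_weight_add[OF wj IH(1) f] IH(2) by eventually_elim simp
    then show ?case
      using insert.hyps IH wj tail_add[OF weightD(1)[OF wj] weightD(1)[OF IH(1)]]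
      by (simp add: weight_add)
  qed
  then show "weight (\<lambda>v. \<Sum>i\<in>I. w i v)"
    and "AE x in M. T (\<lambda>v. \<Sum>i\<in>I. w i v) f x = (\<Sum>i\<in>I. T (w i) f x)"
    and "tail (\<lambda>v. \<Sum>i\<in>I. w i v) u = (\<Sum>i\<in>I. tail (w i) u)"
    by blast+
qed

lemma power_eq_P:
  assumes A: "\<And>f. f \<in> Lp_space M 2 \<Longrightarrow> A f = T (semigroup_weight 1) f" and f: "f \<in> Lp_space M 2"
  shows "(A ^^ i) f \<in> Lp_space M 2 \<and> (AE x in M. (A ^^ i) f x = P (real i) f x)"
proof (induction i)
  case 0
  then show ?case using f by (simp add: P_def)
next
  case (Suc i)
  then have Ai: "(A ^^ i) f \<in> Lp_space M 2" and AE: "AE x in M. (A ^^ i) f x = P (real i) f x" by auto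
  have Pi: "P (real i) f \<in> Lp_space M 2" using P_Lp(1)[OF _ f, of "real i"] by simp
  have "(A ^^ Suc i) f = P 1 ((A ^^ i) f)" using A[OF Ai] by (simp add: P_pos)
  also have "\<dots> = P 1 (P (real i) f)"
    unfolding P_pos[OF zero_less_one] by (rule T_cong[OF AE Lp_spaceD(1)[OF Ai] Lp_spaceD(1)[OF Pi]])
  finally have eq: "(A ^^ Suc i) f = P 1 (P (real i) f)" .
  have "AE x in M. P (1 + real i) f x = P 1 (P (real i) f) x"
    using Lp_contraction_semigroup_P[of 2] f unfolding Lp_contraction_semigroup_def by simp
  then show ?case
    unfolding eq using P_Lp(1)[OF _ Pi, of 1] by (auto elim!: eventually_mono)
qed

text \<open>Substituting \<open>s = exp (- u)\<close> makes a polynomial in \<open>A\<close> an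
  operator with symbol \<open>poly q (exp (- u))\<close>. Its value at infinity,
  \<open>coeff q 0\<close>, is split off as a multiple of the identity, and the rest is a
  tail.\<close>

lemma poly_operator_eq:
  assumes A: "\<And>f. f \<in> Lp_space M 2 \<Longrightarrow> A f = T (semigroup_weight 1) f"
  obtains w where "weight w" "\<And>v. cnj (w v) = w v"
    "\<And>u. 0 \<le> u \<Longrightarrow> tail w u = complex_of_real (poly q (exp (- u)) - coeff q 0)"
    "\<And>f. f \<in> Lp_space M 2 \<Longrightarrow> AE x in M. poly_operator q A f x = complex_of_real (coeff q 0) * f x + T w f x"
proof -
  let ?I = "{1..degree q}"
  let ?w = "\<lambda>i v. complex_of_real (coeff q i) * semigroup_weight (real i) v"
  have wi: "weight (?w i)" if "i \<in> ?I" for i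
    using that by (intro weight_scale semigroup_weight) auto
  define w where "w v = (\<Sum>i\<in>?I. ?w i v)" for v
  have split: "{..degree q} = insert 0 ?I" by auto
  note sum = T_weight_sum[of ?I ?w, OF _ wi, folded w_def]
  show thesis
  proof (rule that)
    show "weight w" using sum(1)[OF _ _ Lp_space_zero[of M 2]] by (simp add: w_def[abs_def])
    show "cnj (w v) = w v" for v by (simp add: w_def semigroup_weight_def)
    show "tail w u = complex_of_real (poly q (exp (- u)) - coeff q 0)" if u: "0 \<le> u" for u
    proof -
      have "tail w u = (\<Sum>i\<in>?I. tail (?w i) u)"
        using sum(3)[OF _ _ Lp_space_zero[of M 2]] by (simp add: w_def[abs_def])
      also have "\<dots> = (\<Sum>i\<in>?I. complex_of_real (coeff q i * exp (- u) ^ i))"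
      proof (rule sum.cong[OF refl])
        fix i assume "i \<in> ?I"
        then have "tail (semigroup_weight (real i)) u = complex_of_real (exp (- real i * u))"
          using u by (intro semigroup_weight(2)) auto
        also have "exp (- real i * u) = exp (- u) ^ i" by (simp flip: exp_of_nat_mult)
        finally show "tail (?w i) u = complex_of_real (coeff q i * exp (- u) ^ i)"
          by (simp add: tail_scale)
      qed
      also have "\<dots> = complex_of_real (poly q (exp (- u)) - coeff q 0)"
        unfolding poly_altdef split by simp
      finally show ?thesis .
    qed
    show "AE x in M. poly_operator q A f x = complex_of_real (coeff q 0) * f x + T w f x"
      if f: "f \<in> Lp_space M 2" for f
    proof -
      have "AE x in M. \<forall>i\<in>?I. (A ^^ i) f x = P (real i) f x"
        using power_eq_P[OF A f] by (intro AE_finite_allI) auto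
      moreover have "AE x in M. T w f x = (\<Sum>i\<in>?I. T (?w i) f x)"
        using sum(2)[OF _ _ f] by (simp add: w_def[abs_def])
      ultimately show ?thesis
      proof eventually_elim
        case (elim x)
        have "(\<Sum>i\<in>?I. complex_of_real (coeff q i) * (A ^^ i) f x) = (\<Sum>i\<in>?I. T (?w i) f x)"
          using elim(1) by (intro sum.cong refl) (simp add: T_weight_scale P_pos)
        then show ?case unfolding poly_operator_def split elim(2) by simp
      qed
    qed
  qed
qed

text \<open>The symbol of the error is the difference between the polynomial and the target function
  at \<open>exp (- u)\<close>, a point of the unit interval. Uniform convergence there bounds the
  \<open>L^2\<close> operator norm by \<open>L2_operator_bound\<close>.\<close>

lemma functional_calculus_P:
  assumes A: "\<And>f. f \<in> Lp_space M 2 \<Longrightarrow> A f = T (semigroup_weight 1) f" and t: "0 \<le> t"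
  shows "is_functional_calculus M A (\<lambda>s. if t = 0 then 1 else s powr t) (P t)"
  unfolding is_functional_calculus_def
proof (intro conjI allI impI)
  show "Lp_bounded_linear M 2 (P t)"
    using Lp_contraction_semigroup_P[of 2] t by (simp add: Lp_contraction_semigroup_def)
  fix q :: "nat \<Rightarrow> real poly" and \<epsilon> :: real
  let ?\<phi> = "\<lambda>s::real. if t = 0 then 1 else s powr t"
  assume lim: "uniform_limit {0..1} (\<lambda>n. poly (q n)) ?\<phi> sequentially" and e: "0 < \<epsilon>"
  have "\<forall>\<^sub>F n in sequentially. \<forall>s\<in>{0..1}. dist (poly (q n) s) (?\<phi> s) < \<epsilon>"
    using lim e by (simp add: uniform_limit_iff)
  then show "\<forall>\<^sub>F n in sequentially. \<forall>f\<in>Lp_space M 2.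
      Lp_norm M 2 (\<lambda>x. poly_operator (q n) A f x - P t f x) \<le> \<epsilon> * Lp_norm M 2 f"
  proof eventually_elim
    case (elim n)
    obtain w where w: "weight w" "\<And>v. cnj (w v) = w v"
      "\<And>u. 0 \<le> u \<Longrightarrow> tail w u = complex_of_real (poly (q n) (exp (- u)) - coeff (q n) 0)"
      "\<And>f. f \<in> Lp_space M 2 \<Longrightarrow> AE x in M. poly_operator (q n) A f x = complex_of_real (coeff (q n) 0) * f x + T w f x"
      by (rule poly_operator_eq[of A "q n"]) (erule A, (rule that; assumption))
    \<comment> \<open>Subtracting \<open>P t\<close> changes the constant if \<open>t = 0\<close>,
      where it is the identity, and the weight otherwise.\<close>
    define c where "c = (if t = 0 then coeff (q n) 0 - 1 else coeff (q n) 0)"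
    define w' where "w' v = (if t = 0 then w v else w v + (- 1) * semigroup_weight t v)" for v
    have w': "weight w'"
    proof (cases "t = 0")
      case False
      with t have "weight (semigroup_weight t)" by (intro semigroup_weight) simp
      from weight_add[OF w(1) weight_scale[OF this, of "-1"]] show ?thesis
        using False by (simp add: w'_def[abs_def])
    qed (use w(1) in \<open>simp add: w'_def[abs_def]\<close>)
    have w'_real: "cnj (w' v) = w' v" for v using w(2) by (simp add: w'_def semigroup_weight_def)
    have bound: "norm (complex_of_real c + tail w' u) \<le> \<epsilon>" if u: "0 \<le> u" for u
    proof -
      have "complex_of_real c + tail w' u = complex_of_real (poly (q n) (exp (- u)) - ?\<phi> (exp (- u)))"
      proof (cases "t = 0")
        case True
        then show ?thesis using w(3)[OF u] by (simp add: c_def w'_def[abs_def])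
      next
        case False
        then have tp: "0 < t" using t by simp
        have "tail w' u = tail w u + (- 1) * tail (semigroup_weight t) u"
          using tail_add[OF weightD(1)[OF w(1)] weightD(1)[OF weight_scale[OF semigroup_weight(1)[OF tp], of "-1"]]]
            tail_scale[of "-1" "semigroup_weight t"] False by (simp add: w'_def[abs_def])
        then show ?thesis using False w(3)[OF u] semigroup_weight(2)[OF tp u]
          by (simp add: c_def powr_def mult.commute)
      qed
      moreover have "\<bar>poly (q n) (exp (- u)) - ?\<phi> (exp (- u))\<bar> < \<epsilon>"
        using elim u by (auto simp: dist_real_def)
      ultimately show ?thesis by (simp only: norm_of_real)
    qed
    show ?case
    proof
      fix f assume f: "f \<in> Lp_space M 2"
      have T_w': "AE x in M. T w' f x = (if t = 0 then T w f x else T w f x - T (semigroup_weight t) f x)"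
      proof (cases "t = 0")
        case False
        then have "weight (semigroup_weight t)" using t by (intro semigroup_weight) simp
        from T_weight_add[OF w(1) weight_scale[OF this, of "-1"] f]
        have "AE x in M. T (\<lambda>v. w v + (- 1) * semigroup_weight t v) f x = T w f x + (- 1) * T (semigroup_weight t) f x"
          unfolding T_weight_scale by simp
        then show ?thesis using False by (simp add: w'_def[abs_def])
      qed (simp add: w'_def[abs_def])
      have AE: "AE x in M. poly_operator (q n) A f x - P t f x = complex_of_real c * f x + T w' f x"
        using w(4)[OF f] T_w' by eventually_elim (auto simp: c_def P_def left_diff_distrib)
      have [measurable]: "poly_operator (q n) A f \<in> borel_measurable M"
        unfolding poly_operator_def[abs_def]
        by (intro borel_measurable_sum borel_measurable_times borel_measurable_const
            Lp_spaceD(1)[OF conjunct1[OF power_eq_P[OF A f]]])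
      note [measurable] = Lp_spaceD(1)[OF f] Lp_spaceD(1)[OF T_Lp(1)[OF w' f]] Lp_spaceD(1)[OF P_Lp(1)[OF t f]]
      have "Lp_norm M 2 (\<lambda>x. poly_operator (q n) A f x - P t f x) = Lp_norm M 2 (\<lambda>x. complex_of_real c * f x + T w' f x)"
        by (rule Lp_norm_cong[OF AE]) simp_all
      also have "\<dots> \<le> \<epsilon> * Lp_norm M 2 f"
        using e by (intro L2_operator_bound[OF w' w'_real _ bound f]) auto
      finally show "Lp_norm M 2 (\<lambda>x. poly_operator (q n) A f x - P t f x) \<le> \<epsilon> * Lp_norm M 2 f" .
    qed
  qed
qed

end

section \<open>Resolvents off the spectrum\<close>

lemma tail_diff:
  assumes w: "weight w" and "a \<le> b"
  shows "(LINT v:{a..b}|lborel. w v) = tail w a - tail w b"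
proof -
  note [measurable] = weightD(3)[OF w]
  have i: "integrable lborel (\<lambda>v. indicator {u<..} v *\<^sub>R w v)" for u
    by (rule integrable_mult_indicator[OF _ weightD(1)[OF w]]) simp
  have "(LINT v:{a..b}|lborel. w v) = (LINT v|lborel. indicator {a<..} v *\<^sub>R w v - indicator {b<..} v *\<^sub>R w v)"
    unfolding set_lebesgue_integral_def
  proof (rule integral_cong_AE)
    show "AE v in lborel. indicator {a..b} v *\<^sub>R w v = indicator {a<..} v *\<^sub>R w v - indicator {b<..} v *\<^sub>R w v"
      using AE_lborel_singleton[of a] by eventually_elim (use assms(2) in \<open>auto simp: indicator_def\<close>)
  qed measurable
  also have "\<dots> = tail w a - tail w b"
    unfolding tail_def set_lebesgue_integral_def by (rule Bochner_Integration.integral_diff[OF i i])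
  finally show ?thesis .
qed

text \<open>The finite exceptional set \<open>S\<close> admits symbols with corners, such as one
  interpolated linearly across a gap.\<close>

lemma tail_eq_antiderivative:
  assumes w: "weight w" and S: "finite S"
    and deriv: "\<And>v. u < v \<Longrightarrow> v \<notin> S \<Longrightarrow> (F has_vector_derivative - w v) (at v)"
    and cont: "continuous_on {u..} F" and lim: "(F \<longlongrightarrow> 0) at_top"
  shows "tail w u = F u"
proof -
  have eq: "tail w u - tail w b = F u - F b" if b: "u \<le> b" for b
  proof -
    have si: "set_integrable lborel {u..b} w"
      unfolding set_integrable_def by (rule integrable_mult_indicator[OF _ weightD(1)[OF w]]) simp
    have "((\<lambda>v. - w v) has_integral (F b - F u)) {u..b}"
      using S b deriv continuous_on_subset[OF cont]
      by (intro fundamental_theorem_of_calculus_interior_strong[of S]) auto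
    from has_integral_neg[OF this] have "(w has_integral (F u - F b)) {u..b}" by simp
    then show ?thesis
      using set_borel_integral_eq_integral(2)[OF si] tail_diff[OF w b] by (simp add: integral_unique)
  qed
  have lim_tail: "(\<lambda>n::nat. tail w u - tail w (real n)) \<longlonglongrightarrow> tail w u - 0"
    by (intro tendsto_intros tail_at_top w)
  have lim_F: "(\<lambda>n::nat. F u - F (real n)) \<longlonglongrightarrow> F u - 0"
    by (intro tendsto_intros filterlim_compose[OF lim] filterlim_real_sequentially)
  obtain m :: nat where m: "u \<le> real m" using real_arch_simple by blast
  have "\<forall>\<^sub>F n::nat in sequentially. F u - F (real n) = tail w u - tail w (real n)"
  proof (intro eventually_sequentiallyI[of m])
    fix n :: nat assume "m \<le> n"
    then have "u \<le> real n" using m by linarith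
    then show "F u - F (real n) = tail w u - tail w (real n)" using eq by simp
  qed
  from LIMSEQ_unique[OF Lim_transform_eventually[OF lim_F this] lim_tail] show ?thesis by simp
qed

text \<open>From \<open>1 + v \<le> norm (1 + z) + norm (z - v)\<close> and \<open>d \<le> r\<close>
  one gets \<open>1 + v \<le> (norm (1 + z) / d + 1) * r\<close>. Decay in the distance from
  \<open>z\<close> is thus compared with the integrable weight
  \<open>1 / (1 + v)\<^sup>2\<close>.\<close>

lemma one_plus_le_distance:
  fixes z :: complex
  assumes "0 < d" "d \<le> r" "norm (z - complex_of_real v) \<le> r" "0 \<le> v"
  shows "1 / r\<^sup>2 \<le> (norm (1 + z) / d + 1)\<^sup>2 * (1 / (1 + v)\<^sup>2)"
proof -
  have r: "0 < r" using assms by linarith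
  have "1 + v = norm ((1 + z) - (z - complex_of_real v))"
  proof -
    have "(1 + z) - (z - complex_of_real v) = complex_of_real (1 + v)" by simp
    then show ?thesis using assms(4) by (simp only: norm_of_real)
  qed
  also have "\<dots> \<le> norm (1 + z) * 1 + norm (z - complex_of_real v)"
    using norm_triangle_ineq4[of "1 + z" "z - complex_of_real v"] by simp
  also have "\<dots> \<le> norm (1 + z) * (r / d) + r"
    using assms by (intro add_mono mult_left_mono) auto
  also have "\<dots> = (norm (1 + z) / d + 1) * r" by (simp add: algebra_simps)
  finally have "(1 + v)\<^sup>2 \<le> ((norm (1 + z) / d + 1) * r)\<^sup>2"
    using assms(4) by (intro power_mono) auto
  then have "(1 + v)\<^sup>2 \<le> (norm (1 + z) / d + 1)\<^sup>2 * r\<^sup>2" by (simp add: power_mult_distrib)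
  then show ?thesis using r assms(4) by (simp add: divide_simps)
qed

text \<open>The majorant \<open>r\<close> is free to exceed the distance from \<open>z\<close> to
  \<open>v\<close>: off the half-line it is that distance, and in a gap it is cut off below at the
  half-width of the gap.\<close>

lemma weight_by_distance:
  fixes z :: complex
  assumes [measurable]: "w \<in> borel_measurable borel" and "0 < d"
    and "\<And>v. v \<le> 0 \<Longrightarrow> w v = 0"
    and "\<And>v. 0 < v \<Longrightarrow> d \<le> r v \<and> norm (z - complex_of_real v) \<le> r v \<and> norm (w v) \<le> 1 / (r v)\<^sup>2"
  shows "weight w"
proof -
  let ?C = "(norm (1 + z) / d + 1)\<^sup>2"
  have "integrable lborel w"
  proof (rule Bochner_Integration.integrable_bound)
    show "integrable lborel (\<lambda>v. complex_of_real ?C * resolvent_weight v)"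
      using weightD(1)[OF resolvent_weight(1)] by (rule integrable_mult_right)
    show "AE v in lborel. norm (w v) \<le> norm (complex_of_real ?C * resolvent_weight v)"
    proof (intro AE_I2)
      fix v
      show "norm (w v) \<le> norm (complex_of_real ?C * resolvent_weight v)"
      proof (cases "0 < v")
        case True
        have "norm (w v) \<le> ?C * (1 / (1 + v)\<^sup>2)"
          using assms(4)[OF True] one_plus_le_distance[OF assms(2), of "r v" z v] True by linarith
        also have "\<dots> = norm (complex_of_real (?C * (1 / (1 + v)\<^sup>2)))"
          by (simp only: norm_of_real) (simp add: abs_of_nonneg)
        also have "complex_of_real (?C * (1 / (1 + v)\<^sup>2)) = complex_of_real ?C * resolvent_weight v"
          using True by (simp only: resolvent_weight_def of_real_mult if_True)
        finally show ?thesis .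
      qed (use assms(3) in simp)
    qed
  qed simp
  then show ?thesis using assms(3) by (simp add: weight_def)
qed

context ball_averages
begin

text \<open>The criterion of \<open>resolvent_setI\<close> reads on symbols
  \<open>1 / (z - u) + 1 / (1 + u) = (1 + z) / ((1 + u) (z - u))\<close>. Off \<open>{a..b}\<close>
  the weights, minus the derivatives of the symbols, agree pointwise; on \<open>{a..b}\<close> only
  their integrals have to agree.\<close>

lemma resolvent_off_spectrum:
  assumes w: "weight w" and p: "1 \<le> p" and a: "0 \<le> a"
    and off: "\<And>v. 0 < v \<Longrightarrow> v \<notin> {a..b} \<Longrightarrow> w v = - (1 / (z - complex_of_real v)\<^sup>2)"
    and tails: "\<And>u. 0 \<le> u \<Longrightarrow> u \<notin> {a<..<b} \<Longrightarrow> z \<noteq> complex_of_real u \<and> tail w u = 1 / (z - complex_of_real u)"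
    and const: "\<And>v f. v \<in> {a..b} \<Longrightarrow> E v f = E a f"
  shows "z \<in> Lp_resolvent_set M p (Lp_generator M p P)"
proof (rule resolvent_setI[OF w p])
  fix f assume f: "f \<in> Lp_space M p"
  note jw = resolvent_weight(1)
  let ?w1 = "\<lambda>v. w v + resolvent_weight v"
  let ?w2 = "\<lambda>v. (1 + z) * wprod resolvent_weight w v"
  have w1: "weight ?w1" by (intro weight_add w jw)
  have w2: "weight ?w2" by (intro weight_scale weight_wprod w jw)
  have nz: "1 + complex_of_real v \<noteq> 0" if "0 \<le> v" for v
  proof -
    have "complex_of_real (1 + v) \<noteq> 0" using that by (simp only: of_real_eq_0_iff)
    then show ?thesis by simp
  qed
  have tails_eq: "tail ?w1 u = tail ?w2 u" if u: "0 \<le> u" "u \<notin> {a<..<b}" for u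
  proof -
    have "tail ?w1 u = 1 / (z - complex_of_real u) + 1 / (1 + complex_of_real u)"
      using tails[OF u] resolvent_weight(2)[OF u(1)] by (simp add: tail_add[OF weightD(1)[OF w] weightD(1)[OF jw]])
    also have "\<dots> = (1 + z) * (1 / (1 + complex_of_real u) * (1 / (z - complex_of_real u)))"
      using tails[OF u] nz[OF u(1)] by (simp add: field_simps)
    also have "\<dots> = tail ?w2 u"
      using tails[OF u] resolvent_weight(2)[OF u(1)] by (simp add: tail_scale tail_wprod[OF jw w])
    finally show ?thesis .
  qed
  have "AE x in M. T ?w1 f x = T ?w2 f x"
  proof (rule T_eq_on_gap[OF w1 w2 f p _ _ const])
    fix v assume v: "v \<notin> {a..b}"
    show "?w1 v = ?w2 v"
    proof (cases "0 < v")
      case True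
      have t: "z \<noteq> complex_of_real v" "tail w v = 1 / (z - complex_of_real v)" using tails[of v] True v by auto
      define A B where "A = z - complex_of_real v" and "B = 1 + complex_of_real v"
      have AB: "A \<noteq> 0" "B \<noteq> 0" "1 + z = A + B" using t nz[of v] True by (auto simp: A_def B_def)
      have "resolvent_weight v = 1 / B\<^sup>2" "tail resolvent_weight v = 1 / B"
        using True resolvent_weight(2)[of v] by (simp_all add: resolvent_weight_def B_def)
      then have "?w1 v = - (1 / A\<^sup>2) + 1 / B\<^sup>2" "?w2 v = (A + B) * (1 / B\<^sup>2 * (1 / A) + - (1 / A\<^sup>2) * (1 / B))"
        using off[OF True v] t AB(3) by (simp_all add: wprod_def A_def)
      moreover have "- (1 / A\<^sup>2) + 1 / B\<^sup>2 = (A + B) * (1 / B\<^sup>2 * (1 / A) + - (1 / A\<^sup>2) * (1 / B))"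
        using AB(1,2) by (simp add: divide_simps power2_eq_square) (simp add: algebra_simps)
      ultimately show ?thesis by simp
    next
      case False
      then show ?thesis using weightD(2)[OF w1, of v] weightD(2)[OF w2, of v] by simp
    qed
  next
    \<comment> \<open>Both integrals are differences of tails at the ends of the interval, where the
      symbol is still \<open>1 / (z - u)\<close>.\<close>
    show "(LINT v:{a..b}|lborel. ?w1 v) = (LINT v:{a..b}|lborel. ?w2 v)"
    proof (cases "a \<le> b")
      case True
      then show ?thesis
        using tail_diff[OF w1 True] tail_diff[OF w2 True] tails_eq[of a] tails_eq[of b] a by simp
    qed (simp add: set_lebesgue_integral_def)
  qed
  then show "AE x in M. T w f x + T resolvent_weight f x = (1 + z) * T resolvent_weight (T w f) x"
    using T_weight_add[OF w jw f p] T_T[OF jw w f p]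
    by eventually_elim (simp add: T_weight_scale)
qed

lemma resolvent_off_halfline:
  assumes p: "1 \<le> p" and d: "0 < d" "\<And>v. 0 \<le> v \<Longrightarrow> d \<le> norm (z - complex_of_real v)"
  shows "z \<in> Lp_resolvent_set M p (Lp_generator M p P)"
proof -
  define w where "w v = (if 0 < v then - (1 / (z - complex_of_real v)\<^sup>2) else 0)" for v
  have nz: "z - complex_of_real v \<noteq> 0" if "0 \<le> v" for v using d(1) d(2)[OF that] by auto
  have w: "weight w"
  proof (rule weight_by_distance[where r="\<lambda>v. norm (z - complex_of_real v)" and z=z, OF _ d(1)])
    show "w \<in> borel_measurable borel" unfolding w_def[abs_def] by measurable
  qed (use d in \<open>auto simp: w_def norm_divide norm_power\<close>)
  have lim: "((\<lambda>v. 1 / (z - complex_of_real v)) \<longlongrightarrow> 0) at_top"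
  proof (rule Lim_null_comparison)
    show "\<forall>\<^sub>F v in at_top. norm (1 / (z - complex_of_real v)) \<le> 1 / (v - norm z)"
    proof (rule eventually_mono[OF eventually_gt_at_top[of "norm z"]])
      fix v assume v: "norm z < v"
      have "0 \<le> v" using v norm_ge_zero[of z] by linarith
      then have "v - norm z \<le> norm (z - complex_of_real v)"
        using norm_triangle_ineq2[of "complex_of_real v" z] by (simp add: norm_minus_commute)
      then show "norm (1 / (z - complex_of_real v)) \<le> 1 / (v - norm z)"
        using v by (simp add: norm_divide frac_le)
    qed
    show "((\<lambda>v. 1 / (v - norm z)) \<longlongrightarrow> 0) at_top" by real_asymp
  qed
  show ?thesis
  \<comment> \<open>The interval \<open>{1..0}\<close> is empty: there is no pole on the half-line
    and nothing to modify.\<close>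
  proof (rule resolvent_off_spectrum[OF w p, of 1 0])
    fix u :: real assume u: "0 \<le> u"
    have "tail w u = 1 / (z - complex_of_real u)"
    proof (rule tail_eq_antiderivative[OF w finite.emptyI _ _ lim])
      fix v assume "u < v"
      then have "z - complex_of_real v \<noteq> 0" using nz[of v] u by simp
      then have "((\<lambda>x. 1 / (z - x)) has_field_derivative 1 / (z - complex_of_real v)\<^sup>2) (at (complex_of_real v))"
        by (auto intro!: derivative_eq_intros simp: power2_eq_square)
      then have "((\<lambda>v. 1 / (z - complex_of_real v)) has_vector_derivative 1 / (z - complex_of_real v)\<^sup>2) (at v)"
        by (rule has_vector_derivative_real_field)
      then show "((\<lambda>v. 1 / (z - complex_of_real v)) has_vector_derivative - w v) (at v)"
        using \<open>u < v\<close> u by (simp add: w_def)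
    next
      show "continuous_on {u..} (\<lambda>v. 1 / (z - complex_of_real v))"
        using nz u by (intro continuous_intros) auto
    qed
    then show "z \<noteq> complex_of_real u \<and> tail w u = 1 / (z - complex_of_real u)"
      using nz[OF u] by simp
  qed (auto simp: w_def)
qed

text \<open>The weight \<open>- 1 / (z - v)\<^sup>2\<close> is not integrable at \<open>z\<close>.
  Since \<open>E\<close> is constant on the gap, the symbol may be replaced there by the chord from
  \<open>1 / d\<close> to \<open>- 1 / d\<close>, whose weight is \<open>1 / d\<^sup>2\<close>. The
  maximum in \<open>F\<close> writes both pieces as one formula that is evidently continuous, and
  \<open>d < z\<close> keeps the gap among positive values.\<close>

lemma resolvent_in_gap:
  assumes p: "1 \<le> p" and d: "0 < d" "d < z" and const: "\<And>v f. v \<in> {z - d..z + d} \<Longrightarrow> E v f = E (z - d) f"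
  shows "complex_of_real z \<in> Lp_resolvent_set M p (Lp_generator M p P)"
proof -
  define h where "h v = (if v \<in> {z - d..z + d} then 1 / d\<^sup>2 else - (1 / (z - v)\<^sup>2))" for v
  \<comment> \<open>\<open>1 / (z - v)\<close> off the gap, interpolated linearly across it\<close>
  define F where "F v = (z - v) / max (d\<^sup>2) ((z - v)\<^sup>2)" for v
  define w where "w v = complex_of_real (if 0 < v then h v else 0)" for v
  have sq: "d\<^sup>2 \<le> (z - v)\<^sup>2 \<longleftrightarrow> v \<notin> {z - d<..<z + d}" for v
    using d by (auto simp: abs_le_square_iff[symmetric] abs_if split: if_splits)
  have F_out: "F v = 1 / (z - v)" if "v \<notin> {z - d<..<z + d}" for v
    using sq[of v] that by (simp add: F_def max_def power2_eq_square)
  have F_in: "F v = (z - v) / d\<^sup>2" if "v \<in> {z - d..z + d}" for v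
  proof (cases "v \<in> {z - d<..<z + d}")
    case True
    then show ?thesis using sq[of v] by (simp add: F_def max_def)
  next
    case False
    then have "v = z - d \<or> v = z + d" using that by auto
    then show ?thesis by (auto simp: F_def)
  qed
  have w: "weight w"
  proof (rule weight_by_distance[where r="\<lambda>v. max d \<bar>z - v\<bar>" and z="complex_of_real z", OF _ d(1)])
    show "w \<in> borel_measurable borel" unfolding w_def[abs_def] h_def by measurable
    fix v :: real assume v: "0 < v"
    have "\<bar>h v\<bar> \<le> 1 / (max d \<bar>z - v\<bar>)\<^sup>2"
    proof (cases "v \<in> {z - d..z + d}")
      case True
      then have "max d \<bar>z - v\<bar> = d" by auto
      then show ?thesis using True by (simp add: h_def)
    next
      case False
      then have "max d \<bar>z - v\<bar> = \<bar>z - v\<bar>" by auto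
      moreover have "h v = - (1 / (z - v)\<^sup>2)" using False by (simp only: h_def if_False)
      ultimately show ?thesis by simp
    qed
    then have "norm (w v) \<le> 1 / (max d \<bar>z - v\<bar>)\<^sup>2" using v by (simp only: w_def if_True norm_of_real)
    then show "d \<le> max d \<bar>z - v\<bar> \<and> norm (complex_of_real z - complex_of_real v) \<le> max d \<bar>z - v\<bar> \<and>
        norm (w v) \<le> 1 / (max d \<bar>z - v\<bar>)\<^sup>2"
      by (simp add: norm_of_real del: of_real_diff flip: of_real_diff)
  qed (simp add: w_def)
  have F_deriv: "(F has_real_derivative - h v) (at v)" if v: "v \<notin> {z - d, z + d}" for v
  proof (cases "v \<in> {z - d<..<z + d}")
    case True
    have "((\<lambda>v. (z - v) / d\<^sup>2) has_real_derivative - h v) (at v)"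
      using True d by (auto intro!: derivative_eq_intros simp: h_def power2_eq_square)
    then show ?thesis
      by (rule has_field_derivative_transform_within_open[of _ _ _ "{z - d<..<z + d}"]) (use True F_in in auto)
  next
    case False
    then have "z - v \<noteq> 0" using d by auto
    then have "((\<lambda>v. 1 / (z - v)) has_real_derivative - h v) (at v)"
      using False v by (auto intro!: derivative_eq_intros simp: h_def power2_eq_square)
    then show ?thesis
      by (rule has_field_derivative_transform_within_open[of _ _ _ "- {z - d..z + d}"])
        (use False v F_out in auto)
  qed
  have maxpos: "0 < max (d\<^sup>2) ((z - v)\<^sup>2)" for v using d by (simp add: less_max_iff_disj)
  have F_cont: "continuous_on {u..} (\<lambda>v. complex_of_real (F v))" for u
    unfolding F_def by (intro continuous_intros ballI) (use maxpos in \<open>simp add: less_imp_neq[symmetric]\<close>)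
  have F_lim: "((\<lambda>v. complex_of_real (F v)) \<longlongrightarrow> 0) at_top"
  proof -
    have "((\<lambda>v. 1 / (z - v)) \<longlongrightarrow> 0) at_top" by real_asymp
    then have "(F \<longlongrightarrow> 0) at_top"
      by (rule Lim_transform_eventually)
        (intro eventually_mono[OF eventually_ge_at_top[of "z + d"]], simp add: F_out)
    from tendsto_of_real[OF this, where 'a = complex] show ?thesis by simp
  qed
  have tail_w: "tail w u = complex_of_real (F u)" if u: "0 \<le> u" for u
  proof (rule tail_eq_antiderivative[OF w _ _ F_cont F_lim])
    show "finite {z - d, z + d}" by simp
    fix v assume v: "u < v" "v \<notin> {z - d, z + d}"
    have "((\<lambda>v. complex_of_real (F v)) has_vector_derivative complex_of_real (- h v)) (at v)"
      by (rule has_vector_derivative_of_real[OF F_deriv[OF v(2)]])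
    then show "((\<lambda>v. complex_of_real (F v)) has_vector_derivative - w v) (at v)"
      using v u by (simp add: w_def)
  qed
  show ?thesis
  proof (rule resolvent_off_spectrum[OF w p, of "z - d" "z + d"])
    show "0 \<le> z - d" using d by simp
    fix v assume v: "0 < v" "v \<notin> {z - d..z + d}"
    then have "h v = - (1 / (z - v)\<^sup>2)" by (simp only: h_def if_False)
    then show "w v = - (1 / (complex_of_real z - complex_of_real v)\<^sup>2)"
      using v(1) by (simp add: w_def)
  next
    fix u assume u: "0 \<le> u" "u \<notin> {z - d<..<z + d}"
    then have "z \<noteq> u" using d by auto
    then show "complex_of_real z \<noteq> complex_of_real u \<and> tail w u = 1 / (complex_of_real z - complex_of_real u)"
      using tail_w[OF u(1)] F_out[OF u(2)] by simp
  qed (rule const)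
qed

end

section \<open>Parametrization of the radii by spectral values\<close>

locale isotropic =
  fixes M :: "'a::{metric_space, second_countable_topology} measure" and \<sigma> :: "ennreal \<Rightarrow> real"
  assumes ultra': "ultrametric TYPE('a)"
    and compact_cball': "\<And>(x :: 'a) r. compact (cball x r)"
    and radon': "radon_measure M" and support': "full_support M"
    and \<sigma>: "distance_distribution \<sigma>"
begin

lemma \<sigma>_mono: "strict_mono \<sigma>"
  and \<sigma>_left: "(\<sigma> \<longlongrightarrow> \<sigma> r) (at_left r)"
  and \<sigma>_zero: "(\<sigma> \<longlongrightarrow> 0) (at_right 0)"
  and \<sigma>_top: "\<sigma> top = 1"
  using \<sigma> by (auto simp: distance_distribution_def)

lemma \<sigma>_less: "x < y \<Longrightarrow> \<sigma> x < \<sigma> y"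
  using \<sigma>_mono by (rule strict_monoD)

lemma \<sigma>_pos: "0 < r \<Longrightarrow> 0 < \<sigma> r"
proof -
  assume "0 < r"
  moreover have "\<sigma> 0 \<in> {0..1}" using \<sigma> unfolding distance_distribution_def by blast
  ultimately show ?thesis using \<sigma>_less[of 0 r] by simp
qed

lemma \<sigma>_real_less_1: "\<sigma> (ennreal r) < 1"
  using \<sigma>_less[of "ennreal r" top] by (simp add: \<sigma>_top less_top)

text \<open>Left continuity at \<open>b\<close>. With \<open>b = top\<close> it provides finite
  radii at which \<open>\<sigma>\<close> comes close to 1, so that the infimum defining
  \<open>rad\<close> is over a nonempty set.\<close>

lemma \<sigma>_left_approx:
  assumes "s < \<sigma> b" "0 < b"
  obtains r where "0 \<le> r" "ennreal r < b" "s < \<sigma> (ennreal r)"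
proof -
  have "\<forall>\<^sub>F x in at_left b. s < \<sigma> x" using \<sigma>_left[of b] assms(1) by (rule order_tendstoD(1))
  then obtain c where c: "c < b" "\<And>x. c < x \<Longrightarrow> x < b \<Longrightarrow> s < \<sigma> x"
    using assms(2) by (auto simp: eventually_at_left)
  then obtain x where x: "c < x" "x < b" using dense by blast
  then have "x < \<infinity>" by (metis infinity_ennreal_def less_top order_less_trans top.extremum_strict)
  then have "ennreal (enn2real x) = x" by (simp add: less_top)
  then show ?thesis using that[of "enn2real x"] c(2)[OF x] x by simp
qed

text \<open>The value for \<open>v \<le> 0\<close> is arbitrary; it only keeps all radii positive.\<close>

definition rad :: "real \<Rightarrow> real" where
  "rad v = (if v \<le> 0 then 1 else Inf {r. 0 \<le> r \<and> exp (- v) < \<sigma> (ennreal r)})"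

text \<open>Left continuity of \<open>\<sigma>\<close> makes both inequalities strict. This
  equivalence characterizes \<open>rad\<close> as a generalized inverse and is the source of its
  monotonicity, limit and measurability.\<close>

lemma rad_less_iff:
  assumes v: "0 < v" and b: "0 < b"
  shows "rad v < b \<longleftrightarrow> exp (- v) < \<sigma> (ennreal b)"
proof -
  let ?S = "{r. 0 \<le> r \<and> exp (- v) < \<sigma> (ennreal r)}"
  have bdd: "bdd_below ?S" by (intro bdd_belowI[of _ 0]) auto
  have ne: "?S \<noteq> {}"
    using \<sigma>_left_approx[of "exp (- v)" top] v by (auto simp: \<sigma>_top)
  have rad: "rad v = Inf ?S" using v by (simp add: rad_def)
  show ?thesis
  proof
    assume "rad v < b"
    then obtain r where "r \<in> ?S" "r < b" unfolding rad using cInf_lessD[OF ne] by blast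
    then show "exp (- v) < \<sigma> (ennreal b)"
      using \<sigma>_less[of "ennreal r" "ennreal b"] by (simp add: ennreal_less_iff)
  next
    assume "exp (- v) < \<sigma> (ennreal b)"
    then obtain r where r: "0 \<le> r" "ennreal r < ennreal b" "exp (- v) < \<sigma> (ennreal r)"
      using \<sigma>_left_approx[of "exp (- v)" "ennreal b"] b by (auto simp: ennreal_less_zero_iff)
    then have "Inf ?S \<le> r" by (intro cInf_lower bdd) auto
    also have "r < b" using r by (simp add: ennreal_less_iff)
    finally show "rad v < b" unfolding rad .
  qed
qed

lemma rad_pos: "0 < rad v"
proof (cases "0 < v")
  case True
  have "\<forall>\<^sub>F x in at_right 0. \<sigma> x < exp (- v)" using \<sigma>_zero by (rule order_tendstoD(2)) simp
  then obtain c where c: "0 < c" "\<And>x. 0 < x \<Longrightarrow> x < c \<Longrightarrow> \<sigma> x < exp (- v)"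
    using eventually_at_right[of "0::ennreal" top] by auto
  obtain x where x: "0 < x" "x < c" using dense[OF c(1)] by blast
  then have xt: "x < top" by (metis less_top order_less_trans top.extremum_strict)
  define r where "r = enn2real x"
  have r: "0 < r" "ennreal r = x" using x xt by (simp_all add: r_def enn2real_positive_iff less_top)
  have "\<not> rad v < r" using rad_less_iff[OF True r(1)] c(2)[OF x] r(2) by simp
  then show ?thesis using r(1) by linarith
qed (simp add: rad_def)

lemma rad_antimono:
  assumes "0 < v" "v \<le> v'"
  shows "rad v' \<le> rad v"
proof (rule ccontr)
  assume "\<not> rad v' \<le> rad v"
  then have "exp (- v) < \<sigma> (ennreal (rad v'))" using rad_less_iff[OF assms(1) rad_pos[of v']] by simp
  then have "exp (- v') < \<sigma> (ennreal (rad v'))" using assms by (smt (verit) exp_le_cancel_iff)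
  then show False using rad_less_iff[OF _ rad_pos, of v' v'] assms by simp
qed

lemma rad_limit:
  assumes "0 < r"
  shows "\<exists>V. \<forall>v\<ge>V. rad v \<le> r"
proof (intro exI allI impI)
  fix v assume v: "max 1 (1 - ln (\<sigma> (ennreal r))) \<le> v"
  have s: "0 < \<sigma> (ennreal r)" using assms by (intro \<sigma>_pos) simp
  have "- v < ln (\<sigma> (ennreal r))" using v by linarith
  then have "exp (- v) < \<sigma> (ennreal r)" using s by (metis exp_less_mono exp_ln)
  then show "rad v \<le> r" using rad_less_iff[of v r] v assms by simp
qed

lemma rad_measurable: "rad \<in> borel_measurable borel"
proof (rule borel_measurableI_less)
  fix b :: real
  have "{v \<in> space borel. rad v < b} = {v. (v \<le> 0 \<and> 1 < b) \<or> (0 < v \<and> 0 < b \<and> exp (- v) < \<sigma> (ennreal b))}"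
  proof -
    have "rad v < b \<longleftrightarrow> (v \<le> 0 \<and> 1 < b) \<or> (0 < v \<and> 0 < b \<and> exp (- v) < \<sigma> (ennreal b))" for v
    proof (cases "0 < v")
      case True
      then show ?thesis using rad_less_iff[OF True, of b] rad_pos[of v] by auto
    qed (simp add: rad_def)
    then show ?thesis by simp
  qed
  also have "\<dots> \<in> sets borel" by measurable
  finally show "{v \<in> space borel. rad v < b} \<in> sets borel" .
qed

sublocale ball_averages M rad
  using ultra' compact_cball' radon' support' rad_pos rad_measurable rad_antimono rad_limit
  by unfold_locales

text \<open>The exponential distribution \<open>exp (- v) dv\<close> on the positive half-line,
  whose image under \<open>rad\<close> turns out to be \<open>d\<sigma>\<close>.\<close>

definition N :: "real measure" where
  "N = density lborel (\<lambda>v. norm (semigroup_weight 1 v))"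

lemma measure_N_tail:
  assumes "0 \<le> u"
  shows "measure N {u<..} = exp (- u)"
proof -
  note w = semigroup_weight(1)[OF zero_less_one]
  note [measurable] = weightD(3)[OF w]
  interpret finite_measure N unfolding N_def by (rule finite_measure_density_norm(1)[OF weightD(1)[OF w]])
  have "complex_of_real (measure N {u<..}) = complex_of_real (LINT v|N. indicator {u<..} v)"
    by (simp add: N_def)
  also have "(LINT v|N. indicator {u<..} v :: real) = (LINT v|lborel. norm (semigroup_weight 1 v) *\<^sub>R indicator {u<..} v)"
    unfolding N_def by (rule integral_density) auto
  also have "complex_of_real \<dots> = (LINT v|lborel. indicator {u<..} v *\<^sub>R semigroup_weight 1 v)"
    unfolding integral_complex_of_real[symmetric]
    by (intro Bochner_Integration.integral_cong) (auto simp: indicator_def semigroup_weight_def norm_mult)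
  also have "\<dots> = complex_of_real (exp (- u))"
    using semigroup_weight(2)[OF zero_less_one assms] by (simp add: tail_def set_lebesgue_integral_def)
  finally show ?thesis by (simp only: of_real_eq_iff)
qed

lemma real_distribution_rad: "real_distribution (distr N borel rad)"
proof -
  note w = semigroup_weight(1)[OF zero_less_one]
  interpret N: finite_measure N unfolding N_def by (rule finite_measure_density_norm(1)[OF weightD(1)[OF w]])
  have "measure N (space N) = 1"
    using finite_measure_density_norm(2)[OF weightD(1)[OF w]] norm_semigroup_weight[OF zero_less_one]
    by (simp add: N_def)
  then have "prob_space N" by (intro prob_spaceI) (simp add: N.emeasure_eq_measure)
  then interpret prob_space N .
  have "rad \<in> borel_measurable N" using rad_measurable by (simp add: N_def)
  then show ?thesis by (rule real_distribution_distr)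
qed

text \<open>Open half-lines are exact: \<open>rad v < b\<close> means
  \<open>v > - ln (\<sigma> b)\<close>, an event of \<open>N\<close>-mass \<open>\<sigma> b\<close>.
  For closed ones, \<open>\<sigma>\<close> just to the right of \<open>r\<close> is squeezed between
  two values of the distribution function, which is right continuous; this produces the right limit
  in \<open>stieltjes_measure\<close>.\<close>

lemma cdf_rad:
  "cdf (distr N borel rad) r = (if r < 0 then 0 else Lim (at_right (ennreal r)) \<sigma>)"
proof -
  let ?D = "distr N borel rad"
  interpret D: real_distribution ?D by (rule real_distribution_rad)
  have radN [measurable]: "rad \<in> borel_measurable N" using rad_measurable by (simp add: N_def)
  have [simp]: "space N = UNIV" "sets N = sets borel" by (simp_all add: N_def)
  have AE_pos: "AE v in N. 0 < v"
    unfolding N_def by (subst AE_density) (auto simp: semigroup_weight_def weightD(3)[OF semigroup_weight(1)[OF zero_less_one]])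
  have less: "measure ?D {..<b} = \<sigma> (ennreal b)" if b: "0 < b" for b
  proof -
    have s: "0 < \<sigma> (ennreal b)" "\<sigma> (ennreal b) < 1" using b \<sigma>_pos \<sigma>_real_less_1 by simp_all
    let ?u = "- ln (\<sigma> (ennreal b))"
    have u: "0 < ?u" using s by simp
    have "measure ?D {..<b} = measure N (rad -` {..<b})" by (subst measure_distr) auto
    also have "\<dots> = measure N {?u<..}"
    proof (rule measure_eq_AE)
      show "AE v in N. v \<in> rad -` {..<b} \<longleftrightarrow> v \<in> {?u<..}"
        using AE_pos
      proof eventually_elim
        case (elim v)
        have "exp (- v) < \<sigma> (ennreal b) \<longleftrightarrow> - v < ln (\<sigma> (ennreal b))"
          using s(1) by (metis exp_less_cancel_iff exp_ln)
        then show ?case using rad_less_iff[OF elim b] by auto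
      qed
      show "rad -` {..<b} \<in> sets N" using measurable_sets[OF radN, of "{..<b}"] by simp
    qed simp
    also have "\<dots> = \<sigma> (ennreal b)" using measure_N_tail[of ?u] u s(1) by simp
    finally show ?thesis .
  qed
  show ?thesis
  proof (cases "r < 0")
    case True
    have "\<not> rad v \<le> r" for v using rad_pos[of v] True by linarith
    then have "rad -` {..r} = {}" by auto
    then have "cdf ?D r = 0" by (simp add: cdf_def measure_distr)
    then show ?thesis using True by simp
  next
    case False
    have "(\<sigma> \<longlongrightarrow> cdf ?D r) (at_right (ennreal r))"
    proof (rule tendsto_sandwich)
      have fin: "\<forall>\<^sub>F x in at_right (ennreal r). ennreal r < x \<and> x < top"
        by (auto simp: eventually_at_right[of "ennreal r" top] less_top intro!: exI[of _ top])
      have bounds: "cdf ?D r \<le> \<sigma> x \<and> \<sigma> x \<le> cdf ?D (enn2real x)" if "ennreal r < x" "x < top" for x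
      proof -
        define b where "b = enn2real x"
        have x: "x = ennreal b" "0 \<le> b" using that by (simp_all add: b_def less_top)
        have b: "r < b" using that(1) False x by (simp add: ennreal_less_iff)
        have "cdf ?D r \<le> measure ?D {..<b}"
          unfolding cdf_def using b by (intro D.finite_measure_mono) auto
        moreover have "measure ?D {..<b} \<le> cdf ?D b"
          unfolding cdf_def by (intro D.finite_measure_mono) auto
        ultimately show ?thesis using less[of b] b False by (simp add: x b_def[symmetric])
      qed
      show "\<forall>\<^sub>F x in at_right (ennreal r). cdf ?D r \<le> \<sigma> x"
        using fin by eventually_elim (use bounds in blast)
      show "\<forall>\<^sub>F x in at_right (ennreal r). \<sigma> x \<le> cdf ?D (enn2real x)"
        using fin by eventually_elim (use bounds in blast)
      have "filterlim enn2real (at_right r) (at_right (ennreal r))"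
        unfolding filterlim_at
      proof
        show "\<forall>\<^sub>F x in at_right (ennreal r). enn2real x \<in> {r<..} \<and> enn2real x \<noteq> r"
          using fin
        proof eventually_elim
          case (elim x)
          then have "ennreal r < ennreal (enn2real x)" by (simp add: less_top)
          then show ?case using False by (simp add: ennreal_less_iff)
        qed
        have "(enn2real \<longlongrightarrow> enn2real (ennreal r)) (at_right (ennreal r))"
          by (intro tendsto_enn2real tendsto_ident_at) auto
        then show "(enn2real \<longlongrightarrow> r) (at_right (ennreal r))" using False by simp
      qed
      moreover have "(cdf ?D \<longlongrightarrow> cdf ?D r) (at_right r)"
        using D.cdf_is_right_cont[of r] by (simp add: continuous_within)
      ultimately show "((\<lambda>x. cdf ?D (enn2real x)) \<longlongrightarrow> cdf ?D r) (at_right (ennreal r))"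
        by (rule filterlim_compose[rotated])
    qed simp
    moreover have "at_right (ennreal r) \<noteq> bot"
    proof
      assume "at_right (ennreal r) = bot"
      then have "\<forall>\<^sub>F x in at_right (ennreal r). False" by simp
      then obtain c where "ennreal r < c" "\<And>x. ennreal r < x \<Longrightarrow> \<not> x < c"
        by (auto simp: eventually_at_right[of "ennreal r" top] less_top)
      then show False using dense by blast
    qed
    ultimately show ?thesis using False tendsto_Lim by (simp add: tendsto_Lim)
  qed
qed

lemma stieltjes_measure_eq: "stieltjes_measure \<sigma> = distr N borel rad"
proof -
  let ?D = "distr N borel rad"
  interpret D: real_distribution ?D by (rule real_distribution_rad)
  have "real_distribution (interval_measure (cdf ?D))"
    by (intro real_distribution_interval_measure D.cdf_nondecreasing D.cdf_is_right_cont
        D.cdf_lim_at_bot D.cdf_lim_at_top_prob)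
  moreover have "cdf (interval_measure (cdf ?D)) = cdf ?D"
    by (intro cdf_interval_measure D.cdf_nondecreasing D.cdf_is_right_cont D.cdf_lim_at_bot)
  ultimately have "interval_measure (cdf ?D) = ?D"
    using cdf_unique real_distribution_rad by blast
  moreover have "cdf ?D = (\<lambda>r. if r < 0 then 0 else Lim (at_right (ennreal r)) \<sigma>)"
    by (rule ext) (rule cdf_rad)
  ultimately show ?thesis by (simp add: stieltjes_measure_def)
qed

lemma isotropic_markov_operator_eq:
  assumes [measurable]: "f \<in> borel_measurable M"
  shows "isotropic_markov_operator M \<sigma> f = T (semigroup_weight 1) f"
proof
  fix x
  note w = semigroup_weight(1)[OF zero_less_one]
  note [measurable] = weightD(3)[OF w]
  \<comment> \<open>Changing variables under \<open>rad\<close> needs measurability of ball averages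
    in an arbitrary real radius, not just along \<open>rad\<close>.\<close>
  have "mono (\<lambda>r. measure M (cball x r))"
    using emeasure_cball_finite
    by (intro monoI measure_mono_fmeasurable) (auto simp: fmeasurable_def)
  then have [measurable]: "(\<lambda>r. measure M (cball x r)) \<in> borel_measurable borel"
    by (rule borel_measurable_mono)
  have "(LINT y:cball x r|M. f y) = (LINT y|M. (if dist x y \<le> r then f y else 0))" for r
    unfolding set_lebesgue_integral_def
    by (intro Bochner_Integration.integral_cong) (auto simp: indicator_def)
  moreover have "(\<lambda>r. LINT y|M. (if dist x y \<le> r then f y else 0)) \<in> borel_measurable borel"
    by measurable
  ultimately have [measurable]: "(\<lambda>r. LINT y:cball x r|M. f y) \<in> borel_measurable borel" by simp
  have meas: "(\<lambda>r. indicator {0..} r *\<^sub>R ball_average M r f x) \<in> borel_measurable borel"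
    unfolding ball_average_def by measurable
  have "isotropic_markov_operator M \<sigma> f x = (LINT v|N. indicator {0..} (rad v) *\<^sub>R E v f x)"
    unfolding isotropic_markov_operator_def set_lebesgue_integral_def stieltjes_measure_eq
    by (rule integral_distr[OF _ meas]) (use rad_measurable in \<open>simp add: N_def\<close>)
  also have "\<dots> = (LINT v|N. E v f x)"
    using rad_pos by (simp add: less_imp_le)
  also have "\<dots> = (LINT v|lborel. norm (semigroup_weight 1 v) *\<^sub>R E v f x)"
    unfolding N_def by (rule integral_density) auto
  also have "\<dots> = T (semigroup_weight 1) f x"
    unfolding T_def
    by (intro Bochner_Integration.integral_cong) (auto simp: semigroup_weight_def scaleR_conv_of_real norm_mult)
  finally show "isotropic_markov_operator M \<sigma> f x = T (semigroup_weight 1) f x" .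
qed

end

section \<open>Eigenfunctions and the spectrum\<close>

text \<open>\<open>is_functional_calculus\<close> constrains an operator only through convergent
  polynomial sequences, so uniqueness needs a concrete one.\<close>

definition bernstein_poly :: "(real \<Rightarrow> real) \<Rightarrow> nat \<Rightarrow> real poly" where
  "bernstein_poly f n =
     (\<Sum>k\<le>n. smult (f (k / n) * of_nat (n choose k)) (monom 1 k * [:1, -1:] ^ (n - k)))"

lemma bernstein_poly_limit:
  assumes "continuous_on {0..1} f"
  shows "uniform_limit {0..1} (\<lambda>n. poly (bernstein_poly f n)) f sequentially"
proof (rule uniform_limitI)
  fix e :: real assume "0 < e"
  then obtain n0 where n0: "\<And>n x. n0 \<le> n \<Longrightarrow> x \<in> {0..1} \<Longrightarrow> \<bar>f x - (\<Sum>k\<le>n. f (k / n) * Bernstein n k x)\<bar> < e"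
    using Bernstein_Weierstrass[OF assms] by blast
  have "poly (bernstein_poly f n) x = (\<Sum>k\<le>n. f (k / n) * Bernstein n k x)" for n x
    unfolding bernstein_poly_def Bernstein_def poly_sum
    by (intro sum.cong refl) (simp add: poly_monom mult.assoc)
  then show "\<forall>\<^sub>F n in sequentially. \<forall>x\<in>{0..1}. dist (poly (bernstein_poly f n) x) (f x) < e"
    using n0 by (intro eventually_sequentiallyI[of n0]) (auto simp: dist_real_def abs_minus_commute)
qed

lemma functional_calculus_unique:
  assumes S: "is_functional_calculus M A \<phi> S" and T: "is_functional_calculus M A \<phi> T"
    and cont: "continuous_on {0..1} \<phi>" and f: "f \<in> Lp_space M 2"
    and poly: "\<And>q. poly_operator q A f \<in> Lp_space M 2"
  shows "AE x in M. S f x = T f x"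
proof -
  let ?q = "bernstein_poly \<phi>"
  have lim: "(\<lambda>n. Lp_norm M 2 (\<lambda>x. poly_operator (?q n) A f x - R f x)) \<longlonglongrightarrow> 0"
    if R: "is_functional_calculus M A \<phi> R" for R
  proof (rule tendstoI)
    fix e :: real assume e: "0 < e"
    define d where "d = e / (1 + Lp_norm M 2 f)"
    have F: "0 \<le> Lp_norm M 2 f" by (rule Lp_norm_nonneg)
    have d: "0 < d" using e F by (simp add: d_def)
    have "d * Lp_norm M 2 f < d * (1 + Lp_norm M 2 f)" using d by simp
    also have "\<dots> = e" using F by (simp add: d_def)
    finally have de: "d * Lp_norm M 2 f < e" .
    have "\<forall>\<^sub>F n in sequentially. \<forall>f\<in>Lp_space M 2. Lp_norm M 2 (\<lambda>x. poly_operator (?q n) A f x - R f x) \<le> d * Lp_norm M 2 f"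
      using R d bernstein_poly_limit[OF cont] unfolding is_functional_calculus_def by blast
    then show "\<forall>\<^sub>F n in sequentially. dist (Lp_norm M 2 (\<lambda>x. poly_operator (?q n) A f x - R f x)) 0 < e"
    proof eventually_elim
      case (elim n)
      then have "Lp_norm M 2 (\<lambda>x. poly_operator (?q n) A f x - R f x) \<le> d * Lp_norm M 2 f" using f by blast
      then show ?case using de by (simp add: Lp_norm_nonneg)
    qed
  qed
  show ?thesis
  proof (rule Lp_limit_unique[OF poly _ _ _ _ lim[OF S] lim[OF T]])
    show "S f \<in> Lp_space M 2" "T f \<in> Lp_space M 2"
      using S T f unfolding is_functional_calculus_def Lp_bounded_linear_def by blast+
  qed simp_all
qed

context ball_averages
begin

lemma poly_operator_Lp:
  assumes A: "\<And>f. f \<in> Lp_space M 2 \<Longrightarrow> A f = T (semigroup_weight 1) f" and f: "f \<in> Lp_space M 2"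
  shows "poly_operator q A f \<in> Lp_space M 2"
  unfolding poly_operator_def[abs_def]
  by (intro Lp_space_sum Lp_space_scale conjunct1[OF power_eq_P[OF A f]]) simp_all

text \<open>Two contraction semigroups that agree on the truncations of \<open>f\<close> agree on
  \<open>f\<close>, because the truncations lie in \<open>L^2 \<inter> L^p\<close> and converge to
  \<open>f\<close> in \<open>L^p\<close>.\<close>

lemma extension_unique:
  assumes S: "Lp_contraction_semigroup M p S" and p: "1 \<le> p" and t: "0 \<le> t"
    and eq: "\<And>f. f \<in> Lp_space M 2 \<Longrightarrow> f \<in> Lp_space M p \<Longrightarrow> AE x in M. S t f x = P t f x"
    and f: "f \<in> Lp_space M p"
  shows "AE x in M. S t f x = P t f x"
proof -
  have contraction: "Lp_norm M p (\<lambda>x. R t (truncate n f) x - R t f x) \<le> Lp_norm M p (\<lambda>x. truncate n f x - f x)"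
    if R: "Lp_contraction_semigroup M p R" for R n
  proof -
    have tr: "truncate n f \<in> Lp_space M p" using truncate_Lp[OF f] p by simp
    note d = Lp_space_scale[OF f, of "-1"]
    have Lin: "Lp_bounded_linear M p (R t)" using R t unfolding Lp_contraction_semigroup_def by blast
    have add: "AE x in M. R t (\<lambda>y. g y + h y) x = R t g x + R t h x"
      if "g \<in> Lp_space M p" "h \<in> Lp_space M p" for g h
      using Lin that unfolding Lp_bounded_linear_def by blast
    have scale: "AE x in M. R t (\<lambda>y. c * g y) x = c * R t g x" if "g \<in> Lp_space M p" for c g
      using Lin that unfolding Lp_bounded_linear_def by blast
    have RL: "R t g \<in> Lp_space M p" if "g \<in> Lp_space M p" for g
      using Lin that unfolding Lp_bounded_linear_def by blast
    have "AE x in M. R t (\<lambda>x. truncate n f x + (- 1) * f x) x = R t (truncate n f) x + R t (\<lambda>x. (- 1) * f x) x"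
      by (rule add[OF tr d])
    moreover have "AE x in M. R t (\<lambda>x. (- 1) * f x) x = (- 1) * R t f x"
      by (rule scale[OF f])
    ultimately have "AE x in M. R t (truncate n f) x - R t f x = R t (\<lambda>x. truncate n f x + (- 1) * f x) x"
      by eventually_elim simp
    moreover have L: "(\<lambda>x. truncate n f x + (- 1) * f x) \<in> Lp_space M p" using p by (intro Lp_space_add tr d) simp
    ultimately have "Lp_norm M p (\<lambda>x. R t (truncate n f) x - R t f x) = Lp_norm M p (R t (\<lambda>x. truncate n f x + (- 1) * f x))"
      using Lp_spaceD(1)[OF Lp_space_diff[OF RL[OF tr] RL[OF f]]] Lp_spaceD(1)[OF RL[OF L]] p
      by (intro Lp_norm_cong) auto
    also have "\<dots> \<le> Lp_norm M p (\<lambda>x. truncate n f x + (- 1) * f x)"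
      using R t L unfolding Lp_contraction_semigroup_def by blast
    finally show ?thesis by simp
  qed
  have RL: "R t g \<in> Lp_space M p" if "Lp_contraction_semigroup M p R" "g \<in> Lp_space M p" for R g
    using that t unfolding Lp_contraction_semigroup_def Lp_bounded_linear_def by blast
  have lim: "(\<lambda>n. Lp_norm M p (\<lambda>x. R t (truncate n f) x - R t f x)) \<longlonglongrightarrow> 0"
    if R: "Lp_contraction_semigroup M p R" for R
    using p by (intro Lim_null_comparison[OF _ truncate_tendsto[OF f]])
      (auto simp: Lp_norm_nonneg contraction[OF R])
  note SP = S Lp_contraction_semigroup_P[OF p]
  have tr: "truncate n f \<in> Lp_space M q" if "1 \<le> q" for n q using truncate_Lp[OF f, of q n] p that by simp
  have same: "Lp_norm M p (\<lambda>x. S t (truncate n f) x - S t f x) = Lp_norm M p (\<lambda>x. P t (truncate n f) x - S t f x)" for n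
  proof (rule Lp_norm_cong)
    show "AE x in M. S t (truncate n f) x - S t f x = P t (truncate n f) x - S t f x"
      using eq[OF tr tr[OF p], of n] by (auto elim!: eventually_mono)
    show "(\<lambda>x. S t (truncate n f) x - S t f x) \<in> borel_measurable M"
      using p by (intro Lp_spaceD(1)[OF Lp_space_diff[OF RL[OF SP(1) tr[OF p]] RL[OF SP(1) f]]]) simp
    show "(\<lambda>x. P t (truncate n f) x - S t f x) \<in> borel_measurable M"
      using p by (intro Lp_spaceD(1)[OF Lp_space_diff[OF RL[OF SP(2) tr[OF p]] RL[OF SP(1) f]]]) simp
  qed
  show ?thesis
  proof (rule Lp_limit_unique[where F="\<lambda>n. P t (truncate n f)", OF _ _ _ p])
    show "(\<lambda>n. Lp_norm M p (\<lambda>x. P t (truncate n f) x - S t f x)) \<longlonglongrightarrow> 0"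
      using lim[OF SP(1)] unfolding same .
    show "(\<lambda>n. Lp_norm M p (\<lambda>x. P t (truncate n f) x - P t f x)) \<longlonglongrightarrow> 0"
      by (rule lim[OF SP(2)])
  qed (use RL SP tr p f in auto)
qed

end

context isotropic
begin

text \<open>\<open>P t\<close> shows that the choice in \<open>isotropic_semigroup\<close> has a
  witness, and uniqueness of the functional calculus makes the chosen operator agree with it almost
  everywhere.\<close>

lemma isotropic_semigroup_eq:
  assumes t: "0 \<le> t" and f: "f \<in> Lp_space M 2"
  shows "AE x in M. isotropic_semigroup M \<sigma> t f x = P t f x"
proof -
  have A: "isotropic_markov_operator M \<sigma> f = T (semigroup_weight 1) f" if "f \<in> Lp_space M 2" for f
    using that by (intro isotropic_markov_operator_eq Lp_spaceD(1))
  let ?\<phi> = "\<lambda>s::real. if t = 0 then 1 else s powr t"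
  have P: "is_functional_calculus M (isotropic_markov_operator M \<sigma>) ?\<phi> (P t)"
    using A t by (rule functional_calculus_P)
  then have S: "is_functional_calculus M (isotropic_markov_operator M \<sigma>) ?\<phi> (isotropic_semigroup M \<sigma> t)"
    unfolding isotropic_semigroup_def
    by (rule someI[where P="is_functional_calculus M (isotropic_markov_operator M \<sigma>) ?\<phi>"])
  have "continuous_on {0..1} ?\<phi>"
    using t by (cases "t = 0") (auto intro!: continuous_on_powr')
  then show ?thesis
    by (rule functional_calculus_unique[OF S P _ f poly_operator_Lp[OF A f]])
qed

lemma isotropic_generator_eq:
  assumes p: "1 \<le> p"
  shows "isotropic_generator M \<sigma> p = Lp_generator M p P"
proof -
  let ?Q = "\<lambda>S. Lp_contraction_semigroup M p S \<and> (\<forall>t\<ge>0. \<forall>f\<in>Lp_space M 2 \<inter> Lp_space M p.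
           AE x in M. S t f x = isotropic_semigroup M \<sigma> t f x)"
  let ?S = "isotropic_semigroup_Lp M \<sigma> p"
  have "AE x in M. P t f x = isotropic_semigroup M \<sigma> t f x" if "0 \<le> t" "f \<in> Lp_space M 2" for t f
    using isotropic_semigroup_eq[OF that] by (auto elim!: eventually_mono)
  then have "?Q P" using Lp_contraction_semigroup_P[OF p] by blast
  then have "?Q (SOME S. ?Q S)" by (rule someI[where P="?Q"])
  then have S: "?Q ?S" unfolding isotropic_semigroup_Lp_def .
  show ?thesis
    unfolding isotropic_generator_def
  proof (rule Lp_generator_cong[OF _ p])
    fix t :: real and f assume t: "0 < t" and f: "f \<in> Lp_space M p"
    have "?S t f \<in> Lp_space M p"
      using S t f unfolding Lp_contraction_semigroup_def Lp_bounded_linear_def by (meson less_imp_le)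
    moreover have "AE x in M. ?S t g x = P t g x" if g: "g \<in> Lp_space M 2" "g \<in> Lp_space M p" for g
    proof -
      have "AE x in M. ?S t g x = isotropic_semigroup M \<sigma> t g x" using S t g by (meson IntI less_imp_le)
      then show ?thesis using isotropic_semigroup_eq[OF less_imp_le[OF t] g(1)] by eventually_elim simp
    qed
    then have "AE x in M. ?S t f x = P t f x"
      using extension_unique[of p ?S t f] S p t f by simp
    ultimately show "?S t f \<in> Lp_space M p \<and> (AE x in M. ?S t f x = P t f x)" by blast
  qed
qed

text \<open>The value 0 is added because it is an eigenvalue, with constant eigenfunctions, if all
  distances are bounded, and otherwise a limit of the other values, as \<open>\<sigma>\<close> tends
  to 1 at infinity.\<close>

definition eigenvalues :: "real set" where
  "eigenvalues = insert 0 {- ln (\<sigma> (ennreal (dist x y))) | x y :: 'a. x \<noteq> y}"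

lemma eigenvalueI: "x \<noteq> y \<Longrightarrow> - ln (\<sigma> (ennreal (dist x (y :: 'a)))) \<in> eigenvalues"
  unfolding eigenvalues_def by blast

lemma eigenvalue_less_iff:
  assumes "0 < D" "0 < v"
  shows "- ln (\<sigma> (ennreal D)) < v \<longleftrightarrow> rad v < D"
proof -
  have s: "0 < \<sigma> (ennreal D)" using assms(1) by (intro \<sigma>_pos) simp
  have "exp (- v) < \<sigma> (ennreal D) \<longleftrightarrow> - v < ln (\<sigma> (ennreal D))"
    using s by (metis exp_less_cancel_iff exp_ln)
  then show ?thesis using rad_less_iff[OF assms(2,1)] by linarith
qed

lemma eigenvalues_nonneg: "l \<in> eigenvalues \<Longrightarrow> 0 \<le> l"
  using \<sigma>_pos \<sigma>_real_less_1 by (auto simp: eigenvalues_def less_imp_le)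

text \<open>The balls of radius \<open>rad v\<close> and \<open>rad a\<close> differ only by points
  at a distance in between, and such a distance would have its value in the interval from
  \<open>a\<close> to \<open>v\<close>.\<close>

lemma E_const_on_gap:
  assumes a: "0 < a" and gap: "{a..b} \<inter> eigenvalues = {}" and v: "v \<in> {a..b}"
  shows "E v f = E a f"
proof
  fix x :: 'a
  have "cball x (rad a) \<subseteq> cball x (rad v)"
  proof
    fix y assume y: "y \<in> cball x (rad a)"
    show "y \<in> cball x (rad v)"
    proof (rule ccontr)
      assume "y \<notin> cball x (rad v)"
      then have D: "rad v < dist x y" "dist x y \<le> rad a" using y by auto
      then have pos: "0 < dist x y" using rad_pos[of v] by linarith
      have "- ln (\<sigma> (ennreal (dist x y))) < v" "\<not> - ln (\<sigma> (ennreal (dist x y))) < a"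
        using eigenvalue_less_iff[OF pos] D a v by auto
      then have "- ln (\<sigma> (ennreal (dist x y))) \<in> {a..b}" using v by auto
      moreover have "- ln (\<sigma> (ennreal (dist x y))) \<in> eigenvalues"
        using pos eigenvalueI[of x y] by auto
      ultimately show False using gap by blast
    qed
  qed
  moreover have "cball x (rad v) \<subseteq> cball x (rad a)" using a v by (intro cball_mono_\<rho>) auto
  ultimately have "cball x (rad v) = cball x (rad a)" by blast
  then show "E v f x = E a f x" by (simp add: ball_average_def)
qed

text \<open>The function has integral zero, vanishes outside the closed ball and is constant on open
  balls of radius \<open>D\<close>. Averages over radii below \<open>D\<close> therefore fix it. A
  ball of radius at least \<open>D\<close> contains the whole closed ball or misses it, so its
  average is zero.\<close>

lemma eigenfunction:
  assumes p: "1 \<le> p" and ne: "x0 \<noteq> (y0::'a)"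
  obtains f where "Lp_norm M p f \<noteq> 0"
    "(f, \<lambda>x. complex_of_real (- ln (\<sigma> (ennreal (dist x0 y0)))) * f x) \<in> Lp_generator M p P"
proof -
  define D where "D = dist x0 y0"
  have D: "0 < D" using ne by (simp add: D_def)
  let ?B = "cball x0 D" and ?B' = "ball x0 D"
  let ?m = "measure M ?B" and ?m' = "measure M ?B'"
  have sets [measurable]: "?B \<in> sets M" "?B' \<in> sets M" by auto
  have fin: "emeasure M ?B < \<infinity>" "emeasure M ?B' < \<infinity>"
    using emeasure_cball_finite[of x0 D] emeasure_mono[OF ball_subset_cball sets(1)] by (auto elim: le_less_trans)
  have m: "0 < ?m" by (rule measure_cball_pos[OF D])
  have m': "0 < ?m'"
  proof -
    have "0 < measure M (cball x0 (D / 2))" by (rule measure_cball_pos) (use D in simp)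
    also have "\<dots> \<le> ?m'"
      using fin(2) D by (intro measure_mono_fmeasurable) (auto simp: fmeasurable_def)
    finally show ?thesis .
  qed
  define f where "f x = complex_of_real (1 / ?m') * indicator ?B' x + complex_of_real (- 1 / ?m) * indicator ?B x" for x
  have Lp: "f \<in> Lp_space M q" if "1 \<le> q" for q
    unfolding f_def[abs_def] using fin sets that by (intro Lp_space_add Lp_space_scale indicator_Lp) auto
  have int_f: "(LINT x|M. f x) = 0"
  proof -
    have "integrable M (indicator ?B' :: 'a \<Rightarrow> complex)" "integrable M (indicator ?B :: 'a \<Rightarrow> complex)"
      using indicator_Lp[OF sets(1) fin(1), of 1] indicator_Lp[OF sets(2) fin(2), of 1] by (simp_all add: Lp_1_iff)
    moreover have "(LINT x|M. indicator A x :: complex) = complex_of_real (measure M A)" for A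
      by (subst of_real_indicator[symmetric], subst integral_complex_of_real) simp
    ultimately show ?thesis using m m' by (simp add: f_def)
  qed
  have dist_B: "dist y x0 \<le> D \<longleftrightarrow> dist x x0 \<le> D" "dist y x0 < D \<longleftrightarrow> dist x x0 < D" if "dist x y < D" for x y
    using dist_ultra[of x x0 y] dist_ultra[of y x0 x] that dist_commute[of x y] by linarith+
  have E: "E v f x = (if - ln (\<sigma> (ennreal D)) < v then f x else 0)" if v: "0 < v" for v x
  proof (cases "rad v < D")
    case True
    have "E v f x = f x"
    proof (rule E_eq_const)
      fix y assume "y \<in> cball x (rad v)"
      then have "dist x y < D" using True by simp
      from dist_B[OF this] show "f y = f x" by (simp add: f_def indicator_def dist_commute)
    qed
    then show ?thesis using True eigenvalue_less_iff[OF D v] by simp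
  next
    case False
    have "E v f x = 0"
    proof (cases "\<exists>y\<in>?B. y \<in> cball x (rad v)")
      case True
      then obtain y where y: "dist x0 y \<le> D" "dist x y \<le> rad v" by auto
      have sub: "z \<in> cball x (rad v)" if "z \<in> ?B" for z
        using dist_ultra[of x z y] dist_ultra[of y z x0] that y False dist_commute[of x0 y] by auto
      have "z \<in> ?B" if "f z \<noteq> 0" for z
      proof (rule ccontr)
        assume z: "z \<notin> ?B"
        then have "z \<notin> ?B'" by auto
        then show False using z that by (simp add: f_def del: mem_ball mem_cball)
      qed
      then have "indicator (cball x (rad v)) z *\<^sub>R f z = f z" for z
        using sub[of z] by (cases "f z = 0") (simp_all add: indicator_def)
      then show ?thesis using int_f by (simp add: ball_average_def set_lebesgue_integral_def)
    next
      case False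
      then show ?thesis
        by (intro E_eq_const) (auto simp: f_def indicator_def)
    qed
    then show ?thesis using False eigenvalue_less_iff[OF D v] by simp
  qed
  have "Lp_norm M p f \<noteq> 0"
  proof
    assume "Lp_norm M p f = 0"
    then have AE0: "AE x in M. f x = 0" using Lp_norm_zero_iff[OF Lp[OF p]] p by simp
    let ?C = "cball y0 (D / 2)"
    \<comment> \<open>All points near \<open>y0\<close> have distance exactly \<open>D\<close> from
      \<open>x0\<close>, so only the indicator of the closed ball contributes.\<close>
    have "f y \<noteq> 0" if "y \<in> ?C" for y
    proof -
      have "dist x0 y = D"
        using dist_ultra[of x0 y0 y] dist_ultra[of x0 y y0] that D dist_commute[of y0 y]
        unfolding D_def mem_cball by linarith
      then show ?thesis using m by (simp add: f_def)
    qed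
    then have "AE x in M. x \<notin> ?C" using AE0 by (auto elim!: eventually_mono)
    then have "?C \<in> null_sets M" by (subst AE_iff_null_sets) auto
    then have "measure M ?C = 0" by (simp add: null_sets_def measure_def)
    then show False using measure_cball_pos[of "D / 2" y0] D by simp
  qed
  moreover have "(f, \<lambda>x. complex_of_real (- ln (\<sigma> (ennreal D))) * f x) \<in> Lp_generator M p P"
    using \<sigma>_real_less_1[of D] \<sigma>_pos[of "ennreal D"] D E by (intro generator_eigenfunction Lp p) auto
  ultimately show thesis using that unfolding D_def by blast
qed

lemma spectrum_eq:
  assumes p: "1 \<le> p"
  shows "Lp_spectrum M p (Lp_generator M p P) = closure (complex_of_real ` eigenvalues)"
proof (intro set_eqI iffI)
  fix z assume z: "z \<in> closure (complex_of_real ` eigenvalues)"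
  show "z \<in> Lp_spectrum M p (Lp_generator M p P)"
  proof (rule approximate_eigenvalue_in_spectrum[OF p])
    fix e :: real assume e: "0 < e"
    have "0 < e / 2" using e by simp
    with z have "\<exists>y\<in>complex_of_real ` eigenvalues. dist y z < e / 2"
      unfolding closure_approachable by blast
    then obtain l where l: "l \<in> eigenvalues" "dist (complex_of_real l) z < e / 2" by blast
    \<comment> \<open>Only \<open>l = 0\<close> is delicate: either some distance exceeds
      \<open>rad (e / 2)\<close> and has its value below \<open>e / 2\<close>, or the whole space is
      one ball and carries constant eigenfunctions.\<close>
    consider x y :: 'a where "x \<noteq> y" "norm (z - complex_of_real (- ln (\<sigma> (ennreal (dist x y))))) < e"
      | "norm z < e" "\<And>x y :: 'a. dist x y \<le> rad (e / 2)"
    proof (cases "l = 0")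
      case False
      then obtain x y :: 'a where "x \<noteq> y" "l = - ln (\<sigma> (ennreal (dist x y)))"
        using l(1) by (auto simp: eigenvalues_def)
      then show ?thesis using that(1)[of x y] l(2) e by (simp add: dist_norm norm_minus_commute)
    next
      case True
      then have z2: "norm z < e / 2" using l(2) by (simp add: dist_norm)
      show ?thesis
      proof (cases "\<exists>x y :: 'a. rad (e / 2) < dist x y")
        case True
        then obtain x y :: 'a where xy: "rad (e / 2) < dist x y" by blast
        let ?l = "- ln (\<sigma> (ennreal (dist x y)))"
        have pos: "0 < dist x y" using xy rad_pos[of "e / 2"] by linarith
        then have l: "?l < e / 2" "?l \<in> eigenvalues"
          using eigenvalue_less_iff[OF pos, of "e / 2"] xy e eigenvalueI[of x y] by auto
        have "norm (z - complex_of_real ?l) \<le> norm z + norm (complex_of_real ?l)" by (rule norm_triangle_ineq4)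
        also have "norm (complex_of_real ?l) = ?l" using eigenvalues_nonneg[OF l(2)] by (simp only: norm_of_real abs_of_nonneg)
        finally have "norm (z - complex_of_real ?l) < e" using z2 l(1) by linarith
        moreover have "x \<noteq> y" using pos by auto
        ultimately show ?thesis using that(1) by blast
      next
        case False
        then have "dist x y \<le> rad (e / 2)" for x y :: 'a by (simp add: not_less)
        moreover have "norm z < e" using z2 e by linarith
        ultimately show ?thesis using that(2) by blast
      qed
    qed
    then show "\<exists>f l. (f, \<lambda>x. l * f x) \<in> Lp_generator M p P \<and> Lp_norm M p f \<noteq> 0 \<and> norm (z - l) < e"
    proof cases
      case (1 x y)
      obtain f where "Lp_norm M p f \<noteq> 0"
        "(f, \<lambda>a. complex_of_real (- ln (\<sigma> (ennreal (dist x y)))) * f a) \<in> Lp_generator M p P"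
        using eigenfunction[OF p 1(1)] by blast
      then show ?thesis using 1(2) by blast
    next
      case 2
      have U: "UNIV = cball (undefined :: 'a) (rad (e / 2))" using 2(2) by auto
      have fin: "emeasure M UNIV < \<infinity>" using emeasure_cball_finite[of undefined "rad (e / 2)"] unfolding U .
      let ?f = "indicator UNIV :: 'a \<Rightarrow> complex"
      have f: "?f \<in> Lp_space M p" using fin by (intro indicator_Lp) auto
      have "(?f, \<lambda>x. complex_of_real 0 * ?f x) \<in> Lp_generator M p P"
        by (rule generator_eigenfunction[OF f p]) (simp_all add: E_const)
      moreover have "Lp_norm M p ?f \<noteq> 0"
      proof
        assume "Lp_norm M p ?f = 0"
        then have "AE x in M. (x::'a) \<notin> UNIV" using Lp_norm_zero_iff[OF f] p by simp
        then have "UNIV \<in> null_sets M" by (subst AE_iff_null_sets) auto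
        then have "measure M UNIV = 0" by (simp add: null_sets_def measure_def)
        then show False using measure_cball_pos[OF rad_pos[of "e / 2"], of undefined] unfolding U by simp
      qed
      ultimately show ?thesis using 2(1) by (intro exI[of _ ?f] exI[of _ "complex_of_real 0"]) simp
    qed
  qed
next
  fix z assume spec: "z \<in> Lp_spectrum M p (Lp_generator M p P)"
  show "z \<in> closure (complex_of_real ` eigenvalues)"
  proof (rule ccontr)
    assume "z \<notin> closure (complex_of_real ` eigenvalues)"
    then obtain d where d: "0 < d" "\<And>l. l \<in> eigenvalues \<Longrightarrow> d \<le> norm (z - complex_of_real l)"
      unfolding closure_approachable by (force simp: dist_norm norm_minus_commute not_less)
    have "z \<in> Lp_resolvent_set M p (Lp_generator M p P)"
    proof (cases "Im z = 0 \<and> 0 \<le> Re z")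
      case True
      define r where "r = Re z"
      have z: "z = complex_of_real r" using True by (simp add: r_def complex_eq_iff)
      have dr: "d \<le> \<bar>r - l\<bar>" if "l \<in> eigenvalues" for l
        using d(2)[OF that] unfolding z of_real_diff[symmetric] norm_of_real .
      have r: "d \<le> r" using dr[of 0] True by (simp add: eigenvalues_def r_def)
      show ?thesis unfolding z
      \<comment> \<open>Half of \<open>d\<close> makes the closed interval avoid all values; it
        stays positive because 0 is one of them, whence \<open>d \<le> r\<close>.\<close>
      proof (rule resolvent_in_gap[OF p, of "d / 2"])
        fix v f assume v: "v \<in> {r - d / 2..r + d / 2}"
        show "E v f = E (r - d / 2) f"
        proof (rule E_const_on_gap[OF _ _ v])
          show "{r - d / 2..r + d / 2} \<inter> eigenvalues = {}"
          proof (rule ccontr)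
            assume "{r - d / 2..r + d / 2} \<inter> eigenvalues \<noteq> {}"
            then obtain l where "l \<in> eigenvalues" "r - d / 2 \<le> l" "l \<le> r + d / 2" by auto
            then show False using dr[of l] d(1) by (simp add: abs_if split: if_splits)
          qed
        qed (use r d(1) in simp)
      qed (use r d(1) in simp_all)
    next
      case False
      \<comment> \<open>A positive lower bound for the distance from \<open>z\<close> to the
        half-line: the imaginary part to the right of the imaginary axis, the real part to the left
        of it.\<close>
      define c where "c = (if 0 \<le> Re z then \<bar>Im z\<bar> else - Re z)"
      show ?thesis
      proof (rule resolvent_off_halfline[OF p, of c])
        show "0 < c" using False by (auto simp: c_def)
        fix v :: real assume v: "0 \<le> v"
        show "c \<le> norm (z - complex_of_real v)"
          using abs_Im_le_cmod[of "z - complex_of_real v"] abs_Re_le_cmod[of "z - complex_of_real v"] v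
          by (auto simp: c_def)
      qed
    qed
    then show False using spec by (simp add: Lp_spectrum_def)
  qed
qed

end

theorem theorem3p13:
  fixes M :: "'a::{metric_space, second_countable_topology} measure"
    and \<sigma> :: "ennreal \<Rightarrow> real"
    and p :: real
  assumes "ultrametric TYPE('a)"
    and "\<And>(x :: 'a) r. compact (cball x r)"
    and "radon_measure M"
    and "full_support M"
    and "distance_distribution \<sigma>"
    and "1 \<le> p"
  shows "Lp_spectrum M p (isotropic_generator M \<sigma> p) = Lp_spectrum M 2 (isotropic_generator M \<sigma> 2)"
proof -
  interpret isotropic M \<sigma>
    using assms(1-5) by unfold_locales
  show ?thesis
    using isotropic_generator_eq spectrum_eq assms(6) by simp
qed

end
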